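(* Let $d\ge 1$ be an integer and $\vec{\mu}=(\mu_0,\dots,\mu_{d-1})$ a probability distribution with $\max_i\mu_i\in[1/d,\,3-2\sqrt2]$ (so necessarily $d\ge 6$). Let $\mathcal{O}_{\vec{\mu}}$ be the generalized platypus channel associated with $\vec{\mu}$. Then there exists $\lambda\in[0,1]$ such that $$Q(\mathcal{O}_{\vec{\mu}}\otimes\mathcal{E}_{\lambda,d})>Q(\mathcal{O}_{\vec{\mu}})+Q(\mathcal{E}_{\lambda,d}).$$
   Context: Logarithms are base 2. Generalized platypus channel: let $A$ and $B$ be $(d+1)$-dimensional Hilbert spaces with computational bases $\{|i\rangle\}_{i=0}^{d}$ and $E$ a $d$-dimensional Hilbert space with basis $\{|j\rangle\}_{j=0}^{d-1}$. Define the isometry $V:A\to B\otimes E$ by $V|0\rangle=\sum_{j=0}^{d-1}\sqrt{\mu_j}\,|j\rangle_B\otimes|j\rangle_E$ and $V|i\rangle=|d\rangle_B\otimes|i-1\rangle_E$ for $i=1,\dots,d$; $\mathcal{O}_{\vec{\mu}}(\rho)=\mathrm{Tr}_E(V\rho V^\dagger)$. Qudit erasure channel: $\mathcal{E}_{\lambda,d}$ maps states on a $d$-dimensional space $A'$ to states on the $(d+1)$-dimensional space $A'\oplus\mathrm{span}\{|e\rangle\}$ by $\mathcal{E}_{\lambda,d}(\rho)=(1-\lambda)\rho+\lambda|e\rangle\langle e|$, with $|e\rangle$ orthogonal to $A'$. For a channel $\mathcal{N}$ with complementary channel $\mathcal{N}^c$, $Q^{(1)}(\mathcal{N})=\max_\rho[S(\mathcal{N}(\rho))-S(\mathcal{N}^c(\rho))]$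 ($S$ = von Neumann entropy) and the quantum capacity is $Q(\mathcal{N})=\lim_{n\to\infty}\frac1nQ^{(1)}(\mathcal{N}^{\otimes n})$. *)

theory Defs
  imports Complex_Main "Jordan_Normal_Form.Char_Poly"
begin

definition adj :: "complex mat \<Rightarrow> complex mat" where
  "adj A = mat (dim_col A) (dim_row A) (\<lambda>(i,j). cnj (A $$ (j,i)))"

definition mtrace :: "complex mat \<Rightarrow> complex" where
  "mtrace A = (\<Sum>i<dim_row A. A $$ (i,i))"

definition density :: "nat \<Rightarrow> complex mat \<Rightarrow> bool" where
  "density n \<rho> \<longleftrightarrow> \<rho> \<in> carrier_mat n n \<and> adj \<rho> = \<rho> \<and>
     (\<forall>v :: nat \<Rightarrow> complex. 0 \<le> Re (\<Sum>i<n. \<Sum>j<n. cnj (v i) * \<rho> $$ (i,j) * v j)) \<and>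
     mtrace \<rho> = 1"

definition eta :: "real \<Rightarrow> real" where
  "eta t = (if t > 0 then t * log 2 t else 0)"

definition vN_entropy :: "complex mat \<Rightarrow> real" where
  "vN_entropy \<rho> = - (\<Sum>x\<in># proots (char_poly \<rho>). eta (Re x))"

text \<open>Partial traces on C^dB (x) C^dE, basis index |b>|e> ~ b * dE + e.\<close>
definition ptrace_E :: "nat \<Rightarrow> nat \<Rightarrow> complex mat \<Rightarrow> complex mat" where
  "ptrace_E dB dE X = mat dB dB (\<lambda>(i,j). \<Sum>k<dE. X $$ (i*dE+k, j*dE+k))"

definition ptrace_B :: "nat \<Rightarrow> nat \<Rightarrow> complex mat \<Rightarrow> complex mat" where
  "ptrace_B dB dE X = mat dE dE (\<lambda>(k,l). \<Sum>i<dB. X $$ (i*dE+k, i*dE+l))"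

record stinespring =
  s_in :: nat
  s_outB :: nat
  s_outE :: nat
  s_iso :: "complex mat"

definition conj_iso :: "stinespring \<Rightarrow> complex mat \<Rightarrow> complex mat" where
  "conj_iso W \<rho> = s_iso W * \<rho> * adj (s_iso W)"

definition chan :: "stinespring \<Rightarrow> complex mat \<Rightarrow> complex mat" where
  "chan W \<rho> = ptrace_E (s_outB W) (s_outE W) (conj_iso W \<rho>)"

definition chan_c :: "stinespring \<Rightarrow> complex mat \<Rightarrow> complex mat" where
  "chan_c W \<rho> = ptrace_B (s_outB W) (s_outE W) (conj_iso W \<rho>)"

definition coh_info :: "stinespring \<Rightarrow> complex mat \<Rightarrow> real" where
  "coh_info W \<rho> = vN_entropy (chan W \<rho>) - vN_entropy (chan_c W \<rho>)"

definition Q1 :: "stinespring \<Rightarrow> real" where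
  "Q1 W = Sup {coh_info W \<rho> | \<rho>. density (s_in W) \<rho>}"

text \<open>Tensor product of channels N1 (x) N2: isometry V1 (x) V2, with outputs regrouped as
  (B1 (x) B2) (x) (E1 (x) E2).\<close>
definition tensor_iso :: "stinespring \<Rightarrow> stinespring \<Rightarrow> stinespring" where
  "tensor_iso W1 W2 =
    (let A1 = s_in W1; A2 = s_in W2; B1 = s_outB W1; B2 = s_outB W2;
         E1 = s_outE W1; E2 = s_outE W2 in
     \<lparr> s_in = A1 * A2, s_outB = B1 * B2, s_outE = E1 * E2,
       s_iso = mat (B1 * B2 * (E1 * E2)) (A1 * A2) (\<lambda>(r,c).
         let b = r div (E1 * E2); e = r mod (E1 * E2) in
         s_iso W1 $$ ((b div B2) * E1 + e div E2, c div A2) *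
         s_iso W2 $$ ((b mod B2) * E2 + e mod E2, c mod A2)) \<rparr>)"

definition unit_iso :: stinespring where
  "unit_iso = \<lparr> s_in = 1, s_outB = 1, s_outE = 1, s_iso = mat 1 1 (\<lambda>_. 1) \<rparr>"

fun tensor_pow :: "stinespring \<Rightarrow> nat \<Rightarrow> stinespring" where
  "tensor_pow W 0 = unit_iso"
| "tensor_pow W (Suc n) = tensor_iso (tensor_pow W n) W"

definition Qcap :: "stinespring \<Rightarrow> real" where
  "Qcap W = lim (\<lambda>n. Q1 (tensor_pow W (Suc n)) / real (Suc n))"

text \<open>A = C^(d+1), B = C^(d+1), E = C^d;
  V|0> = sum_j sqrt(mu_j) |j>_B |j>_E,  V|i> = |d>_B |i-1>_E (1 \<le> i \<le> d).\<close>
definition platypus :: "nat \<Rightarrow> (nat \<Rightarrow> real) \<Rightarrow> stinespring" where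
  "platypus d \<mu> = \<lparr> s_in = d + 1, s_outB = d + 1, s_outE = d,
     s_iso = mat ((d + 1) * d) (d + 1) (\<lambda>(r,a).
       let b = r div d; e = r mod d in
       if a = 0 then (if b < d \<and> b = e then complex_of_real (sqrt (\<mu> b)) else 0)
       else (if b = d \<and> e = a - 1 then 1 else 0)) \<rparr>"

text \<open>Qudit erasure channel A' = C^d \<rightarrow> A' \<oplus> span{|e>} = C^(d+1), with |e> = |d>;
  Stinespring isometry V|i> = sqrt(1-lambda) |i>_B |e>_E + sqrt(lambda) |e>_B |i>_E, E = C^(d+1).\<close>
definition erasure :: "nat \<Rightarrow> real \<Rightarrow> stinespring" where
  "erasure d lam = \<lparr> s_in = d, s_outB = d + 1, s_outE = d + 1,
     s_iso = mat ((d + 1) * (d + 1)) d (\<lambda>(r,a).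
       let b = r div (d + 1); e = r mod (d + 1) in
       (if b = a \<and> e = d then complex_of_real (sqrt (1 - lam)) else 0) +
       (if b = d \<and> e = a then complex_of_real (sqrt lam) else 0)) \<rparr>"

end

theory Submission
  imports Defs "HOL-Computational_Algebra.Fundamental_Theorem_Algebra"
begin

text \<open>
  We take \<open>lam = 1/2\<close>. The Stinespring isometry of the erasure channel is then symmetric under exchange
  of output and environment, so its coherent informations, and those of its tensor powers, all vanish.

  Upper bound \<open>Q(O) \<le> log (1 + sqrt \<mu>_max) \<le> 1/2\<close>: measuring the output in the eigenbasis of \<open>K\<close>
  and the environment in its own, concavity of the logarithm gives \<open>S(B) - S(E) \<le> 2 log Tr K\<close> with
  \<open>K^2 = \<Sum>k. \<epsilon>_k A_k \<rho> A_k^*\<close>, where the \<open>A_k\<close> are the Kraus operators in the eigenbasis of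
  the environment state and \<open>\<epsilon>_k\<close> are its eigenvalues. The operators \<open>sqrt \<epsilon>_k sqrt \<rho> A_k^* K^(-1)\<close>
  form a trace non-increasing recovery operation, which turns \<open>(Tr K)^2\<close> into a quantity linear in the Choi
  matrix. Moving the partial transpose over, it is bounded by any multiplicative bound on the partially transposed
  Choi matrix, so that the estimate tensorises.

  Lower bound for the joint channel: on the mixture of \<open>|0>|j0>\<close> and of the vector
  \<open>\<Sum>j. sqrt \<mu>_j |j+1>|j>\<close> with equal weights the output is diagonal, whereas the environment state is a sum
  of rank-one operators of which two are not orthogonal. Its entropy is therefore strictly below the Shannon entropy of their weights,
  and the coherent information exceeds \<open>1/2\<close>.

  The limits in \<open>Qcap\<close> exist since coherent information is superadditive under tensor products.
\<close>

section \<open>Spectral theorem\<close>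

text \<open>The hypothesis on the largest weight says exactly
  \<open>1 + sqrt \<mu>_max \<le> sqrt 2\<close>, and the joint input would give coherent
  information exactly \<open>1/2\<close> if the environment terms were orthogonal. The two bounds
  thus meet at \<open>1/2\<close> with no room to spare, and the strict inequality rests on a single
  overlap, \<open>\<mu> j0 / 4\<close>.

  The obstacle is the upper bound: \<open>Q\<close> is regularised, so every entangled input of
  every tensor power has to be controlled. The bound is of the type
  \<open>Q(N) \<le> log ||T o N||\<close>, with the diamond norm of the channel followed by
  transposition. In place of the norm, an explicit factorisation of the partially transposed Choi
  matrix with diagonal marginals is carried along. Such factorisations are multiplied entry by
  entry, so multiplicativity needs no duality argument. As the capacity is defined by entropies and
  not by codes, the bound has to be reached from the coherent information of one arbitrary state;
  this is why a recovery operation adapted to that state is built.\<close>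

definition orthonormal :: "'i set \<Rightarrow> 'x set \<Rightarrow> ('i \<Rightarrow> 'x \<Rightarrow> complex) \<Rightarrow> bool" where
  "orthonormal I X u \<longleftrightarrow>
     (\<forall>i\<in>I. \<forall>j\<in>I. (\<Sum>x\<in>X. cnj (u i x) * u j x) = (if i = j then 1 else 0))"

definition spectral :: "nat \<Rightarrow> (nat \<Rightarrow> nat \<Rightarrow> complex) \<Rightarrow> (nat \<Rightarrow> nat \<Rightarrow> complex) \<Rightarrow> (nat \<Rightarrow> real) \<Rightarrow> bool" where
  "spectral n M u l \<longleftrightarrow> orthonormal {..<n} {..<n} u \<and>
     (\<forall>x<n. \<forall>y<n. (\<Sum>k<n. u k x * cnj (u k y)) = (if x = y then 1 else 0)) \<and>
     (\<forall>x<n. \<forall>y<n. M x y = (\<Sum>k<n. of_real (l k) * (u k x * cnj (u k y))))"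

lemma orthonormalD:
  "orthonormal I X u \<Longrightarrow> i \<in> I \<Longrightarrow> j \<in> I \<Longrightarrow>
     (\<Sum>x\<in>X. cnj (u i x) * u j x) = (if i = j then 1 else 0)"
  by (auto simp: orthonormal_def)

lemma complex_mult_cnj_cmod: "z * cnj z = complex_of_real ((cmod z)\<^sup>2)"
  by (simp only: complex_norm_square)

lemma cnj_mult_cmod: "cnj z * z = complex_of_real ((cmod z)\<^sup>2)"
  by (simp only: complex_norm_square mult.commute)

text \<open>For square matrices a one-sided inverse is two-sided: orthonormality reads
  \<open>P * Q = 1\<close>, completeness reads \<open>Q * P = 1\<close>.\<close>

lemma orthonormal_complete:
  fixes u :: "nat \<Rightarrow> nat \<Rightarrow> complex"
  assumes "orthonormal {..<n} {..<n} u" "x < n" "y < n"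
  shows "(\<Sum>k<n. u k x * cnj (u k y)) = (if x = y then 1 else 0)"
proof -
  define P where "P = mat n n (\<lambda>(i,j). cnj (u i j))"
  define Q where "Q = mat n n (\<lambda>(i,j). u j i)"
  have P: "P \<in> carrier_mat n n" and Q: "Q \<in> carrier_mat n n" by (auto simp: P_def Q_def)
  have PQ: "P * Q = 1\<^sub>m n"
    using orthonormalD[OF assms(1)]
    by (intro eq_matI) (auto simp: P_def Q_def scalar_prod_def atLeast0LessThan)
  have QP: "Q * P = 1\<^sub>m n"
    using mat_mult_left_right_inverse[OF P Q PQ] .
  have "(Q * P) $$ (x, y) = (\<Sum>k<n. u k x * cnj (u k y))"
    using assms(2,3) by (simp add: P_def Q_def scalar_prod_def atLeast0LessThan)
  with QP show ?thesis using assms(2,3) by simp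
qed

lemma unit_eigenvector_exists:
  fixes M :: "nat \<Rightarrow> nat \<Rightarrow> complex"
  assumes "n > 0"
  obtains v e where "(\<Sum>x<n. cnj (v x) * v x) = 1" "\<And>x. x < n \<Longrightarrow> (\<Sum>z<n. M x z * v z) = e * v x"
    "Re (v 0) \<le> 0" "Im (v 0) = 0"
proof -
  define A where "A = mat n n (\<lambda>(i,j). M i j)"
  have A: "A \<in> carrier_mat n n" by (simp add: A_def)
  have "degree (char_poly A) = n" using degree_monic_char_poly[OF A] by simp
  then have "\<not> constant (poly (char_poly A))" using assms by (simp add: constant_degree)
  then obtain e where "poly (char_poly A) e = 0"
    using fundamental_theorem_of_algebra by blast
  then have "eigenvalue A e" using eigenvalue_root_char_poly[OF A] by simp
  then obtain w where w: "w \<in> carrier_vec n" "w \<noteq> 0\<^sub>v n" "A *\<^sub>v w = e \<cdot>\<^sub>v w"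
    using A unfolding eigenvalue_def eigenvector_def by auto
  have wM: "(\<Sum>z<n. M x z * w $ z) = e * w $ x" if "x < n" for x
  proof -
    have "(A *\<^sub>v w) $ x = (\<Sum>z<n. M x z * w $ z)"
      using w(1) that by (simp add: A_def scalar_prod_def atLeast0LessThan)
    then show ?thesis using w that by simp
  qed
  define N where "N = (\<Sum>x<n. (cmod (w $ x))\<^sup>2)"
  have "N \<noteq> 0"
  proof
    assume "N = 0"
    then have "\<forall>x<n. w $ x = 0" unfolding N_def by (subst (asm) sum_nonneg_eq_0_iff) auto
    then have "w = 0\<^sub>v n" using w(1) by (intro eq_vecI) auto
    with w(2) show False by simp
  qed
  then have N: "N > 0" unfolding N_def by (metis sum_nonneg zero_le_power2 order_le_less)
  \<comment> \<open>A phase that turns the entry at 0 into a nonpositive real number; if that entry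
    is 0, any phase serves.\<close>
  define c where "c = (if w $ 0 = 0 then 1 else - cnj (w $ 0) / cmod (w $ 0))"
  have c: "cmod c = 1" by (simp add: c_def norm_divide)
  have c0: "c * w $ 0 = - of_real (cmod (w $ 0))"
    by (auto simp: c_def cnj_mult_cmod power2_eq_square)
  define v where "v = (\<lambda>x. c * w $ x / of_real (sqrt N))"
  show thesis
  proof (rule that[of v e])
    have "(\<Sum>x<n. cnj (v x) * v x) = of_real (\<Sum>x<n. (cmod (w $ x))\<^sup>2 / N)"
      unfolding of_real_sum cnj_mult_cmod v_def using N
      by (simp add: norm_mult norm_divide c power_divide)
    also have "\<dots> = 1" using N unfolding N_def by (simp add: sum_divide_distrib[symmetric])
    finally show "(\<Sum>x<n. cnj (v x) * v x) = 1" .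
    show "(\<Sum>z<n. M x z * v z) = e * v x" if "x < n" for x
      using wM[OF that] by (simp add: v_def mult.left_commute sum_distrib_left[symmetric]
          sum_divide_distrib[symmetric])
    have "v 0 = - of_real (cmod (w $ 0) / sqrt N)" by (simp add: v_def c0)
    then show "Re (v 0) \<le> 0" "Im (v 0) = 0" using N by auto
  qed
qed

text \<open>The sign condition on \<open>v 0\<close> keeps the reflection vector \<open>e_0 - v\<close> away from \<open>0\<close>.\<close>

lemma householder:
  fixes v :: "nat \<Rightarrow> complex"
  assumes v: "(\<Sum>x<n. cnj (v x) * v x) = 1" "Re (v 0) \<le> 0" "Im (v 0) = 0" and n: "n > 0"
  obtains u where "orthonormal {..<n} {..<n} u" "\<And>x. x < n \<Longrightarrow> u 0 x = v x"
proof -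
  define w where "w = (\<lambda>x. (if x = 0 then 1 else 0) - v x)"
  define r where "r = Re (v 0)"
  have v0: "v 0 = of_real r" using v by (simp add: r_def complex_eq_iff)
  have r: "r \<le> 0" using v by (simp add: r_def)
  \<comment> \<open>The squared norm of \<open>w\<close>, namely
    \<open>|e_0|^2 + |v|^2 - 2 Re (v 0)\<close>; it is at least 2 because
    \<open>r \<le> 0\<close>.\<close>
  define N where "N = complex_of_real (2 - 2 * r)"
  have N0: "N \<noteq> 0" using r by (simp add: N_def)
  have wN: "(\<Sum>x<n. cnj (w x) * w x) = N"
  proof -
    have "(\<Sum>x<n. cnj (w x) * w x) = (\<Sum>x<n. (if x = 0 then 1 - v 0 - cnj (v 0) else 0) + cnj (v x) * v x)"
      by (intro sum.cong) (auto simp: w_def algebra_simps)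
    also have "\<dots> = N" using n by (simp add: sum.distrib v(1) v0 N_def sum.delta)
    finally show ?thesis .
  qed
  \<comment> \<open>The columns of the reflection \<open>1 - 2 w w^* / N\<close>. Since
    \<open>2 * cnj (w 0) = N\<close>, it maps \<open>e_0\<close> to
    \<open>e_0 - w = v\<close>.\<close>
  define u where "u = (\<lambda>k x. (if k = x then 1 else 0) - 2 * w x * cnj (w k) / N)"
  have cN: "cnj N = N" by (simp add: N_def)
  show thesis
  proof (rule that[of u])
    show "orthonormal {..<n} {..<n} u" unfolding orthonormal_def
    proof (intro ballI)
      fix i j assume ij: "i \<in> {..<n}" "j \<in> {..<n}"
      define K where "K = 4 * w i * cnj (w j) / N\<^sup>2"
      have K: "K * N = 4 * w i * cnj (w j) / N" using N0 by (simp add: K_def power2_eq_square)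
      have "(\<Sum>x<n. cnj (u i x) * u j x) =
        (\<Sum>x<n. (if x = i then (if i = j then 1 else 0) else 0) - (if x = i then 2 * w i * cnj (w j) / N else 0)
           - (if x = j then 2 * w i * cnj (w j) / N else 0) + K * (cnj (w x) * w x))"
        by (intro sum.cong) (auto simp: u_def K_def cN algebra_simps power2_eq_square)
      also have "\<dots> = (if i = j then 1 else 0)"
        using ij N0 by (simp add: sum.distrib sum_subtractf sum_distrib_left[symmetric] wN sum.delta K)
      finally show "(\<Sum>x<n. cnj (u i x) * u j x) = (if i = j then 1 else 0)" .
    qed
    show "u 0 x = v x" if "x < n" for x
    proof -
      have "2 * cnj (w 0) = N" by (simp add: w_def v0 N_def)
      then have "2 * w x * cnj (w 0) / N = w x" using N0
        by (metis mult.commute mult.left_commute nonzero_mult_div_cancel_right)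
      then show ?thesis by (auto simp: u_def w_def)
    qed
  qed
qed

lemma orthonormal_expand:
  fixes u :: "nat \<Rightarrow> nat \<Rightarrow> complex"
  assumes "orthonormal {..<n} {..<n} u" "x < n"
  shows "(\<Sum>k<n. (\<Sum>y<n. cnj (u k y) * f y) * u k x) = f x"
proof -
  have "(\<Sum>k<n. (\<Sum>y<n. cnj (u k y) * f y) * u k x) = (\<Sum>k<n. \<Sum>y<n. f y * (u k x * cnj (u k y)))"
    by (simp only: sum_distrib_left sum_distrib_right ac_simps)
  also have "\<dots> = (\<Sum>y<n. f y * (\<Sum>k<n. u k x * cnj (u k y)))"
    by (subst sum.swap) (simp add: sum_distrib_left)
  also have "\<dots> = (\<Sum>y<n. if y = x then f y else 0)"
    using orthonormal_complete[OF assms(1,2)] by (intro sum.cong) auto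
  finally show ?thesis using assms(2) by (simp add: sum.delta)
qed

text \<open>Deflation: a unitary basis starting with one unit eigenvector turns \<open>M\<close>
  into \<open>T\<close>, which leaves a Hermitian block of size one less for the induction.\<close>

lemma hermitian_eigenbasis:
  fixes M :: "nat \<Rightarrow> nat \<Rightarrow> complex"
  assumes "\<And>x y. x < n \<Longrightarrow> y < n \<Longrightarrow> cnj (M x y) = M y x"
  shows "\<exists>u e. orthonormal {..<n} {..<n} u \<and> (\<forall>k<n. \<forall>x<n. (\<Sum>z<n. M x z * u k z) = e k * u k x)"
  using assms
proof (induction n arbitrary: M)
  case 0
  then show ?case by (auto simp: orthonormal_def)
next
  case (Suc n)
  let ?N = "{..<Suc n}"
  obtain v e0 where v: "(\<Sum>x<Suc n. cnj (v x) * v x) = 1"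
    and ev: "\<And>x. x < Suc n \<Longrightarrow> (\<Sum>z<Suc n. M x z * v z) = e0 * v x"
    and v0: "Re (v 0) \<le> 0" "Im (v 0) = 0"
    using unit_eigenvector_exists[of "Suc n" M] by blast
  obtain u where u: "orthonormal ?N ?N u" and u0: "\<And>x. x < Suc n \<Longrightarrow> u 0 x = v x"
    using householder[OF v v0] by blast
  define T where "T = (\<lambda>j k. \<Sum>y<Suc n. cnj (u j y) * (\<Sum>z<Suc n. M y z * u k z))"
  have Tc: "cnj (T j k) = T k j" for j k
  proof -
    have "cnj (T j k) = (\<Sum>y<Suc n. \<Sum>z<Suc n. u j y * (M z y * cnj (u k z)))"
      unfolding T_def cnj_sum sum_distrib_left using Suc.prems by (intro sum.cong refl) auto
    also have "\<dots> = T k j"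
      unfolding T_def by (subst sum.swap) (simp only: sum_distrib_left ac_simps)
    finally show ?thesis .
  qed
  have T0: "T j 0 = (if j = 0 then e0 else 0)" if "j < Suc n" for j
  proof -
    have "T j 0 = (\<Sum>y<Suc n. e0 * (cnj (u j y) * u 0 y))"
      unfolding T_def using ev u0 by (intro sum.cong refl) simp
    also have "\<dots> = e0 * (if j = 0 then 1 else 0)"
      unfolding sum_distrib_left[symmetric] using orthonormalD[OF u, of j 0] that by simp
    finally show ?thesis by simp
  qed
  have MT: "(\<Sum>z<Suc n. M x z * u k z) = (\<Sum>j<Suc n. T j k * u j x)" if "x < Suc n" for x k
    using orthonormal_expand[OF u that, of "\<lambda>y. \<Sum>z<Suc n. M y z * u k z"] by (simp only: T_def)
  \<comment> \<open>By Hermiticity the first row of \<open>T\<close> vanishes together with its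
    first column off the diagonal, so \<open>T\<close> is block diagonal.\<close>
  have T0': "T 0 (Suc k) = 0" if "k < n" for k
    using Tc[of "Suc k" 0] T0[of "Suc k"] that by simp
  obtain u' e' where u': "orthonormal {..<n} {..<n} u'"
    and e': "\<And>k x. k < n \<Longrightarrow> x < n \<Longrightarrow> (\<Sum>z<n. T (Suc x) (Suc z) * u' k z) = e' k * u' k x"
    using Suc.IH[of "\<lambda>j k. T (Suc j) (Suc k)"] Tc by blast
  \<comment> \<open>The eigenvectors of the lower block are coordinates with respect to the vectors
    \<open>u (Suc j)\<close> and are carried back to the original space.\<close>
  define U where "U = (\<lambda>k x. case k of 0 \<Rightarrow> u 0 x | Suc k \<Rightarrow> \<Sum>j<n. u' k j * u (Suc j) x)"
  define E where "E = (\<lambda>k. case k of 0 \<Rightarrow> e0 | Suc k \<Rightarrow> e' k)"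
  have US: "(\<Sum>x<Suc n. cnj (u i x) * U (Suc k) x) = (if i = 0 then 0 else u' k (i - 1))"
    if "i < Suc n" for i k
  proof -
    have "(\<Sum>x<Suc n. cnj (u i x) * U (Suc k) x) = (\<Sum>j<n. u' k j * (\<Sum>x<Suc n. cnj (u i x) * u (Suc j) x))"
      unfolding U_def by (simp add: sum_distrib_left del: sum.lessThan_Suc)
       (subst sum.swap, simp add: algebra_simps)
    also have "\<dots> = (\<Sum>j<n. if j = i - 1 then (if i = 0 then 0 else u' k j) else 0)"
      using orthonormalD[OF u, of i] that by (intro sum.cong refl) auto
    also have "\<dots> = (if i = 0 then 0 else u' k (i - 1))"
      using that by (auto simp: sum.delta)
    finally show ?thesis .
  qed
  have orth: "orthonormal ?N ?N U" unfolding orthonormal_def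
  proof (intro ballI)
    fix i k assume ik: "i \<in> ?N" "k \<in> ?N"
    show "(\<Sum>x<Suc n. cnj (U i x) * U k x) = (if i = k then 1 else 0)"
    proof (cases i)
      case 0
      show ?thesis
      proof (cases k)
        case 0
        then show ?thesis using \<open>i = 0\<close> orthonormalD[OF u, of 0 0] by (simp add: U_def)
      next
        case (Suc k')
        then show ?thesis using \<open>i = 0\<close> US[of 0 k'] by (simp add: U_def)
      qed
    next
      case (Suc i')
      note i = this
      show ?thesis
      proof (cases k)
        case 0
        have "(\<Sum>x<Suc n. cnj (U i x) * U k x) = cnj (\<Sum>x<Suc n. cnj (U k x) * U i x)"
          by (simp add: mult.commute)
        also have "\<dots> = 0" using 0 i US[of 0 i'] by (simp add: U_def)
        finally show ?thesis using 0 i by simp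
      next
        case (Suc k')
        have "(\<Sum>x<Suc n. cnj (U i x) * U k x)
            = (\<Sum>j<n. cnj (u' i' j) * (\<Sum>x<Suc n. cnj (u (Suc j) x) * U k x))"
          unfolding U_def i by (simp add: sum_distrib_left sum_distrib_right del: sum.lessThan_Suc)
           (subst sum.swap, simp add: algebra_simps)
        also have "\<dots> = (\<Sum>j<n. cnj (u' i' j) * u' k' j)"
          unfolding Suc using US by (intro sum.cong refl) simp
        finally show ?thesis using ik orthonormalD[OF u', of i' k'] i Suc by simp
      qed
    qed
  qed
  have "(\<Sum>z<Suc n. M x z * U k z) = E k * U k x" if kx: "k < Suc n" "x < Suc n" for k x
  proof (cases k)
    case 0
    then show ?thesis using ev[OF kx(2)] u0 kx by (simp add: U_def E_def)
  next
    case (Suc k')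
    have "(\<Sum>z<Suc n. M x z * U k z) = (\<Sum>j<n. u' k' j * (\<Sum>z<Suc n. M x z * u (Suc j) z))"
      unfolding U_def Suc by (simp add: sum_distrib_left del: sum.lessThan_Suc)
       (subst sum.swap, simp add: algebra_simps)
    also have "\<dots> = (\<Sum>j<n. u' k' j * (\<Sum>i<n. T (Suc i) (Suc j) * u (Suc i) x))"
    proof (rule sum.cong[OF refl])
      fix j assume j: "j \<in> {..<n}"
      have "(\<Sum>z<Suc n. M x z * u (Suc j) z) = (\<Sum>i<n. T (Suc i) (Suc j) * u (Suc i) x)"
        unfolding MT[OF kx(2)] using j by (subst sum.lessThan_Suc_shift) (simp add: T0')
      then show "u' k' j * (\<Sum>z<Suc n. M x z * u (Suc j) z)
          = u' k' j * (\<Sum>i<n. T (Suc i) (Suc j) * u (Suc i) x)" by (rule arg_cong)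
    qed
    also have "\<dots> = (\<Sum>i<n. (\<Sum>j<n. T (Suc i) (Suc j) * u' k' j) * u (Suc i) x)"
      by (simp only: sum_distrib_left sum_distrib_right, subst sum.swap, simp only: ac_simps)
    also have "\<dots> = (\<Sum>i<n. e' k' * (u' k' i * u (Suc i) x))"
      using e' kx Suc by (intro sum.cong refl) (simp add: ac_simps)
    finally show ?thesis unfolding U_def E_def Suc by (simp add: sum_distrib_left)
  qed
  with orth show ?case by blast
qed

text \<open>What is missing from the eigenbasis is that the eigenvalues are real: each is the
  quadratic form of its unit eigenvector, which Hermiticity makes equal to its own
  conjugate.\<close>

theorem spectral_exists:
  fixes M :: "nat \<Rightarrow> nat \<Rightarrow> complex"
  assumes M: "\<And>x y. x < n \<Longrightarrow> y < n \<Longrightarrow> cnj (M x y) = M y x"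
  obtains u l where "spectral n M u l"
proof -
  obtain u e where u: "orthonormal {..<n} {..<n} u"
    and e: "\<And>k x. k < n \<Longrightarrow> x < n \<Longrightarrow> (\<Sum>z<n. M x z * u k z) = e k * u k x"
    using hermitian_eigenbasis[of n M] M by blast
  have ek: "e k = (\<Sum>x<n. \<Sum>z<n. cnj (u k x) * (M x z * u k z))" if "k < n" for k
  proof -
    have "(\<Sum>x<n. \<Sum>z<n. cnj (u k x) * (M x z * u k z)) = (\<Sum>x<n. e k * (cnj (u k x) * u k x))"
      using e[OF that] by (intro sum.cong refl) (simp add: sum_distrib_left[symmetric])
    also have "\<dots> = e k"
      unfolding sum_distrib_left[symmetric] using orthonormalD[OF u, of k k] that by simp
    finally show ?thesis by simp
  qed
  have re: "e k = of_real (Re (e k))" if "k < n" for k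
  proof -
    have "cnj (e k) = (\<Sum>x<n. \<Sum>z<n. u k x * (M z x * cnj (u k z)))"
      unfolding ek[OF that] cnj_sum using M by (intro sum.cong refl) auto
    also have "\<dots> = e k" unfolding ek[OF that] by (subst sum.swap) (simp only: ac_simps)
    finally show ?thesis by (simp add: complex_eq_iff)
  qed
  have "M x y = (\<Sum>k<n. of_real (Re (e k)) * (u k x * cnj (u k y)))" if xy: "x < n" "y < n" for x y
  proof -
    have "M x y = (\<Sum>z<n. if z = y then M x z else 0)" using xy by (simp add: sum.delta)
    also have "\<dots> = (\<Sum>z<n. M x z * (\<Sum>k<n. u k z * cnj (u k y)))"
      using orthonormal_complete[OF u _ xy(2)] by (intro sum.cong refl) auto
    also have "\<dots> = (\<Sum>k<n. (\<Sum>z<n. M x z * u k z) * cnj (u k y))"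
      by (simp only: sum_distrib_left sum_distrib_right, subst sum.swap, simp only: ac_simps)
    also have "\<dots> = (\<Sum>k<n. of_real (Re (e k)) * (u k x * cnj (u k y)))"
      using e[OF _ xy(1)] re by (intro sum.cong refl) (auto simp flip: re)
    finally show ?thesis .
  qed
  then have "spectral n M u (\<lambda>k. Re (e k))"
    unfolding spectral_def using u orthonormal_complete[OF u] by auto
  then show thesis by (rule that)
qed

text \<open>The bridge from the definition of entropy through roots of the characteristic polynomial
  to any spectral decomposition: \<open>X\<close> is similar to a diagonal matrix, whose
  characteristic polynomial splits with the same multiplicities.\<close>

lemma vN_entropy_spectral:
  assumes X: "X \<in> carrier_mat n n" and s: "spectral n (\<lambda>i j. X $$ (i,j)) u l"
  shows "vN_entropy X = - (\<Sum>k<n. eta (l k))"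
proof -
  define P where "P = mat n n (\<lambda>(i,j). u j i)"
  define Q where "Q = mat n n (\<lambda>(i,j). cnj (u i j))"
  define D where "D = mat n n (\<lambda>(i,j). if i = j then complex_of_real (l i) else 0)"
  have c: "P \<in> carrier_mat n n" "Q \<in> carrier_mat n n" "D \<in> carrier_mat n n"
    by (auto simp: P_def Q_def D_def)
  have "P * Q = 1\<^sub>m n" using s
    by (intro eq_matI) (auto simp: P_def Q_def scalar_prod_def atLeast0LessThan spectral_def)
  moreover have "Q * P = 1\<^sub>m n" using s
    by (intro eq_matI) (auto simp: P_def Q_def scalar_prod_def atLeast0LessThan spectral_def orthonormal_def)
  moreover have "X = P * D * Q"
  proof (intro eq_matI)
    fix i j assume ij: "i < dim_row (P * D * Q)" "j < dim_col (P * D * Q)"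
    then have ij: "i < n" "j < n" using c by auto
    have PD: "(P * D) $$ (i, k) = u k i * of_real (l k)" if "k < n" for k
    proof -
      have "(P * D) $$ (i, k) = (\<Sum>m<n. if m = k then u k i * of_real (l k) else 0)"
        using ij that unfolding P_def D_def
        by (simp add: scalar_prod_def atLeast0LessThan if_distrib[where f = "\<lambda>x. _ * x"]
            sum.delta cong: if_cong)
      then show ?thesis using that by (simp add: sum.delta)
    qed
    have "(P * D * Q) $$ (i, j) = (\<Sum>k<n. (P * D) $$ (i, k) * Q $$ (k, j))"
      using ij c by (subst index_mult_mat(1)) (auto simp: scalar_prod_def atLeast0LessThan)
    also have "\<dots> = (\<Sum>k<n. of_real (l k) * (u k i * cnj (u k j)))"
      using ij by (intro sum.cong refl) (simp add: PD Q_def)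
    finally show "X $$ (i, j) = (P * D * Q) $$ (i, j)" using s ij by (simp add: spectral_def)
  qed (use c X in auto)
  ultimately have "similar_mat X D"
    using X c similar_mat_witI[of P Q n X D] unfolding similar_mat_def by blast
  then have "char_poly X = char_poly D" by (rule char_poly_similar)
  also have "\<dots> = (\<Prod>a\<leftarrow>diag_mat D. [:- a, 1:])"
    by (rule char_poly_upper_triangular[OF c(3)]) (auto simp: D_def)
  also have "diag_mat D = map (\<lambda>k. complex_of_real (l k)) [0..<n]"
    by (auto simp: diag_mat_def D_def)
  finally have cp: "char_poly X = (\<Prod>k\<leftarrow>[0..<n]. [:- complex_of_real (l k), 1:])"
    by (simp add: o_def)
  have "proots (\<Prod>k\<leftarrow>ks. [:- complex_of_real (l k), 1:]) = mset (map (\<lambda>k. complex_of_real (l k)) ks)" for ks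
  proof (induction ks)
    case (Cons k ks)
    have "(\<Prod>k\<leftarrow>ks. [:- complex_of_real (l k), 1:]) \<noteq> 0" by (auto simp: prod_list_zero_iff)
    then show ?case using Cons proots_mult[of "[:- complex_of_real (l k), 1:]"] by simp
  qed simp
  then have "proots (char_poly X) = mset (map (\<lambda>k. complex_of_real (l k)) [0..<n])"
    unfolding cp by simp
  then have "vN_entropy X = - (\<Sum>k\<leftarrow>[0..<n]. eta (l k))"
    unfolding vN_entropy_def by (simp flip: sum_mset_sum_list mset_map add: multiset.map_comp o_def image_mset.compositionality)
  then show ?thesis by (simp add: interv_sum_list_conv_sum_set_nat atLeast0LessThan)
qed

section \<open>Entropy inequalities\<close>

definition ip :: "'x set \<Rightarrow> ('x \<Rightarrow> complex) \<Rightarrow> ('x \<Rightarrow> complex) \<Rightarrow> complex" where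
  "ip X f g = (\<Sum>x\<in>X. cnj (f x) * g x)"

lemma orthonormal_ip:
  "orthonormal I X u \<Longrightarrow> i \<in> I \<Longrightarrow> j \<in> I \<Longrightarrow> ip X (u i) (u j) = (if i = j then 1 else 0)"
  unfolding ip_def by (rule orthonormalD)

lemma ip_sum_right: "ip X f (\<lambda>x. \<Sum>i\<in>I. h i x) = (\<Sum>i\<in>I. ip X f (h i))"
  unfolding ip_def sum_distrib_left by (rule sum.swap)

lemma ip_sum_left: "ip X (\<lambda>x. \<Sum>i\<in>I. h i x) f = (\<Sum>i\<in>I. ip X (h i) f)"
  unfolding ip_def cnj_sum sum_distrib_right by (rule sum.swap)

lemma ip_scale_right: "ip X f (\<lambda>x. c * g x) = c * ip X f g"
  unfolding ip_def sum_distrib_left by (simp only: ac_simps)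

lemma ip_scale_left: "ip X (\<lambda>x. c * f x) g = cnj c * ip X f g"
  unfolding ip_def sum_distrib_left by (simp add: ac_simps)

lemma ip_diff_right: "ip X f (\<lambda>x. g x - h x) = ip X f g - ip X f h"
  unfolding ip_def by (simp add: algebra_simps sum_subtractf)

lemma ip_diff_left: "ip X (\<lambda>x. g x - h x) f = ip X g f - ip X h f"
  unfolding ip_def by (simp add: algebra_simps sum_subtractf)

lemma cnj_ip: "cnj (ip X f g) = ip X g f"
  unfolding ip_def by (simp add: ac_simps)

lemma ip_self: "ip X f f = of_real (\<Sum>x\<in>X. (cmod (f x))\<^sup>2)"
  unfolding ip_def by (simp only: cnj_mult_cmod of_real_sum)

lemma ip_cong: "(\<And>x. x \<in> X \<Longrightarrow> f x = f' x) \<Longrightarrow> (\<And>x. x \<in> X \<Longrightarrow> g x = g' x) \<Longrightarrow> ip X f g = ip X f' g'"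
  unfolding ip_def by (intro sum.cong) auto

lemma cmod_ip_sym: "cmod (ip X f g) = cmod (ip X g f)"
  by (metis cnj_ip complex_mod_cnj)

lemma ip_mult_swap: "ip X f g * ip X g f = of_real ((cmod (ip X g f))\<^sup>2)"
  unfolding cnj_ip[of X g f, symmetric] by (rule cnj_mult_cmod)

lemma bessel:
  assumes J: "finite J" and w: "orthonormal J X w"
  shows "(\<Sum>j\<in>J. (cmod (ip X (w j) f))\<^sup>2) \<le> (\<Sum>x\<in>X. (cmod (f x))\<^sup>2)"
proof -
  define c where "c = (\<lambda>j. ip X (w j) f)"
  define p where "p = (\<lambda>x. \<Sum>j\<in>J. c j * w j x)"
  have wp: "ip X (w i) p = c i" if "i \<in> J" for i
  proof -
    have "ip X (w i) p = (\<Sum>j\<in>J. if j = i then c j else 0)"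
      unfolding p_def ip_sum_right ip_scale_right
      using orthonormal_ip[OF w that] by (intro sum.cong) auto
    then show ?thesis using that J by (simp add: sum.delta)
  qed
  have pf: "ip X p g = (\<Sum>j\<in>J. cnj (c j) * ip X (w j) g)" for g
    unfolding p_def ip_sum_left ip_scale_left ..
  have "ip X p p = (\<Sum>j\<in>J. cnj (c j) * c j)" unfolding pf using wp by simp
  moreover have "ip X p f = (\<Sum>j\<in>J. cnj (c j) * c j)" unfolding pf c_def ..
  moreover have "ip X f p = (\<Sum>j\<in>J. cnj (c j) * c j)"
    using cnj_ip[of X p f] calculation(2) by (simp add: ac_simps)
  ultimately have "ip X (\<lambda>x. f x - p x) (\<lambda>x. f x - p x) = ip X f f - (\<Sum>j\<in>J. cnj (c j) * c j)"
    by (simp add: ip_diff_left ip_diff_right)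
  then have "complex_of_real (\<Sum>x\<in>X. (cmod (f x - p x))\<^sup>2)
     = of_real ((\<Sum>x\<in>X. (cmod (f x))\<^sup>2) - (\<Sum>j\<in>J. (cmod (c j))\<^sup>2))"
    unfolding ip_self by (simp add: cnj_mult_cmod)
  then have "(\<Sum>x\<in>X. (cmod (f x - p x))\<^sup>2) = (\<Sum>x\<in>X. (cmod (f x))\<^sup>2) - (\<Sum>j\<in>J. (cmod (c j))\<^sup>2)"
    using of_real_eq_iff by blast
  moreover have "(\<Sum>x\<in>X. (cmod (f x - p x))\<^sup>2) \<ge> 0" by (intro sum_nonneg) auto
  ultimately show ?thesis unfolding c_def by linarith
qed

lemma ip_expand:
  fixes u :: "nat \<Rightarrow> nat \<Rightarrow> complex"
  assumes "orthonormal {..<n} {..<n} u"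
  shows "ip {..<n} f g = (\<Sum>k<n. cnj (ip {..<n} (u k) f) * ip {..<n} (u k) g)"
proof -
  have "ip {..<n} f g = ip {..<n} (\<lambda>x. \<Sum>k<n. ip {..<n} (u k) f * u k x) g"
    by (intro ip_cong refl) (simp add: orthonormal_expand[OF assms, folded ip_def])
  then show ?thesis by (simp add: ip_sum_left ip_scale_left)
qed

lemma parseval:
  fixes u :: "nat \<Rightarrow> nat \<Rightarrow> complex"
  assumes "orthonormal {..<n} {..<n} u"
  shows "(\<Sum>k<n. (cmod (ip {..<n} (u k) f))\<^sup>2) = (\<Sum>x<n. (cmod (f x))\<^sup>2)"
proof -
  have "complex_of_real (\<Sum>x<n. (cmod (f x))\<^sup>2) = of_real (\<Sum>k<n. (cmod (ip {..<n} (u k) f))\<^sup>2)"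
    unfolding ip_self[of "{..<n}" f, symmetric] ip_expand[OF assms, of f f] by (simp only: cnj_mult_cmod of_real_sum)
  then show ?thesis using of_real_eq_iff by metis
qed

definition sesq_form :: "nat \<Rightarrow> (nat \<Rightarrow> nat \<Rightarrow> complex) \<Rightarrow> (nat \<Rightarrow> complex) \<Rightarrow> (nat \<Rightarrow> complex) \<Rightarrow> complex" where
  "sesq_form n M f g = (\<Sum>x<n. \<Sum>y<n. cnj (f x) * M x y * g y)"

text \<open>Spectral decompositions, channel outputs and weighted Kraus sums are all of this shape,
  so one rearrangement serves for each of them.\<close>

lemma sesq_form_gram:
  assumes "\<And>x y. x < n \<Longrightarrow> y < n \<Longrightarrow> M x y = (\<Sum>i\<in>I. c i * (g i x * cnj (g i y)))"
  shows "sesq_form n M f h = (\<Sum>i\<in>I. c i * (ip {..<n} f (g i) * ip {..<n} (g i) h))"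
proof -
  have "sesq_form n M f h = (\<Sum>x<n. \<Sum>y<n. \<Sum>i\<in>I. c i * ((cnj (f x) * g i x) * (cnj (g i y) * h y)))"
    unfolding sesq_form_def using assms
    by (intro sum.cong refl) (simp add: sum_distrib_left sum_distrib_right ac_simps)
  also have "\<dots> = (\<Sum>x<n. \<Sum>i\<in>I. \<Sum>y<n. c i * ((cnj (f x) * g i x) * (cnj (g i y) * h y)))"
    by (intro sum.cong refl sum.swap)
  also have "\<dots> = (\<Sum>i\<in>I. \<Sum>x<n. \<Sum>y<n. c i * ((cnj (f x) * g i x) * (cnj (g i y) * h y)))"
    by (rule sum.swap)
  also have "\<dots> = (\<Sum>i\<in>I. c i * (ip {..<n} f (g i) * ip {..<n} (g i) h))"
    unfolding ip_def by (simp only: sum_product) (simp only: sum_distrib_left)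
  finally show ?thesis .
qed

lemma spectral_orthonormal: "spectral n M u l \<Longrightarrow> orthonormal {..<n} {..<n} u"
  by (simp add: spectral_def)

lemma spectral_sesq_form:
  assumes "spectral n M u l"
  shows "sesq_form n M f h = (\<Sum>k<n. of_real (l k) * (ip {..<n} f (u k) * ip {..<n} (u k) h))"
  using assms by (intro sesq_form_gram) (simp add: spectral_def)

lemma spectral_sesq_form_basis:
  assumes "spectral n M u l" "j < n" "k < n"
  shows "sesq_form n M (u j) (u k) = (if j = k then of_real (l k) else 0)"
proof -
  have "sesq_form n M (u j) (u k) = (\<Sum>i<n. if i = j then (if j = k then of_real (l k) else 0) else 0)"
    unfolding spectral_sesq_form[OF assms(1)]
    using orthonormal_ip[OF spectral_orthonormal[OF assms(1)]] assms
    by (intro sum.cong refl) auto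
  then show ?thesis using assms by (simp add: sum.delta)
qed

section \<open>Gibbs inequalities for spectra\<close>

lemma log_ratio_le:
  assumes "0 < a" "0 < (b::real)"
  shows "log 2 b - log 2 a \<le> (b / a - 1) / ln 2"
proof -
  have "ln (b / a) \<le> b / a - 1" using assms by (intro ln_le_minus_one) auto
  then show ?thesis using assms
    by (simp add: log_def ln_div diff_divide_distrib[symmetric] divide_right_mono)
qed

lemma log_ratio_less:
  assumes "0 < a" "0 < (b::real)" "a \<noteq> b"
  shows "log 2 b - log 2 a < (b / a - 1) / ln 2"
proof -
  have "ln (b / a) \<noteq> b / a - 1" using assms ln_eq_minus_one[of "b / a"] by auto
  moreover have "ln (b / a) \<le> b / a - 1" using assms by (intro ln_le_minus_one) auto
  ultimately have "ln (b / a) < b / a - 1" by linarith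
  then show ?thesis using assms
    by (simp add: log_def ln_div diff_divide_distrib[symmetric] divide_strict_right_mono)
qed

lemma eta_nonpos: "t \<le> 1 \<Longrightarrow> eta t \<le> 0"
  by (auto simp: eta_def mult_le_0_iff)

text \<open>Measuring in \<open>w\<close> does not decrease entropy, and Shannon entropy is at most
  cross entropy; both follow at once from the tangent bound of the logarithm, summed with the
  transition weights \<open>P k j\<close>. The system \<open>w\<close> may be incomplete: that the
  \<open>q j\<close> sum to 1 says that it sees the whole support of the state.\<close>

lemma entropy_le_cross:
  assumes s: "spectral n M u l" and l: "\<And>k. k < n \<Longrightarrow> l k \<ge> 0" "(\<Sum>k<n. l k) = 1"
    and J: "finite J" and w: "orthonormal J {..<n} w"
    and q: "\<And>j. j \<in> J \<Longrightarrow> complex_of_real (q j) = sesq_form n M (w j) (w j)" "(\<Sum>j\<in>J. q j) = 1"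
    and t: "\<And>j. j \<in> J \<Longrightarrow> t j > 0" "(\<Sum>j\<in>J. t j) \<le> 1"
  shows "- (\<Sum>k<n. eta (l k)) \<le> - (\<Sum>j\<in>J. q j * log 2 (t j))"
proof -
  note u = spectral_orthonormal[OF s]
  define P where "P = (\<lambda>k j. (cmod (ip {..<n} (u k) (w j)))\<^sup>2)"
  have qP: "q j = (\<Sum>k<n. l k * P k j)" if "j \<in> J" for j
  proof -
    have "complex_of_real (q j) = of_real (\<Sum>k<n. l k * P k j)"
      unfolding q(1)[OF that] spectral_sesq_form[OF s] P_def
      by (simp only: ip_mult_swap of_real_mult of_real_sum)
    then show ?thesis using of_real_eq_iff by blast
  qed
  have P1: "(\<Sum>k<n. P k j) = 1" if "j \<in> J" for j
  proof -
    have "complex_of_real (\<Sum>k<n. P k j) = 1"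
      unfolding P_def parseval[OF u] ip_self[symmetric] using orthonormal_ip[OF w that that] by simp
    then show ?thesis by (metis of_real_1 of_real_eq_iff)
  qed
  have P2: "(\<Sum>j\<in>J. P k j) \<le> 1" if "k < n" for k
  proof -
    have "complex_of_real (\<Sum>x<n. (cmod (u k x))\<^sup>2) = 1"
      unfolding ip_self[symmetric] using orthonormal_ip[OF u, of k k] that by simp
    then have "(\<Sum>x<n. (cmod (u k x))\<^sup>2) = 1" by (metis of_real_1 of_real_eq_iff)
    then show ?thesis using bessel[OF J w, of "u k"] unfolding P_def
      by (simp add: cmod_ip_sym[of _ "u k"])
  qed
  \<comment> \<open>The missing weight \<open>1 - \<Sum>j. P k j\<close> of each eigenvector is
    nonnegative and averages to 0, so it vanishes wherever \<open>l k > 0\<close>.\<close>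
  have "(\<Sum>k<n. l k * (1 - (\<Sum>j\<in>J. P k j))) = 0"
  proof -
    have "(\<Sum>k<n. l k * (\<Sum>j\<in>J. P k j)) = (\<Sum>j\<in>J. q j)"
      unfolding sum_distrib_left by (subst sum.swap) (simp add: qP)
    then show ?thesis using l(2) q(2) by (simp add: right_diff_distrib sum_subtractf)
  qed
  then have P3: "l k * (1 - (\<Sum>j\<in>J. P k j)) = 0" if "k < n" for k
    by (subst (asm) sum_nonneg_eq_0_iff) (use l(1) P2 that in auto)
  have eP: "eta (l k) = (\<Sum>j\<in>J. P k j * eta (l k))" if "k < n" for k
    using P3[OF that] by (cases "l k = 0") (auto simp: eta_def sum_distrib_right[symmetric])
  have le: "P k j * (l k * log 2 (t j) - eta (l k)) \<le> P k j * ((t j - l k) / ln 2)"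
    if "k < n" "j \<in> J" for k j
  proof (intro mult_left_mono)
    show "l k * log 2 (t j) - eta (l k) \<le> (t j - l k) / ln 2"
    proof (cases "l k = 0")
      case True
      then show ?thesis using t(1)[OF that(2)] by (simp add: eta_def)
    next
      case False
      then have lk: "l k > 0" using l(1)[OF that(1)] by simp
      have "l k * (log 2 (t j) - log 2 (l k)) \<le> l k * ((t j / l k - 1) / ln 2)"
        using log_ratio_le[OF lk t(1)[OF that(2)]] lk by (intro mult_left_mono) auto
      then show ?thesis using lk by (simp add: eta_def algebra_simps)
    qed
  qed (simp add: P_def)
  have "(\<Sum>j\<in>J. q j * log 2 (t j)) - (\<Sum>k<n. eta (l k))
      = (\<Sum>k<n. \<Sum>j\<in>J. P k j * (l k * log 2 (t j) - eta (l k)))"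
  proof -
    have "(\<Sum>j\<in>J. q j * log 2 (t j)) = (\<Sum>k<n. \<Sum>j\<in>J. P k j * (l k * log 2 (t j)))"
      by (subst sum.swap) (simp add: qP sum_distrib_right sum_distrib_left ac_simps)
    moreover have "(\<Sum>k<n. eta (l k)) = (\<Sum>k<n. \<Sum>j\<in>J. P k j * eta (l k))"
      using eP by (intro sum.cong) auto
    ultimately show ?thesis by (simp add: right_diff_distrib sum_subtractf)
  qed
  also have "\<dots> \<le> (\<Sum>k<n. \<Sum>j\<in>J. P k j * ((t j - l k) / ln 2))"
    using le by (intro sum_mono) auto
  also have "\<dots> = ((\<Sum>j\<in>J. t j * (\<Sum>k<n. P k j)) - (\<Sum>k<n. l k * (\<Sum>j\<in>J. P k j))) / ln 2"
    unfolding sum_distrib_left sum.swap[of "\<lambda>j k. t j * P k j"]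
    by (simp add: sum_subtractf[symmetric] sum_divide_distrib algebra_simps)
  also have "(\<Sum>j\<in>J. t j * (\<Sum>k<n. P k j)) = (\<Sum>j\<in>J. t j)"
    using P1 by simp
  also have "(\<Sum>k<n. l k * (\<Sum>j\<in>J. P k j)) = (\<Sum>k<n. l k)"
    using P3 by (intro sum.cong) (auto simp: algebra_simps)
  also have "((\<Sum>j\<in>J. t j) - (\<Sum>k<n. l k)) / ln 2 \<le> 0"
    using t(2) l(2) by (intro divide_nonpos_pos) auto
  finally show ?thesis by simp
qed

text \<open>The numbers \<open>c k i\<close> form a joint distribution with marginals
  \<open>l\<close> and \<open>t\<close>. Under it the tangent bound compares
  \<open>log (t i)\<close> with \<open>log (l k)\<close>, and the linear remainder is
  \<open>\<Sum>i. t i * S i - 1\<close>, which is nonpositive.\<close>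

lemma entropy_decomp:
  assumes s: "spectral n M u l" and I: "finite I"
    and M: "\<And>x y. x < n \<Longrightarrow> y < n \<Longrightarrow> M x y = (\<Sum>i\<in>I. g i x * cnj (g i y))"
    and t: "\<And>i. i \<in> I \<Longrightarrow> t i = (\<Sum>x<n. (cmod (g i x))\<^sup>2)" "(\<Sum>i\<in>I. t i) = 1"
  shows "- (\<Sum>k<n. eta (l k)) \<le> - (\<Sum>i\<in>I. eta (t i))"
    and "\<lbrakk>i \<in> I; j \<in> I; i \<noteq> j; ip {..<n} (g i) (g j) \<noteq> 0\<rbrakk> \<Longrightarrow>
       - (\<Sum>k<n. eta (l k)) < - (\<Sum>i\<in>I. eta (t i))"
proof -
  note u = spectral_orthonormal[OF s]
  define a where "a = (\<lambda>k i. ip {..<n} (u k) (g i))"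
  define c where "c = (\<lambda>k i. (cmod (a k i))\<^sup>2)"
  have aa: "(\<Sum>i\<in>I. a k i * cnj (a k' i)) = (if k = k' then of_real (l k) else 0)"
    if "k < n" "k' < n" for k k'
  proof -
    have "sesq_form n M (u k) (u k') = (\<Sum>i\<in>I. 1 * (ip {..<n} (u k) (g i) * ip {..<n} (g i) (u k')))"
      by (rule sesq_form_gram) (simp add: M)
    then show ?thesis using spectral_sesq_form_basis[OF s that]
      by (auto simp: a_def cnj_ip)
  qed
  have lc: "l k = (\<Sum>i\<in>I. c k i)" if "k < n" for k
  proof -
    have "complex_of_real (l k) = of_real (\<Sum>i\<in>I. c k i)"
      using aa[OF that that] unfolding c_def by (simp add: complex_mult_cnj_cmod)
    then show ?thesis using of_real_eq_iff by blast
  qed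
  have l0: "l k \<ge> 0" if "k < n" for k unfolding lc[OF that] c_def by (intro sum_nonneg) auto
  have cl: "c k i = 0" if "k < n" "i \<in> I" "l k = 0" for k i
  proof -
    have "(\<Sum>i\<in>I. c k i) = 0" using lc that by simp
    then show ?thesis by (subst (asm) sum_nonneg_eq_0_iff) (use I that in \<open>auto simp: c_def\<close>)
  qed
  have ct: "(\<Sum>k<n. c k i) = t i" if "i \<in> I" for i
    unfolding c_def a_def parseval[OF u] t(1)[OF that] ..
  have t0: "t i \<ge> 0" if "i \<in> I" for i unfolding t(1)[OF that] by (intro sum_nonneg) auto
  have ctz: "c k i = 0" if "k < n" "i \<in> I" "t i = 0" for k i
  proof -
    have "(\<Sum>k<n. c k i) = 0" using ct that by simp
    then show ?thesis by (subst (asm) sum_nonneg_eq_0_iff) (use that in \<open>auto simp: c_def\<close>)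
  qed
  have lsum: "(\<Sum>k<n. l k) = 1"
  proof -
    have "(\<Sum>k<n. l k) = (\<Sum>k<n. \<Sum>i\<in>I. c k i)" using lc by (intro sum.cong) auto
    also have "\<dots> = 1" by (subst sum.swap) (simp add: ct t(2))
    finally show ?thesis .
  qed
  define S where "S = (\<lambda>i. \<Sum>k<n. c k i / l k)"
  \<comment> \<open>\<open>S i\<close> is a diagonal entry of the projection onto the range of the Gram matrix of the \<open>g i\<close>.\<close>
  have S: "S i \<le> 1" if i: "i \<in> I" for i
  proof -
    \<comment> \<open>Column \<open>i\<close> of the same projection: idempotence makes its squared
      norm equal to its own diagonal entry \<open>S i\<close>, whence
      \<open>(S i)^2 \<le> S i\<close>.\<close>
    define b where "b = (\<lambda>j. \<Sum>k<n. cnj (a k j) * (a k i / of_real (l k)))"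
    have bi: "b i = of_real (S i)"
      unfolding b_def S_def c_def by (simp add: cnj_mult_cmod)
    have "(\<Sum>j\<in>I. b j * cnj (b j)) = (\<Sum>j\<in>I. \<Sum>k<n. \<Sum>k'<n. (a k i / of_real (l k) * cnj (a k' i / of_real (l k'))) * (a k' j * cnj (a k j)))"
      unfolding b_def cnj_sum sum_product by (intro sum.cong refl) (simp add: ac_simps)
    also have "\<dots> = (\<Sum>k<n. \<Sum>k'<n. (a k i / of_real (l k) * cnj (a k' i / of_real (l k'))) * (\<Sum>j\<in>I. a k' j * cnj (a k j)))"
      unfolding sum_distrib_left by (subst sum.swap) (intro sum.cong refl sum.swap)
    also have "\<dots> = (\<Sum>k<n. \<Sum>k'<n. if k' = k then of_real (c k i / l k) else 0)"
    proof (intro sum.cong refl)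
      fix k k' assume "k \<in> {..<n}" "k' \<in> {..<n}"
      then show "(a k i / of_real (l k) * cnj (a k' i / of_real (l k'))) * (\<Sum>j\<in>I. a k' j * cnj (a k j))
         = (if k' = k then of_real (c k i / l k) else 0)"
        by (cases "l k = 0") (auto simp: aa c_def complex_mult_cnj_cmod[symmetric] simp del: of_real_power)
    qed
    also have "\<dots> = of_real (S i)" unfolding S_def by (simp add: sum.delta')
    finally have "(\<Sum>j\<in>I. (cmod (b j))\<^sup>2) = S i"
      unfolding complex_mult_cnj_cmod of_real_sum[symmetric] of_real_eq_iff .
    moreover have "(cmod (b i))\<^sup>2 \<le> (\<Sum>j\<in>I. (cmod (b j))\<^sup>2)"
      using I i by (intro member_le_sum) auto
    ultimately have "(S i)\<^sup>2 \<le> S i" unfolding bi by simp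
    then show ?thesis using mult_strict_left_mono[of 1 "S i" "S i"]
      by (cases "S i \<le> 1") (auto simp: power2_eq_square)
  qed
  define L where "L = (\<lambda>k i. c k i * (log 2 (t i) - log 2 (l k)))"
  define R where "R = (\<lambda>k i. c k i / l k * (t i - l k) / ln 2)"
  have LR: "L k i \<le> R k i" if "k < n" "i \<in> I" for k i
  proof (cases "c k i = 0")
    case False
    then have pos: "l k > 0" "t i > 0" using cl ctz l0 t0 that by (metis order_le_less)+
    have "c k i * (log 2 (t i) - log 2 (l k)) \<le> c k i * ((t i / l k - 1) / ln 2)"
      using log_ratio_le[OF pos] by (intro mult_left_mono) (auto simp: c_def)
    also have "\<dots> = R k i" using pos by (simp add: R_def field_simps)
    finally show ?thesis by (simp add: L_def)
  qed (simp add: L_def R_def)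
  have LRs: "L k i < R k i" if "k < n" "i \<in> I" "c k i \<noteq> 0" "l k \<noteq> t i" for k i
  proof -
    have pos: "l k > 0" "t i > 0" using cl ctz l0 t0 that by (metis order_le_less)+
    have "c k i * (log 2 (t i) - log 2 (l k)) < c k i * ((t i / l k - 1) / ln 2)"
      using log_ratio_less[OF pos] that by (intro mult_strict_left_mono) (auto simp: c_def)
    also have "\<dots> = R k i" using pos by (simp add: R_def field_simps)
    finally show ?thesis by (simp add: L_def)
  qed
  have sumL: "(\<Sum>k<n. \<Sum>i\<in>I. L k i) = (\<Sum>i\<in>I. eta (t i)) - (\<Sum>k<n. eta (l k))"
  proof -
    have "(\<Sum>k<n. eta (l k)) = (\<Sum>k<n. l k * log 2 (l k))"
      using l0 by (intro sum.cong) (auto simp: eta_def order_le_less)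
    also have "\<dots> = (\<Sum>k<n. \<Sum>i\<in>I. c k i * log 2 (l k))"
      unfolding sum_distrib_right[symmetric] using lc by (intro sum.cong) auto
    finally have 1: "(\<Sum>k<n. eta (l k)) = (\<Sum>k<n. \<Sum>i\<in>I. c k i * log 2 (l k))" .
    have "(\<Sum>i\<in>I. eta (t i)) = (\<Sum>i\<in>I. t i * log 2 (t i))"
      using t0 by (intro sum.cong) (auto simp: eta_def order_le_less)
    also have "\<dots> = (\<Sum>i\<in>I. \<Sum>k<n. c k i * log 2 (t i))"
      unfolding sum_distrib_right[symmetric] using ct by (intro sum.cong) auto
    also have "\<dots> = (\<Sum>k<n. \<Sum>i\<in>I. c k i * log 2 (t i))" by (rule sum.swap)
    finally show ?thesis unfolding 1 L_def by (simp add: right_diff_distrib sum_subtractf)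
  qed
  have sumR: "(\<Sum>k<n. \<Sum>i\<in>I. R k i) \<le> 0"
  proof -
    \<comment> \<open>Where \<open>l k = 0\<close> also \<open>c k i = 0\<close>, so the value 0 of
      a division by 0 is the right one.\<close>
    have "(\<Sum>k<n. \<Sum>i\<in>I. R k i) = (\<Sum>k<n. \<Sum>i\<in>I. (t i * (c k i / l k) - c k i) / ln 2)"
    proof (intro sum.cong refl)
      fix k i assume "k \<in> {..<n}" "i \<in> I"
      then show "R k i = (t i * (c k i / l k) - c k i) / ln 2"
        using cl[of k i] by (cases "l k = 0") (simp_all add: R_def field_simps)
    qed
    also have "\<dots> = ((\<Sum>k<n. \<Sum>i\<in>I. t i * (c k i / l k)) - (\<Sum>k<n. \<Sum>i\<in>I. c k i)) / ln 2"
      by (simp add: sum_divide_distrib sum_subtractf diff_divide_distrib)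
    also have "(\<Sum>k<n. \<Sum>i\<in>I. t i * (c k i / l k)) = (\<Sum>i\<in>I. t i * S i)"
      by (subst sum.swap) (simp add: S_def sum_distrib_left)
    also have "(\<Sum>k<n. \<Sum>i\<in>I. c k i) = 1"
      by (subst sum.swap) (simp add: ct t(2))
    finally have eq: "(\<Sum>k<n. \<Sum>i\<in>I. R k i) = ((\<Sum>i\<in>I. t i * S i) - 1) / ln 2" .
    have "(\<Sum>i\<in>I. t i * S i) \<le> (\<Sum>i\<in>I. t i * 1)"
      using S t0 by (intro sum_mono mult_left_mono) auto
    then show ?thesis unfolding eq using t(2) by (intro divide_nonpos_pos) auto
  qed
  have "(\<Sum>k<n. \<Sum>i\<in>I. L k i) \<le> (\<Sum>k<n. \<Sum>i\<in>I. R k i)"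
    using LR by (intro sum_mono) auto
  then show "- (\<Sum>k<n. eta (l k)) \<le> - (\<Sum>i\<in>I. eta (t i))" using sumL sumR by linarith
  assume ij: "i \<in> I" "j \<in> I" "i \<noteq> j" "ip {..<n} (g i) (g j) \<noteq> 0"
  \<comment> \<open>Otherwise \<open>g i\<close> lies in the eigenspace of \<open>M\<close> for the
    value \<open>t i\<close>, and its quadratic form is \<open>(t i)^2\<close>. But that form is the
    sum of all \<open>|<g m, g i>|^2\<close>, which the term \<open>m = i\<close> already exhausts,
    leaving nothing for \<open>m = j\<close>.\<close>
  have "\<exists>k<n. c k i \<noteq> 0 \<and> l k \<noteq> t i"
  proof (rule ccontr)
    assume "\<not> ?thesis"
    then have lt: "c k i * l k = c k i * t i" if "k < n" for k using that by auto
    have "sesq_form n M (g i) (g i) = (\<Sum>m\<in>I. 1 * (ip {..<n} (g i) (g m) * ip {..<n} (g m) (g i)))"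
      by (rule sesq_form_gram) (simp add: M)
    moreover have "sesq_form n M (g i) (g i) = of_real (\<Sum>k<n. c k i * l k)"
      unfolding spectral_sesq_form[OF s] c_def a_def
      by (simp only: ip_mult_swap of_real_mult of_real_sum ac_simps)
    moreover have "(\<Sum>k<n. c k i * l k) = t i * t i"
    proof -
      have "(\<Sum>k<n. c k i * l k) = (\<Sum>k<n. c k i * t i)" using lt by (intro sum.cong) auto
      then show ?thesis using ct[OF ij(1)] by (simp add: sum_distrib_right[symmetric])
    qed
    ultimately have "complex_of_real (\<Sum>m\<in>I. (cmod (ip {..<n} (g m) (g i)))\<^sup>2) = of_real (t i * t i)"
      by (simp only: ip_mult_swap of_real_sum mult_1_left)
    then have eq: "(\<Sum>m\<in>I. (cmod (ip {..<n} (g m) (g i)))\<^sup>2) = t i * t i"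
      using of_real_eq_iff by blast
    have ii: "(cmod (ip {..<n} (g i) (g i)))\<^sup>2 = t i * t i"
      unfolding ip_self t(1)[OF ij(1), symmetric] by (simp add: power2_eq_square)
    have "(\<Sum>m\<in>{i, j}. (cmod (ip {..<n} (g m) (g i)))\<^sup>2) \<le> (\<Sum>m\<in>I. (cmod (ip {..<n} (g m) (g i)))\<^sup>2)"
      using I ij by (intro sum_mono2) auto
    then have "(cmod (ip {..<n} (g j) (g i)))\<^sup>2 \<le> 0" using ij(3) ii eq by simp
    then show False using ij(4) cmod_ip_sym[of "{..<n}" "g i" "g j"] by simp
  qed
  then obtain k where k: "k < n" "c k i \<noteq> 0" "l k \<noteq> t i" by blast
  have "(\<Sum>i\<in>I. L k i) < (\<Sum>i\<in>I. R k i)"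
    using k ij I LR LRs by (intro sum_strict_mono_ex1) (auto intro!: bexI[of _ i])
  then have "(\<Sum>k<n. \<Sum>i\<in>I. L k i) < (\<Sum>k<n. \<Sum>i\<in>I. R k i)"
    using k LR by (intro sum_strict_mono_ex1) (auto intro: sum_mono)
  then show "- (\<Sum>k<n. eta (l k)) < - (\<Sum>i\<in>I. eta (t i))" using sumL sumR by linarith
qed

section \<open>States and channel outputs\<close>

lemma sum_divmod:
  "(\<Sum>i<m * n. f i) = (\<Sum>a<m. \<Sum>b<n. f (a * n + b :: nat))"
proof -
  have "(\<Sum>i<m * n. f i) = (\<Sum>a<m. sum f {a * n..<a * n + n})" by (simp add: sum.nat_group)
  also have "\<dots> = (\<Sum>a<m. \<Sum>b<n. f (a * n + b))"
  proof (rule sum.cong[OF refl])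
    fix a
    show "sum f {a * n..<a * n + n} = (\<Sum>b<n. f (a * n + b))"
      using sum.shift_bounds_nat_ivl[of f 0 "a * n" n] by (simp add: atLeast0LessThan add.commute)
  qed
  finally show ?thesis .
qed

lemma pair_less:
  assumes "a < m" "b < n"
  shows "a * n + b < m * (n::nat)"
proof -
  have "a * n + b < Suc a * n" using assms by simp
  also have "\<dots> \<le> m * n" using assms by (intro mult_le_mono1) simp
  finally show ?thesis .
qed

lemma div_less_mult: "i < m * n \<Longrightarrow> i div n < (m::nat)"
  by (simp add: less_mult_imp_div_less)

lemma mod_less_mult: "i < m * n \<Longrightarrow> i mod n < (n::nat)"
  by (cases "n = 0") auto

text \<open>Factorisation over the two digits of \<open>a * n + b\<close>; it drives the tensor
  product computations below.\<close>

lemma sum_divmod_prod: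
  fixes f g :: "nat \<Rightarrow> complex"
  shows "(\<Sum>i<m * n. f (i div n) * g (i mod n)) = (\<Sum>a<m. f a) * (\<Sum>b<n. g b)"
  unfolding sum_divmod sum_product by (intro sum.cong refl) simp

text \<open>The entry of the isometry in the basis \<open>|b>|e>\<close> of the output space.\<close>

definition iso_at :: "stinespring \<Rightarrow> nat \<Rightarrow> nat \<Rightarrow> nat \<Rightarrow> complex" where
  "iso_at W b e a = s_iso W $$ (b * s_outE W + e, a)"

text \<open>The last clause is \<open>V^* V = 1\<close>. Positive input dimension provides a state,
  so that the supremum in \<open>Q1\<close> is over a nonempty set.\<close>

definition valid :: "stinespring \<Rightarrow> bool" where
  "valid W \<longleftrightarrow> s_in W > 0 \<and> s_outB W > 0 \<and> s_outE W > 0 \<and>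
     s_iso W \<in> carrier_mat (s_outB W * s_outE W) (s_in W) \<and>
     (\<forall>a<s_in W. \<forall>a'<s_in W.
        (\<Sum>b<s_outB W. \<Sum>e<s_outE W. cnj (iso_at W b e a) * iso_at W b e a') = (if a = a' then 1 else 0))"

text \<open>The matrix of \<open>V \<rho> V^*\<close> before either partial trace, with output and
  environment indices kept apart.\<close>

definition kernel :: "stinespring \<Rightarrow> complex mat \<Rightarrow> nat \<Rightarrow> nat \<Rightarrow> nat \<Rightarrow> nat \<Rightarrow> complex" where
  "kernel W \<rho> b e b' e' =
     (\<Sum>a<s_in W. \<Sum>a'<s_in W. iso_at W b e a * \<rho> $$ (a, a') * cnj (iso_at W b' e' a'))"

lemma conj_iso_index:
  assumes W: "valid W" and \<rho>: "\<rho> \<in> carrier_mat (s_in W) (s_in W)"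
    and b: "b < s_outB W" "b' < s_outB W" and e: "e < s_outE W" "e' < s_outE W"
  shows "conj_iso W \<rho> $$ (b * s_outE W + e, b' * s_outE W + e') = kernel W \<rho> b e b' e'"
proof -
  have V: "s_iso W \<in> carrier_mat (s_outB W * s_outE W) (s_in W)" using W by (simp add: valid_def)
  note r = pair_less[OF b(1) e(1)] and r' = pair_less[OF b(2) e(2)]
  have VR: "(s_iso W * \<rho>) $$ (b * s_outE W + e, a') = (\<Sum>a<s_in W. iso_at W b e a * \<rho> $$ (a, a'))"
    if "a' < s_in W" for a'
    using V \<rho> r that by (subst index_mult_mat(1)) (auto simp: scalar_prod_def atLeast0LessThan iso_at_def)
  have "conj_iso W \<rho> $$ (b * s_outE W + e, b' * s_outE W + e')
      = (\<Sum>a'<s_in W. (s_iso W * \<rho>) $$ (b * s_outE W + e, a') * cnj (iso_at W b' e' a'))"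
    unfolding conj_iso_def using V \<rho> r r'
    by (subst index_mult_mat(1)) (auto simp: scalar_prod_def atLeast0LessThan iso_at_def adj_def)
  also have "\<dots> = (\<Sum>a'<s_in W. \<Sum>a<s_in W. iso_at W b e a * \<rho> $$ (a, a') * cnj (iso_at W b' e' a'))"
    using VR by (intro sum.cong refl) (simp add: sum_distrib_right)
  finally show ?thesis unfolding kernel_def by (subst sum.swap)
qed

lemma chan_carrier [simp]: "chan W \<rho> \<in> carrier_mat (s_outB W) (s_outB W)"
  by (simp add: chan_def ptrace_E_def)

lemma chan_c_carrier [simp]: "chan_c W \<rho> \<in> carrier_mat (s_outE W) (s_outE W)"
  by (simp add: chan_c_def ptrace_B_def)

lemma chan_index:
  assumes "valid W" "\<rho> \<in> carrier_mat (s_in W) (s_in W)" "b < s_outB W" "b' < s_outB W"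
  shows "chan W \<rho> $$ (b, b') = (\<Sum>e<s_outE W. kernel W \<rho> b e b' e)"
  using assms by (simp add: chan_def ptrace_E_def conj_iso_index)

lemma chan_c_index:
  assumes "valid W" "\<rho> \<in> carrier_mat (s_in W) (s_in W)" "e < s_outE W" "e' < s_outE W"
  shows "chan_c W \<rho> $$ (e, e') = (\<Sum>b<s_outB W. kernel W \<rho> b e b e')"
  using assms by (simp add: chan_c_def ptrace_B_def conj_iso_index)

lemma densityI_gram:
  assumes X: "X \<in> carrier_mat n n" and I: "finite I"
    and g: "\<And>x y. x < n \<Longrightarrow> y < n \<Longrightarrow> X $$ (x, y) = (\<Sum>i\<in>I. g i x * cnj (g i y))"
    and t: "(\<Sum>i\<in>I. \<Sum>x<n. (cmod (g i x))\<^sup>2) = 1"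
  shows "density n X"
  unfolding density_def
proof (intro conjI allI)
  show "X \<in> carrier_mat n n" by fact
  show "adj X = X" using X by (intro eq_matI) (auto simp: adj_def g ac_simps)
  show "0 \<le> Re (\<Sum>i<n. \<Sum>j<n. cnj (v i) * X $$ (i, j) * v j)" for v
  proof -
    have "(\<Sum>i<n. \<Sum>j<n. cnj (v i) * X $$ (i, j) * v j) = sesq_form n (\<lambda>x y. X $$ (x, y)) v v"
      by (simp add: sesq_form_def)
    also have "\<dots> = (\<Sum>i\<in>I. 1 * (ip {..<n} v (g i) * ip {..<n} (g i) v))"
      by (rule sesq_form_gram) (simp add: g)
    also have "\<dots> = of_real (\<Sum>i\<in>I. (cmod (ip {..<n} (g i) v))\<^sup>2)"
      by (simp only: ip_mult_swap of_real_sum mult_1_left)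
    finally show ?thesis by (simp add: sum_nonneg)
  qed
  have "mtrace X = (\<Sum>x<n. \<Sum>i\<in>I. g i x * cnj (g i x))"
    using X g by (auto simp: mtrace_def)
  also have "\<dots> = of_real (\<Sum>x<n. \<Sum>i\<in>I. (cmod (g i x))\<^sup>2)"
    by (simp only: complex_mult_cnj_cmod of_real_sum)
  also have "(\<Sum>x<n. \<Sum>i\<in>I. (cmod (g i x))\<^sup>2) = 1" by (subst sum.swap) (rule t)
  finally show "mtrace X = 1" by simp
qed

lemma density_spectral:
  assumes "density n \<rho>"
  obtains u l where "spectral n (\<lambda>x y. \<rho> $$ (x, y)) u l" "\<And>k. k < n \<Longrightarrow> l k \<ge> 0" "(\<Sum>k<n. l k) = 1"
proof -
  have c: "\<rho> \<in> carrier_mat n n" and a: "adj \<rho> = \<rho>" using assms by (auto simp: density_def)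
  have "cnj (\<rho> $$ (x, y)) = \<rho> $$ (y, x)" if "x < n" "y < n" for x y
  proof -
    have "adj \<rho> $$ (y, x) = cnj (\<rho> $$ (x, y))" using c that by (simp add: adj_def)
    then show ?thesis using a by simp
  qed
  then obtain u l where s: "spectral n (\<lambda>x y. \<rho> $$ (x, y)) u l"
    using spectral_exists[of n "\<lambda>x y. \<rho> $$ (x, y)"] by blast
  have "l k \<ge> 0" if "k < n" for k
  proof -
    have "Re (sesq_form n (\<lambda>x y. \<rho> $$ (x, y)) (u k) (u k)) \<ge> 0"
      using assms unfolding density_def sesq_form_def by blast
    then show ?thesis using spectral_sesq_form_basis[OF s that that] by simp
  qed
  moreover have "(\<Sum>k<n. l k) = 1"
  proof -
    have "1 = (\<Sum>x<n. \<Sum>k<n. of_real (l k) * (u k x * cnj (u k x)))"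
      using assms c s by (simp add: density_def mtrace_def spectral_def)
    also have "\<dots> = (\<Sum>k<n. of_real (l k) * (\<Sum>x<n. cnj (u k x) * u k x))"
      by (subst sum.swap) (simp add: sum_distrib_left ac_simps)
    also have "\<dots> = (\<Sum>k<n. of_real (l k))"
      using orthonormalD[OF spectral_orthonormal[OF s]] by simp
    finally have "complex_of_real (\<Sum>k<n. l k) = 1" by simp
    then show ?thesis by (metis of_real_1 of_real_eq_iff)
  qed
  ultimately show thesis using that s by blast
qed

text \<open>\<open>G\<close> is a square root of \<rho> up to a unitary. Its second index serves as
  the reference system of a purification.\<close>

lemma density_gram:
  assumes "density n \<rho>"
  obtains G where "\<And>x y. x < n \<Longrightarrow> y < n \<Longrightarrow> \<rho> $$ (x, y) = (\<Sum>r<n. G x r * cnj (G y r))"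
proof -
  obtain u l where s: "spectral n (\<lambda>x y. \<rho> $$ (x, y)) u l" "\<And>k. k < n \<Longrightarrow> l k \<ge> 0"
    using density_spectral[OF assms] by metis
  define G where "G = (\<lambda>x r. of_real (sqrt (l r)) * u r x)"
  have "\<rho> $$ (x, y) = (\<Sum>r<n. G x r * cnj (G y r))" if "x < n" "y < n" for x y
  proof -
    have "\<rho> $$ (x, y) = (\<Sum>k<n. of_real (l k) * (u k x * cnj (u k y)))"
      using s(1) that by (simp add: spectral_def)
    also have "\<dots> = (\<Sum>r<n. G x r * cnj (G y r))"
    proof (intro sum.cong refl)
      fix k assume "k \<in> {..<n}"
      then have "complex_of_real (l k) = of_real (sqrt (l k)) * of_real (sqrt (l k))"
        using s(2) by (simp flip: of_real_mult)
      then show "of_real (l k) * (u k x * cnj (u k y)) = G x k * cnj (G y k)"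
        by (simp add: G_def)
    qed
    finally show ?thesis .
  qed
  then show thesis by (rule that)
qed

lemma density_trace: "density n \<rho> \<Longrightarrow> (\<Sum>x<n. \<rho> $$ (x, x)) = 1"
  by (auto simp: density_def mtrace_def)

lemma density_carrier: "density n \<rho> \<Longrightarrow> \<rho> \<in> carrier_mat n n"
  by (simp add: density_def)

lemma entropy_nonneg:
  assumes "density n \<rho>" shows "vN_entropy \<rho> \<ge> 0"
proof -
  obtain u l where s: "spectral n (\<lambda>x y. \<rho> $$ (x, y)) u l" "\<And>k. k < n \<Longrightarrow> l k \<ge> 0" "(\<Sum>k<n. l k) = 1"
    using density_spectral[OF assms] by metis
  have "l k \<le> 1" if "k < n" for k
    using member_le_sum[of k "{..<n}" l] s that by auto
  then have "(\<Sum>k<n. eta (l k)) \<le> 0" by (intro sum_nonpos eta_nonpos) auto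
  then show ?thesis using vN_entropy_spectral[OF density_carrier[OF assms] s(1)] by simp
qed

text \<open>Cross entropy against the uniform distribution in the eigenbasis of the state.\<close>

lemma entropy_le_log_dim:
  assumes "density n \<rho>" "n > 0" shows "vN_entropy \<rho> \<le> log 2 n"
proof -
  obtain u l where s: "spectral n (\<lambda>x y. \<rho> $$ (x, y)) u l" "\<And>k. k < n \<Longrightarrow> l k \<ge> 0" "(\<Sum>k<n. l k) = 1"
    using density_spectral[OF assms(1)] by metis
  have "- (\<Sum>k<n. eta (l k)) \<le> - (\<Sum>j<n. l j * log 2 (1 / n))"
    by (rule entropy_le_cross[OF s finite_lessThan spectral_orthonormal[OF s(1)]])
      (use spectral_sesq_form_basis[OF s(1)] s assms in auto)
  also have "\<dots> = log 2 n" using s(3) assms(2) by (simp add: sum_distrib_right[symmetric] sum_negf log_divide)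
  finally show ?thesis using vN_entropy_spectral[OF density_carrier[OF assms(1)] s(1)] by simp
qed

section \<open>Amplitudes of the purified output\<close>

lemma sum_swap3:
  "(\<Sum>b\<in>B. \<Sum>e\<in>E. \<Sum>r\<in>R. f b e r) = (\<Sum>e\<in>E. \<Sum>r\<in>R. \<Sum>b\<in>B. f b e r)"
proof -
  have "(\<Sum>b\<in>B. \<Sum>e\<in>E. \<Sum>r\<in>R. f b e r) = (\<Sum>e\<in>E. \<Sum>b\<in>B. \<Sum>r\<in>R. f b e r)" by (rule sum.swap)
  also have "\<dots> = (\<Sum>e\<in>E. \<Sum>r\<in>R. \<Sum>b\<in>B. f b e r)" by (intro sum.cong refl sum.swap)
  finally show ?thesis .
qed

text \<open>The amplitude at \<open>|b>|e>|r>\<close> of the purification \<open>G\<close> after the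
  isometry. Both channel outputs are marginals of this one vector.\<close>

definition outvec :: "stinespring \<Rightarrow> (nat \<Rightarrow> 'r \<Rightarrow> complex) \<Rightarrow> nat \<Rightarrow> nat \<Rightarrow> 'r \<Rightarrow> complex" where
  "outvec W G b e r = (\<Sum>a<s_in W. iso_at W b e a * G a r)"

lemma kernel_gram:
  assumes G: "\<And>x y. x < s_in W \<Longrightarrow> y < s_in W \<Longrightarrow> \<rho> $$ (x, y) = (\<Sum>r\<in>R. G x r * cnj (G y r))"
  shows "kernel W \<rho> b e b' e' = (\<Sum>r\<in>R. outvec W G b e r * cnj (outvec W G b' e' r))"
proof -
  have "kernel W \<rho> b e b' e' = (\<Sum>a<s_in W. \<Sum>a'<s_in W. \<Sum>r\<in>R.
      (iso_at W b e a * G a r) * cnj (iso_at W b' e' a' * G a' r))"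
    unfolding kernel_def using G
    by (intro sum.cong refl) (simp add: sum_distrib_left sum_distrib_right ac_simps)
  also have "\<dots> = (\<Sum>r\<in>R. \<Sum>a<s_in W. \<Sum>a'<s_in W.
      (iso_at W b e a * G a r) * cnj (iso_at W b' e' a' * G a' r))"
    by (rule sum_swap3[symmetric])
  also have "\<dots> = (\<Sum>r\<in>R. outvec W G b e r * cnj (outvec W G b' e' r))"
    unfolding outvec_def cnj_sum sum_product ..
  finally show ?thesis .
qed

lemma outvec_norm:
  assumes W: "valid W"
    and \<rho>: "density (s_in W) \<rho>"
    and G: "\<And>x y. x < s_in W \<Longrightarrow> y < s_in W \<Longrightarrow> \<rho> $$ (x, y) = (\<Sum>r\<in>R. G x r * cnj (G y r))"
  shows "(\<Sum>b<s_outB W. \<Sum>e<s_outE W. \<Sum>r\<in>R. (cmod (outvec W G b e r))\<^sup>2) = 1"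
proof -
  let ?A = "{..<s_in W}" and ?B = "{..<s_outB W}" and ?E = "{..<s_outE W}"
  have k: "kernel W \<rho> b e b' e' = (\<Sum>r\<in>R. outvec W G b e r * cnj (outvec W G b' e' r))" for b e b' e'
    by (rule kernel_gram) (rule G)
  have "complex_of_real (\<Sum>b\<in>?B. \<Sum>e\<in>?E. \<Sum>r\<in>R. (cmod (outvec W G b e r))\<^sup>2)
      = (\<Sum>b\<in>?B. \<Sum>e\<in>?E. kernel W \<rho> b e b e)"
    unfolding k by (simp only: complex_mult_cnj_cmod of_real_sum)
  also have "\<dots> = (\<Sum>b\<in>?B. \<Sum>e\<in>?E. \<Sum>a\<in>?A. \<Sum>a'\<in>?A. \<rho> $$ (a, a') * (cnj (iso_at W b e a') * iso_at W b e a))"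
    unfolding kernel_def by (simp only: ac_simps)
  also have "\<dots> = (\<Sum>a\<in>?A. \<Sum>b\<in>?B. \<Sum>e\<in>?E. \<Sum>a'\<in>?A. \<rho> $$ (a, a') * (cnj (iso_at W b e a') * iso_at W b e a))"
    by (rule sum_swap3[symmetric])
  also have "\<dots> = (\<Sum>a\<in>?A. \<Sum>a'\<in>?A. \<Sum>b\<in>?B. \<Sum>e\<in>?E. \<rho> $$ (a, a') * (cnj (iso_at W b e a') * iso_at W b e a))"
    by (intro sum.cong refl sum_swap3[symmetric])
  also have "\<dots> = (\<Sum>a\<in>?A. \<Sum>a'\<in>?A. \<rho> $$ (a, a') * (if a' = a then 1 else 0))"
    unfolding sum_distrib_left[symmetric] using W by (intro sum.cong refl) (simp add: valid_def)
  also have "\<dots> = (\<Sum>a\<in>?A. \<Sum>a'\<in>?A. if a' = a then \<rho> $$ (a, a') else 0)"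
    by (intro sum.cong refl) auto
  also have "\<dots> = 1" using density_trace[OF \<rho>] by (simp add: sum.delta)
  finally show ?thesis by (metis of_real_1 of_real_eq_iff)
qed

lemma chan_gram:
  assumes "valid W" "\<rho> \<in> carrier_mat (s_in W) (s_in W)"
    and G: "\<And>x y. x < s_in W \<Longrightarrow> y < s_in W \<Longrightarrow> \<rho> $$ (x, y) = (\<Sum>r\<in>R. G x r * cnj (G y r))"
    and "b < s_outB W" "b' < s_outB W"
  shows "chan W \<rho> $$ (b, b') = (\<Sum>(e,r)\<in>{..<s_outE W} \<times> R. outvec W G b e r * cnj (outvec W G b' e r))"
proof -
  have k: "kernel W \<rho> b e b' e' = (\<Sum>r\<in>R. outvec W G b e r * cnj (outvec W G b' e' r))" for b e b' e'
    by (rule kernel_gram) (rule G)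
  show ?thesis using chan_index[OF assms(1,2,4,5)] unfolding k by (simp add: sum.cartesian_product)
qed

lemma chan_c_gram:
  assumes "valid W" "\<rho> \<in> carrier_mat (s_in W) (s_in W)"
    and G: "\<And>x y. x < s_in W \<Longrightarrow> y < s_in W \<Longrightarrow> \<rho> $$ (x, y) = (\<Sum>r\<in>R. G x r * cnj (G y r))"
    and "e < s_outE W" "e' < s_outE W"
  shows "chan_c W \<rho> $$ (e, e') = (\<Sum>(b,r)\<in>{..<s_outB W} \<times> R. outvec W G b e r * cnj (outvec W G b e' r))"
proof -
  have k: "kernel W \<rho> b e b' e' = (\<Sum>r\<in>R. outvec W G b e r * cnj (outvec W G b' e' r))" for b e b' e'
    by (rule kernel_gram) (rule G)
  show ?thesis using chan_c_index[OF assms(1,2,4,5)] unfolding k by (simp add: sum.cartesian_product)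
qed

lemma density_chan:
  assumes W: "valid W" and \<rho>: "density (s_in W) \<rho>"
  shows "density (s_outB W) (chan W \<rho>)"
proof -
  obtain G where G: "\<And>x y. x < s_in W \<Longrightarrow> y < s_in W \<Longrightarrow>
      \<rho> $$ (x, y) = (\<Sum>r<s_in W. G x r * cnj (G y r))"
    using density_gram[OF \<rho>] by metis
  have norm: "(\<Sum>b<s_outB W. \<Sum>e<s_outE W. \<Sum>r<s_in W. (cmod (outvec W G b e r))\<^sup>2) = 1"
    by (rule outvec_norm[OF W \<rho>]) (rule G)
  show ?thesis
  proof (rule densityI_gram[where I = "{..<s_outE W} \<times> {..<s_in W}" and g = "\<lambda>(e,r) b. outvec W G b e r"])
    show "chan W \<rho> $$ (b, b') = (\<Sum>i\<in>{..<s_outE W} \<times> {..<s_in W}.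
      (case i of (e, r) \<Rightarrow> \<lambda>b. outvec W G b e r) b * cnj ((case i of (e, r) \<Rightarrow> \<lambda>b. outvec W G b e r) b'))"
      if "b < s_outB W" "b' < s_outB W" for b b'
    proof -
      have "chan W \<rho> $$ (b, b') = (\<Sum>(e,r)\<in>{..<s_outE W} \<times> {..<s_in W}. outvec W G b e r * cnj (outvec W G b' e r))"
        by (rule chan_gram[OF W density_carrier[OF \<rho>] _ that]) (rule G)
      then show ?thesis by (simp only: case_prod_unfold)
    qed
    show "(\<Sum>i\<in>{..<s_outE W} \<times> {..<s_in W}. \<Sum>b<s_outB W.
        (cmod ((case i of (e, r) \<Rightarrow> \<lambda>b. outvec W G b e r) b))\<^sup>2) = 1"
      using norm[THEN sum_swap3[symmetric, THEN trans]] by (simp add: sum.cartesian_product')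
  qed auto
qed

lemma density_chan_c:
  assumes W: "valid W" and \<rho>: "density (s_in W) \<rho>"
  shows "density (s_outE W) (chan_c W \<rho>)"
proof -
  obtain G where G: "\<And>x y. x < s_in W \<Longrightarrow> y < s_in W \<Longrightarrow>
      \<rho> $$ (x, y) = (\<Sum>r<s_in W. G x r * cnj (G y r))"
    using density_gram[OF \<rho>] by metis
  have norm: "(\<Sum>b<s_outB W. \<Sum>e<s_outE W. \<Sum>r<s_in W. (cmod (outvec W G b e r))\<^sup>2) = 1"
    by (rule outvec_norm[OF W \<rho>]) (rule G)
  show ?thesis
  proof (rule densityI_gram[where I = "{..<s_outB W} \<times> {..<s_in W}" and g = "\<lambda>(b,r) e. outvec W G b e r"])
    show "chan_c W \<rho> $$ (e, e') = (\<Sum>i\<in>{..<s_outB W} \<times> {..<s_in W}.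
      (case i of (b, r) \<Rightarrow> \<lambda>e. outvec W G b e r) e * cnj ((case i of (b, r) \<Rightarrow> \<lambda>e. outvec W G b e r) e'))"
      if "e < s_outE W" "e' < s_outE W" for e e'
    proof -
      have "chan_c W \<rho> $$ (e, e') = (\<Sum>(b,r)\<in>{..<s_outB W} \<times> {..<s_in W}. outvec W G b e r * cnj (outvec W G b e' r))"
        by (rule chan_c_gram[OF W density_carrier[OF \<rho>] _ that]) (rule G)
      then show ?thesis by (simp only: case_prod_unfold)
    qed
    have "(\<Sum>b<s_outB W. \<Sum>r<s_in W. \<Sum>e<s_outE W. (cmod (outvec W G b e r))\<^sup>2)
        = (\<Sum>b<s_outB W. \<Sum>e<s_outE W. \<Sum>r<s_in W. (cmod (outvec W G b e r))\<^sup>2)"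
      by (intro sum.cong refl sum.swap)
    then show "(\<Sum>i\<in>{..<s_outB W} \<times> {..<s_in W}. \<Sum>e<s_outE W.
        (cmod ((case i of (b, r) \<Rightarrow> \<lambda>e. outvec W G b e r) e))\<^sup>2) = 1"
      using norm by (simp add: sum.cartesian_product')
  qed auto
qed

text \<open>This bound makes the supremum in \<open>Q1\<close> finite; applied to tensor powers it
  also bounds the regularised sequence linearly.\<close>

lemma coh_info_le:
  assumes W: "valid W" and \<rho>: "density (s_in W) \<rho>"
  shows "coh_info W \<rho> \<le> log 2 (s_outB W)"
proof -
  have "s_outB W > 0" using W by (simp add: valid_def)
  then show ?thesis unfolding coh_info_def
    using entropy_le_log_dim[OF density_chan[OF assms]] entropy_nonneg[OF density_chan_c[OF assms]]
    by simp
qed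

lemma density_exists:
  assumes "n > 0"
  shows "\<exists>\<rho>. density n \<rho>"
proof
  have "(\<Sum>x<n. (cmod (if x = 0 then 1 else 0))\<^sup>2) = (\<Sum>x<n. if x = 0 then 1 else (0::real))"
    by (intro sum.cong) auto
  also have "\<dots> = 1" using assms by (simp add: sum.delta)
  finally have 1: "(\<Sum>x<n. (cmod (if x = 0 then 1 else 0))\<^sup>2) = (1::real)" .
  show "density n (mat n n (\<lambda>(x, y). if x = 0 \<and> y = 0 then 1 else 0))"
    by (rule densityI_gram[where I = "{0::nat}" and g = "\<lambda>_ x. if x = 0 then 1 else 0"])
      (auto simp: 1)
qed

lemma coh_info_le_Q1:
  assumes W: "valid W" and \<rho>: "density (s_in W) \<rho>"
  shows "coh_info W \<rho> \<le> Q1 W"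
  unfolding Q1_def
proof (rule cSup_upper)
  show "bdd_above {coh_info W \<rho> |\<rho>. density (s_in W) \<rho>}"
    using coh_info_le[OF W] by (intro bdd_aboveI[of _ "log 2 (s_outB W)"]) auto
qed (use \<rho> in auto)

lemma Q1_le:
  assumes W: "valid W" and c: "\<And>\<rho>. density (s_in W) \<rho> \<Longrightarrow> coh_info W \<rho> \<le> c"
  shows "Q1 W \<le> c"
  unfolding Q1_def
proof (rule cSup_least)
  show "{coh_info W \<rho> |\<rho>. density (s_in W) \<rho>} \<noteq> {}"
    using density_exists[of "s_in W"] W by (auto simp: valid_def)
qed (use c in auto)

section \<open>Tensor products and regularisation\<close>

lemma tensor_iso_simps [simp]:
  "s_in (tensor_iso W1 W2) = s_in W1 * s_in W2"
  "s_outB (tensor_iso W1 W2) = s_outB W1 * s_outB W2"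
  "s_outE (tensor_iso W1 W2) = s_outE W1 * s_outE W2"
  by (auto simp: tensor_iso_def Let_def)

lemma iso_at_tensor:
  assumes "b < s_outB W1 * s_outB W2" "e < s_outE W1 * s_outE W2" "a < s_in W1 * s_in W2"
  shows "iso_at (tensor_iso W1 W2) b e a =
    iso_at W1 (b div s_outB W2) (e div s_outE W2) (a div s_in W2) *
    iso_at W2 (b mod s_outB W2) (e mod s_outE W2) (a mod s_in W2)"
proof -
  have "(b * n + e) div n = b" if "e < n" for n using that by simp
  note this[OF assms(2)]
  then show ?thesis
    using pair_less[OF assms(1,2)] assms by (simp add: tensor_iso_def Let_def iso_at_def)
qed

lemma sum2_divmod_prod:
  fixes f g :: "nat \<Rightarrow> nat \<Rightarrow> complex"
  shows "(\<Sum>i<m * n. \<Sum>j<p * q. f (i div n) (j div q) * g (i mod n) (j mod q))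
    = (\<Sum>a<m. \<Sum>c<p. f a c) * (\<Sum>b<n. \<Sum>d<q. g b d)"
proof -
  have "(\<Sum>i<m * n. \<Sum>j<p * q. f (i div n) (j div q) * g (i mod n) (j mod q))
    = (\<Sum>i<m * n. (\<Sum>c<p. f (i div n) c) * (\<Sum>d<q. g (i mod n) d))"
    by (intro sum.cong refl sum_divmod_prod)
  also have "\<dots> = (\<Sum>a<m. \<Sum>c<p. f a c) * (\<Sum>b<n. \<Sum>d<q. g b d)"
    by (rule sum_divmod_prod)
  finally show ?thesis .
qed

lemma divmod_eq_iff: "x div n = y div n \<and> x mod n = y mod n \<longleftrightarrow> x = (y::nat)"
  by (metis div_mult_mod_eq)

lemma valid_tensor:
  assumes W1: "valid W1" and W2: "valid W2"
  shows "valid (tensor_iso W1 W2)"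
  unfolding valid_def tensor_iso_simps
proof (intro conjI allI impI)
  let ?W = "tensor_iso W1 W2"
  show "s_in W1 * s_in W2 > 0" "s_outB W1 * s_outB W2 > 0" "s_outE W1 * s_outE W2 > 0"
    using W1 W2 by (auto simp: valid_def)
  show "s_iso ?W \<in> carrier_mat (s_outB W1 * s_outB W2 * (s_outE W1 * s_outE W2)) (s_in W1 * s_in W2)"
    by (simp add: tensor_iso_def Let_def)
  fix a a' assume a: "a < s_in W1 * s_in W2" "a' < s_in W1 * s_in W2"
  let ?F = "\<lambda>W a a' b e. cnj (iso_at W b e a) * iso_at W b e a'"
  have "(\<Sum>b<s_outB W1 * s_outB W2. \<Sum>e<s_outE W1 * s_outE W2. cnj (iso_at ?W b e a) * iso_at ?W b e a')
    = (\<Sum>b<s_outB W1 * s_outB W2. \<Sum>e<s_outE W1 * s_outE W2.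
        ?F W1 (a div s_in W2) (a' div s_in W2) (b div s_outB W2) (e div s_outE W2) *
        ?F W2 (a mod s_in W2) (a' mod s_in W2) (b mod s_outB W2) (e mod s_outE W2))"
    using a by (intro sum.cong refl) (simp add: iso_at_tensor)
  also have "\<dots> = (\<Sum>b<s_outB W1. \<Sum>e<s_outE W1. ?F W1 (a div s_in W2) (a' div s_in W2) b e) *
      (\<Sum>b<s_outB W2. \<Sum>e<s_outE W2. ?F W2 (a mod s_in W2) (a' mod s_in W2) b e)"
    by (rule sum2_divmod_prod)
  also have "\<dots> = (if a div s_in W2 = a' div s_in W2 then 1 else 0) * (if a mod s_in W2 = a' mod s_in W2 then 1 else 0)"
    using W1 W2 a by (simp add: valid_def div_less_mult mod_less_mult)
  also have "\<dots> = (if a = a' then 1 else 0)"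
    using divmod_eq_iff[of a "s_in W2" a'] by auto
  finally show "(\<Sum>b<s_outB W1 * s_outB W2. \<Sum>e<s_outE W1 * s_outE W2. cnj (iso_at ?W b e a) * iso_at ?W b e a')
    = (if a = a' then 1 else 0)" .
qed

section \<open>Product states and superadditivity\<close>

definition kron :: "nat \<Rightarrow> nat \<Rightarrow> complex mat \<Rightarrow> complex mat \<Rightarrow> complex mat" where
  "kron m n X Y = mat (m * n) (m * n) (\<lambda>(i, j). X $$ (i div n, j div n) * Y $$ (i mod n, j mod n))"

lemma kron_carrier [simp]: "kron m n X Y \<in> carrier_mat (m * n) (m * n)"
  by (simp add: kron_def)

lemma kernel_tensor:
  assumes b: "b < s_outB W1 * s_outB W2" "b' < s_outB W1 * s_outB W2"
    and e: "e < s_outE W1 * s_outE W2" "e' < s_outE W1 * s_outE W2"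
  shows "kernel (tensor_iso W1 W2) (kron (s_in W1) (s_in W2) \<rho>1 \<rho>2) b e b' e' =
    kernel W1 \<rho>1 (b div s_outB W2) (e div s_outE W2) (b' div s_outB W2) (e' div s_outE W2) *
    kernel W2 \<rho>2 (b mod s_outB W2) (e mod s_outE W2) (b' mod s_outB W2) (e' mod s_outE W2)"
  unfolding kernel_def tensor_iso_simps
proof (subst sum2_divmod_prod[symmetric], intro sum.cong refl, goal_cases)
  case (1 a a')
  then show ?case using assms by (simp add: iso_at_tensor kron_def)
qed

lemma chan_tensor:
  assumes W: "valid W1" "valid W2" and \<rho>: "density (s_in W1) \<rho>1" "density (s_in W2) \<rho>2"
  shows "chan (tensor_iso W1 W2) (kron (s_in W1) (s_in W2) \<rho>1 \<rho>2) =
    kron (s_outB W1) (s_outB W2) (chan W1 \<rho>1) (chan W2 \<rho>2)" (is "?L = ?R")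
proof (rule eq_matI)
  fix b b' assume "b < dim_row ?R" "b' < dim_col ?R"
  then have b: "b < s_outB W1 * s_outB W2" "b' < s_outB W1 * s_outB W2" by (auto simp: kron_def)
  have "?L $$ (b, b') = (\<Sum>e<s_outE W1 * s_outE W2.
      kernel W1 \<rho>1 (b div s_outB W2) (e div s_outE W2) (b' div s_outB W2) (e div s_outE W2) *
      kernel W2 \<rho>2 (b mod s_outB W2) (e mod s_outE W2) (b' mod s_outB W2) (e mod s_outE W2))"
    using b by (subst chan_index[OF valid_tensor[OF W]]) (auto simp: kernel_tensor intro!: sum.cong)
  also have "\<dots> = ?R $$ (b, b')"
    by (subst sum_divmod_prod)
      (use b in \<open>simp add: kron_def chan_index[OF W(1) density_carrier[OF \<rho>(1)]]
         chan_index[OF W(2) density_carrier[OF \<rho>(2)]] div_less_mult mod_less_mult\<close>)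
  finally show "?L $$ (b, b') = ?R $$ (b, b')" .
qed (auto simp: kron_def chan_def ptrace_E_def)

lemma chan_c_tensor:
  assumes W: "valid W1" "valid W2" and \<rho>: "density (s_in W1) \<rho>1" "density (s_in W2) \<rho>2"
  shows "chan_c (tensor_iso W1 W2) (kron (s_in W1) (s_in W2) \<rho>1 \<rho>2) =
    kron (s_outE W1) (s_outE W2) (chan_c W1 \<rho>1) (chan_c W2 \<rho>2)" (is "?L = ?R")
proof (rule eq_matI)
  fix e e' assume "e < dim_row ?R" "e' < dim_col ?R"
  then have e: "e < s_outE W1 * s_outE W2" "e' < s_outE W1 * s_outE W2" by (auto simp: kron_def)
  have "?L $$ (e, e') = (\<Sum>b<s_outB W1 * s_outB W2.
      kernel W1 \<rho>1 (b div s_outB W2) (e div s_outE W2) (b div s_outB W2) (e' div s_outE W2) *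
      kernel W2 \<rho>2 (b mod s_outB W2) (e mod s_outE W2) (b mod s_outB W2) (e' mod s_outE W2))"
    using e by (subst chan_c_index[OF valid_tensor[OF W]]) (auto simp: kernel_tensor intro!: sum.cong)
  also have "\<dots> = ?R $$ (e, e')"
    by (subst sum_divmod_prod)
      (use e in \<open>simp add: kron_def chan_c_index[OF W(1) density_carrier[OF \<rho>(1)]]
         chan_c_index[OF W(2) density_carrier[OF \<rho>(2)]] div_less_mult mod_less_mult\<close>)
  finally show "?L $$ (e, e') = ?R $$ (e, e')" .
qed (auto simp: kron_def chan_c_def ptrace_B_def)

lemma spectral_kron:
  assumes s1: "spectral m (\<lambda>x y. X $$ (x, y)) u1 l1" and s2: "spectral n (\<lambda>x y. Y $$ (x, y)) u2 l2"
  shows "spectral (m * n) (\<lambda>x y. kron m n X Y $$ (x, y))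
    (\<lambda>k x. u1 (k div n) (x div n) * u2 (k mod n) (x mod n)) (\<lambda>k. l1 (k div n) * l2 (k mod n))"
    (is "spectral _ _ ?u ?l")
  unfolding spectral_def orthonormal_def
proof (intro conjI ballI allI impI)
  fix i j assume "i \<in> {..<m * n}" "j \<in> {..<m * n}"
  then have ij: "i < m * n" "j < m * n" by auto
  have "(\<Sum>x<m * n. cnj (?u i x) * ?u j x) = (\<Sum>x<m * n.
     (cnj (u1 (i div n) (x div n)) * u1 (j div n) (x div n)) * (cnj (u2 (i mod n) (x mod n)) * u2 (j mod n) (x mod n)))"
    by (intro sum.cong refl) simp
  also have "\<dots> = (\<Sum>x<m. cnj (u1 (i div n) x) * u1 (j div n) x) * (\<Sum>x<n. cnj (u2 (i mod n) x) * u2 (j mod n) x)"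
    by (rule sum_divmod_prod)
  also have "\<dots> = (if i div n = j div n then 1 else 0) * (if i mod n = j mod n then 1 else 0)"
    using orthonormalD[OF spectral_orthonormal[OF s1]] orthonormalD[OF spectral_orthonormal[OF s2]] ij
    by (simp add: div_less_mult mod_less_mult)
  also have "\<dots> = (if i = j then 1 else 0)" using divmod_eq_iff[of i n j] by auto
  finally show "(\<Sum>x<m * n. cnj (?u i x) * ?u j x) = (if i = j then 1 else 0)" .
next
  fix x y assume xy: "x < m * n" "y < m * n"
  have "(\<Sum>k<m * n. ?u k x * cnj (?u k y)) = (\<Sum>k<m * n.
     (u1 (k div n) (x div n) * cnj (u1 (k div n) (y div n))) * (u2 (k mod n) (x mod n) * cnj (u2 (k mod n) (y mod n))))"
    by (intro sum.cong refl) simp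
  also have "\<dots> = (\<Sum>k<m. u1 k (x div n) * cnj (u1 k (y div n))) * (\<Sum>k<n. u2 k (x mod n) * cnj (u2 k (y mod n)))"
    by (rule sum_divmod_prod)
  also have "\<dots> = (if x div n = y div n then 1 else 0) * (if x mod n = y mod n then 1 else 0)"
    using s1 s2 xy by (simp add: spectral_def div_less_mult mod_less_mult)
  also have "\<dots> = (if x = y then 1 else 0)" using divmod_eq_iff[of x n y] by auto
  finally show "(\<Sum>k<m * n. ?u k x * cnj (?u k y)) = (if x = y then 1 else 0)" .
  have "kron m n X Y $$ (x, y) = (\<Sum>k<m. of_real (l1 k) * (u1 k (x div n) * cnj (u1 k (y div n)))) *
     (\<Sum>k<n. of_real (l2 k) * (u2 k (x mod n) * cnj (u2 k (y mod n))))"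
    using s1 s2 xy by (simp add: spectral_def div_less_mult mod_less_mult kron_def)
  also have "\<dots> = (\<Sum>k<m * n. of_real (?l k) * (?u k x * cnj (?u k y)))"
    unfolding sum_divmod_prod[symmetric] by (intro sum.cong refl) simp
  finally show "kron m n X Y $$ (x, y) = (\<Sum>k<m * n. of_real (?l k) * (?u k x * cnj (?u k y)))" .
qed

lemma density_kron:
  assumes X: "density m X" and Y: "density n Y"
  shows "density (m * n) (kron m n X Y)"
proof -
  obtain G where G: "\<And>x y. x < m \<Longrightarrow> y < m \<Longrightarrow> X $$ (x, y) = (\<Sum>r<m. G x r * cnj (G y r))"
    using density_gram[OF X] by metis
  obtain H where H: "\<And>x y. x < n \<Longrightarrow> y < n \<Longrightarrow> Y $$ (x, y) = (\<Sum>r<n. H x r * cnj (H y r))"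
    using density_gram[OF Y] by metis
  define K where "K = (\<lambda>r x. G (x div n) (r div n) * H (x mod n) (r mod n))"
  have K: "kron m n X Y $$ (x, y) = (\<Sum>r<m * n. K r x * cnj (K r y))" if "x < m * n" "y < m * n" for x y
  proof -
    have "kron m n X Y $$ (x, y) = (\<Sum>r<m. G (x div n) r * cnj (G (y div n) r)) * (\<Sum>r<n. H (x mod n) r * cnj (H (y mod n) r))"
      using that by (simp add: kron_def G[symmetric] H[symmetric] div_less_mult mod_less_mult)
    also have "\<dots> = (\<Sum>r<m * n. (G (x div n) (r div n) * cnj (G (y div n) (r div n)))
        * (H (x mod n) (r mod n) * cnj (H (y mod n) (r mod n))))"
      by (rule sum_divmod_prod[symmetric])
    also have "\<dots> = (\<Sum>r<m * n. K r x * cnj (K r y))"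
      by (intro sum.cong refl) (simp add: K_def)
    finally show ?thesis .
  qed
  show ?thesis
  proof (rule densityI_gram[OF kron_carrier finite_lessThan K])
    have "complex_of_real (\<Sum>i<m * n. \<Sum>x<m * n. (cmod (K i x))\<^sup>2) = (\<Sum>x<m * n. \<Sum>i<m * n. K i x * cnj (K i x))"
      by (subst sum.swap) (simp only: complex_mult_cnj_cmod of_real_sum)
    also have "\<dots> = (\<Sum>x<m * n. X $$ (x div n, x div n) * Y $$ (x mod n, x mod n))"
      using K by (intro sum.cong refl) (simp add: kron_def flip: K)
    also have "\<dots> = 1" 
      using sum_divmod_prod[of "\<lambda>i. X $$ (i, i)" n "\<lambda>i. Y $$ (i, i)" m]
      by (simp add: density_trace[OF X] density_trace[OF Y])
    finally show "(\<Sum>i<m * n. \<Sum>x<m * n. (cmod (K i x))\<^sup>2) = 1" by (metis of_real_1 of_real_eq_iff)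
  qed
qed

text \<open>A Leibniz rule: summed over a product distribution it is additivity of entropy. The
  convention \<open>0 log 0 = 0\<close> covers vanishing factors.\<close>

lemma eta_mult:
  assumes "x \<ge> 0" "y \<ge> 0"
  shows "eta (x * y) = x * eta y + eta x * y"
  using assms by (cases "x = 0 \<or> y = 0") (auto simp: eta_def log_mult algebra_simps)

lemma entropy_kron:
  assumes X: "density m X" and Y: "density n Y"
  shows "vN_entropy (kron m n X Y) = vN_entropy X + vN_entropy Y"
proof -
  obtain u1 l1 where s1: "spectral m (\<lambda>x y. X $$ (x, y)) u1 l1" "\<And>k. k < m \<Longrightarrow> l1 k \<ge> 0" "(\<Sum>k<m. l1 k) = 1"
    using density_spectral[OF X] by metis
  obtain u2 l2 where s2: "spectral n (\<lambda>x y. Y $$ (x, y)) u2 l2" "\<And>k. k < n \<Longrightarrow> l2 k \<ge> 0" "(\<Sum>k<n. l2 k) = 1"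
    using density_spectral[OF Y] by metis
  have "(\<Sum>k<m * n. eta (l1 (k div n) * l2 (k mod n))) = (\<Sum>a<m. \<Sum>b<n. eta (l1 a * l2 b))"
    unfolding sum_divmod by (intro sum.cong refl) simp
  also have "\<dots> = (\<Sum>a<m. \<Sum>b<n. l1 a * eta (l2 b) + eta (l1 a) * l2 b)"
    using s1 s2 by (intro sum.cong refl eta_mult) auto
  also have "\<dots> = (\<Sum>a<m. l1 a) * (\<Sum>b<n. eta (l2 b)) + (\<Sum>a<m. eta (l1 a)) * (\<Sum>b<n. l2 b)"
    unfolding sum_product by (simp add: sum.distrib)
  finally show ?thesis
    using vN_entropy_spectral[OF kron_carrier spectral_kron[OF s1(1) s2(1)]]
      vN_entropy_spectral[OF density_carrier[OF X] s1(1)] vN_entropy_spectral[OF density_carrier[OF Y] s2(1)]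
      s1(3) s2(3) by simp
qed

text \<open>Entropy is additive on product inputs. The two suprema are taken one after the other,
  with the first state held fixed.\<close>

lemma Q1_tensor:
  assumes W: "valid W1" "valid W2"
  shows "Q1 W1 + Q1 W2 \<le> Q1 (tensor_iso W1 W2)"
proof -
  have *: "coh_info W1 \<rho>1 + coh_info W2 \<rho>2 \<le> Q1 (tensor_iso W1 W2)"
    if \<rho>: "density (s_in W1) \<rho>1" "density (s_in W2) \<rho>2" for \<rho>1 \<rho>2
  proof -
    have "coh_info (tensor_iso W1 W2) (kron (s_in W1) (s_in W2) \<rho>1 \<rho>2) = coh_info W1 \<rho>1 + coh_info W2 \<rho>2"
      unfolding coh_info_def chan_tensor[OF W \<rho>] chan_c_tensor[OF W \<rho>]
      using entropy_kron[OF density_chan[OF W(1) \<rho>(1)] density_chan[OF W(2) \<rho>(2)]]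
        entropy_kron[OF density_chan_c[OF W(1) \<rho>(1)] density_chan_c[OF W(2) \<rho>(2)]] by simp
    then show ?thesis
      using coh_info_le_Q1[OF valid_tensor[OF W], of "kron (s_in W1) (s_in W2) \<rho>1 \<rho>2"] density_kron[OF \<rho>]
      by simp
  qed
  have "Q1 W2 \<le> Q1 (tensor_iso W1 W2) - coh_info W1 \<rho>1" if "density (s_in W1) \<rho>1" for \<rho>1
    using *[OF that] by (intro Q1_le[OF W(2)]) (simp add: algebra_simps)
  then have "Q1 W1 \<le> Q1 (tensor_iso W1 W2) - Q1 W2"
    by (intro Q1_le[OF W(1)]) (simp add: algebra_simps)
  then show ?thesis by simp
qed

section \<open>Tensor powers as a strict monoid\<close>

lemma valid_iso_carrier: "valid W \<Longrightarrow> s_iso W \<in> carrier_mat (s_outB W * s_outE W) (s_in W)"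
  by (simp add: valid_def)

text \<open>The carrier conditions fix the matrix dimensions, so that equality of records follows,
  not just agreement of entries.\<close>

lemma stinespring_eqI:
  fixes W W' :: stinespring
  assumes "s_in W = s_in W'" "s_outB W = s_outB W'" "s_outE W = s_outE W'"
    and "s_iso W \<in> carrier_mat (s_outB W * s_outE W) (s_in W)"
    and "s_iso W' \<in> carrier_mat (s_outB W' * s_outE W') (s_in W')"
    and "\<And>b e a. b < s_outB W' \<Longrightarrow> e < s_outE W' \<Longrightarrow> a < s_in W' \<Longrightarrow> iso_at W b e a = iso_at W' b e a"
  shows "W = W'"
proof (rule stinespring.equality)
  show "s_iso W = s_iso W'"
  proof (rule eq_matI)
    fix i j assume "i < dim_row (s_iso W')" "j < dim_col (s_iso W')"
    then have ij: "i < s_outB W' * s_outE W'" "j < s_in W'" using assms(5) by auto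
    have "i div s_outE W' * s_outE W' + i mod s_outE W' = i" by simp
    then show "s_iso W $$ (i, j) = s_iso W' $$ (i, j)"
      using assms(6)[of "i div s_outE W'" "i mod s_outE W'" j] ij assms(3)
      by (simp add: iso_at_def div_less_mult mod_less_mult)
  qed (use assms in auto)
qed (use assms in auto)

lemma tensor_iso_carrier:
  "s_iso (tensor_iso W1 W2) \<in> carrier_mat (s_outB W1 * s_outB W2 * (s_outE W1 * s_outE W2)) (s_in W1 * s_in W2)"
  by (simp add: tensor_iso_def Let_def)

lemma divmod3:
  "x div (m * n) = x div n div (m::nat)" "x mod (m * n) div n = x div n mod m" "x mod (m * n) mod n = x mod n"
  by (auto simp: div_mult2_eq mult.commute[of m n] mod_mult2_eq, (cases "n = 0", auto)+)

text \<open>An index of a triple product is a three-digit number in mixed radix, whose digits do not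
  depend on the bracketing (\<open>divmod3\<close>). Associativity is therefore an equality, and
  powers can be split anywhere.\<close>

lemma tensor_iso_assoc:
  "tensor_iso (tensor_iso W1 W2) W3 = tensor_iso W1 (tensor_iso W2 W3)"
proof (rule stinespring_eqI)
  fix b e a
  let ?L = "tensor_iso (tensor_iso W1 W2) W3" and ?R = "tensor_iso W1 (tensor_iso W2 W3)"
  assume "b < s_outB ?R" "e < s_outE ?R" "a < s_in ?R"
  then have *: "b < s_outB W1 * (s_outB W2 * s_outB W3)" "e < s_outE W1 * (s_outE W2 * s_outE W3)"
    "a < s_in W1 * (s_in W2 * s_in W3)" by auto
  have R: "iso_at ?R b e a = iso_at W1 (b div (s_outB W2 * s_outB W3)) (e div (s_outE W2 * s_outE W3)) (a div (s_in W2 * s_in W3)) *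
     (iso_at W2 (b mod (s_outB W2 * s_outB W3) div s_outB W3) (e mod (s_outE W2 * s_outE W3) div s_outE W3) (a mod (s_in W2 * s_in W3) div s_in W3) *
      iso_at W3 (b mod (s_outB W2 * s_outB W3) mod s_outB W3) (e mod (s_outE W2 * s_outE W3) mod s_outE W3) (a mod (s_in W2 * s_in W3) mod s_in W3))"
    using * by (simp add: iso_at_tensor mod_less_mult)
  have ass: "b < s_outB W1 * s_outB W2 * s_outB W3" "e < s_outE W1 * s_outE W2 * s_outE W3"
    "a < s_in W1 * s_in W2 * s_in W3" using * by (auto simp: mult.assoc)
  have "iso_at ?L b e a = (iso_at W1 (b div s_outB W3 div s_outB W2) (e div s_outE W3 div s_outE W2) (a div s_in W3 div s_in W2) *
     iso_at W2 (b div s_outB W3 mod s_outB W2) (e div s_outE W3 mod s_outE W2) (a div s_in W3 mod s_in W2)) *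
     iso_at W3 (b mod s_outB W3) (e mod s_outE W3) (a mod s_in W3)"
    using ass by (simp add: iso_at_tensor div_less_mult)
  then show "iso_at ?L b e a = iso_at ?R b e a" unfolding R divmod3 by simp
next
  show "s_iso (tensor_iso (tensor_iso W1 W2) W3) \<in> carrier_mat (s_outB (tensor_iso (tensor_iso W1 W2) W3) *
    s_outE (tensor_iso (tensor_iso W1 W2) W3)) (s_in (tensor_iso (tensor_iso W1 W2) W3))"
    using tensor_iso_carrier[of "tensor_iso W1 W2" W3] by simp
  show "s_iso (tensor_iso W1 (tensor_iso W2 W3)) \<in> carrier_mat (s_outB (tensor_iso W1 (tensor_iso W2 W3)) *
    s_outE (tensor_iso W1 (tensor_iso W2 W3))) (s_in (tensor_iso W1 (tensor_iso W2 W3)))"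
    using tensor_iso_carrier[of W1 "tensor_iso W2 W3"] by simp
qed (auto simp: mult.assoc)

lemma unit_iso_simps [simp]: "s_in unit_iso = 1" "s_outB unit_iso = 1" "s_outE unit_iso = 1"
  by (auto simp: unit_iso_def)

lemma iso_at_unit [simp]: "iso_at unit_iso 0 0 0 = 1"
  by (simp add: iso_at_def unit_iso_def)

lemma valid_unit: "valid unit_iso"
  by (auto simp: valid_def, auto simp: unit_iso_def)

lemma tensor_unit_left:
  assumes "valid W" shows "tensor_iso unit_iso W = W"
proof (rule stinespring_eqI)
  show "iso_at (tensor_iso unit_iso W) b e a = iso_at W b e a" if "b < s_outB W" "e < s_outE W" "a < s_in W" for b e a
    using that by (subst iso_at_tensor) auto
  show "s_iso (tensor_iso unit_iso W) \<in> carrier_mat (s_outB (tensor_iso unit_iso W) * s_outE (tensor_iso unit_iso W)) (s_in (tensor_iso unit_iso W))"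
    using tensor_iso_carrier[of unit_iso W] by simp
qed (use assms in \<open>auto simp: valid_iso_carrier\<close>)

lemma tensor_unit_right:
  assumes "valid W" shows "tensor_iso W unit_iso = W"
proof (rule stinespring_eqI)
  show "iso_at (tensor_iso W unit_iso) b e a = iso_at W b e a" if "b < s_outB W" "e < s_outE W" "a < s_in W" for b e a
    using that by (subst iso_at_tensor) auto
  show "s_iso (tensor_iso W unit_iso) \<in> carrier_mat (s_outB (tensor_iso W unit_iso) * s_outE (tensor_iso W unit_iso)) (s_in (tensor_iso W unit_iso))"
    using tensor_iso_carrier[of W unit_iso] by simp
qed (use assms in \<open>auto simp: valid_iso_carrier\<close>)

lemma valid_tensor_pow: "valid W \<Longrightarrow> valid (tensor_pow W n)"
  by (induction n) (auto intro: valid_unit valid_tensor)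

lemma tensor_pow_add:
  assumes "valid W"
  shows "tensor_pow W (m + n) = tensor_iso (tensor_pow W m) (tensor_pow W n)"
  by (induction n) (auto simp: tensor_unit_right[OF valid_tensor_pow[OF assms]] tensor_iso_assoc)

lemma tensor_pow_1: "valid W \<Longrightarrow> tensor_pow W (Suc 0) = W"
  by (simp add: tensor_unit_left)

lemma s_outB_tensor_pow: "s_outB (tensor_pow W n) = s_outB W ^ n"
  by (induction n) auto

text \<open>Fekete's lemma. \<open>Qcap\<close> is defined by \<open>lim\<close>, which is
  informative only once convergence is known; the limit is the supremum, hence above every
  term.\<close>

lemma superadditive_limit:
  fixes a :: "nat \<Rightarrow> real" and C :: real
  assumes sup: "\<And>m n. a m + a n \<le> a (m + n)" and bd: "\<And>n. n > 0 \<Longrightarrow> a n \<le> C * n"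
  obtains L where "(\<lambda>n. a (Suc n) / real (Suc n)) \<longlonglongrightarrow> L" "L \<le> C" "\<And>n. a (Suc n) / real (Suc n) \<le> L"
proof -
  define f where "f = (\<lambda>n. a (Suc n) / real (Suc n))"
  have fC: "f n \<le> C" for n
    using bd[of "Suc n"] by (simp add: f_def divide_le_eq)
  define L where "L = Sup (range f)"
  have bdd: "bdd_above (range f)" using fC by (auto intro!: bdd_aboveI)
  have fL: "f n \<le> L" for n unfolding L_def using bdd by (intro cSup_upper) auto
  have LC: "L \<le> C" unfolding L_def using fC by (intro cSup_least) auto
  have mult: "real q * a m + a r \<le> a (q * m + r)" for q m r
  proof (induction q)
    case (Suc q)
    have "a m + a (q * m + r) \<le> a (m + (q * m + r))" by (rule sup)
    then show ?case using Suc by (simp add: algebra_simps)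
  qed simp
  have "f \<longlonglongrightarrow> L"
  proof (rule LIMSEQ_I)
    fix \<epsilon> :: real assume \<epsilon>: "\<epsilon> > 0"
    have "\<exists>y\<in>range f. L - \<epsilon> / 2 < y"
      using \<epsilon> less_cSup_iff[OF _ bdd, of "L - \<epsilon> / 2"] by (simp add: L_def)
    then obtain m0 where m0: "L - \<epsilon> / 2 < f m0" by auto
    define m where "m = Suc m0"
    define M where "M = (\<Sum>r<m. \<bar>a r\<bar>) + \<bar>a m\<bar>"
    \<comment> \<open>Division with remainder, \<open>n = q * m + r\<close>: superadditivity gives
      \<open>q * a m + a r \<le> a n\<close>, and \<open>M\<close> absorbs both \<open>a r\<close>
      and the rounding of \<open>n / m\<close> to \<open>q\<close>, uniformly in
      \<open>n\<close>.\<close>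
    have low: "a m / m - M / n \<le> a n / n" if n: "n > 0" for n
    proof -
      define q r where "q = n div m" and "r = n mod m"
      have nq: "n = q * m + r" and r: "r < m" by (simp_all only: q_def r_def div_mult_mod_eq) (simp add: m_def)
      have "real n = real q * real m + real r" using arg_cong[OF nq, of real] by simp
      moreover have "real m > 0" by (simp add: m_def)
      ultimately have q: "real q * a m = real n * (a m / m) - real r / real m * a m"
        by (simp add: field_simps)
      have "\<bar>a r\<bar> \<le> (\<Sum>r<m. \<bar>a r\<bar>)" using r by (intro member_le_sum) auto
      moreover have "\<bar>real r / real m * a m\<bar> \<le> 1 * \<bar>a m\<bar>"
        unfolding abs_mult using r by (intro mult_right_mono) auto
      ultimately have "real n * (a m / m) - M \<le> real q * a m + a r"
        unfolding q M_def by linarith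
      also have "\<dots> \<le> a n" using mult[of q m r] nq by simp
      finally have "(real n * (a m / m) - M) / n \<le> a n / n" by (rule divide_right_mono) simp
      then show ?thesis using n by (simp add: diff_divide_distrib)
    qed
    obtain N :: nat where N: "N > 0" "M / N < \<epsilon> / 2"
    proof -
      obtain N :: nat where "real N > M / (\<epsilon> / 2)" using reals_Archimedean2 by blast
      then have "M / real (Suc N) < \<epsilon> / 2" using \<epsilon> by (simp add: field_simps)
      then show thesis using that[of "Suc N"] by simp
    qed
    have M0: "M \<ge> 0" unfolding M_def by (simp add: sum_nonneg)
    show "\<exists>no. \<forall>n\<ge>no. norm (f n - L) < \<epsilon>"
    proof (intro exI[of _ N] allI impI)
      fix n assume "n \<ge> N"
      then have "M / real (Suc n) \<le> M / N" using N M0 by (intro divide_left_mono) auto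
      moreover have "f m0 - M / real (Suc n) \<le> f n" using low[of "Suc n"] by (simp add: f_def m_def)
      ultimately have "f n > L - \<epsilon>" using m0 N by linarith
      then show "norm (f n - L) < \<epsilon>" using fL[of n] \<epsilon> by simp
    qed
  qed
  then show thesis using that LC fL unfolding f_def by blast
qed

text \<open>Any linear bound on \<open>Q1\<close> of the powers yields existence of the limit, an
  upper bound for it, and the fact that a single use of the channel is a lower bound.\<close>

lemma Qcap_bounds:
  fixes C :: real
  assumes W: "valid W" and C: "\<And>n. n > 0 \<Longrightarrow> Q1 (tensor_pow W n) \<le> C * n"
  shows "Qcap W \<le> C" "Q1 W \<le> Qcap W"
proof -
  have "Q1 (tensor_pow W m) + Q1 (tensor_pow W n) \<le> Q1 (tensor_pow W (m + n))" for m n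
    unfolding tensor_pow_add[OF W] by (intro Q1_tensor valid_tensor_pow W)
  then obtain L where L: "(\<lambda>n. Q1 (tensor_pow W (Suc n)) / real (Suc n)) \<longlonglongrightarrow> L" "L \<le> C"
    "\<And>n. Q1 (tensor_pow W (Suc n)) / real (Suc n) \<le> L"
    using superadditive_limit[of "\<lambda>n. Q1 (tensor_pow W n)" C] C by blast
  have "Qcap W = L" unfolding Qcap_def using L(1) by (rule limI)
  then show "Qcap W \<le> C" "Q1 W \<le> Qcap W"
    using L(2) L(3)[of 0] tensor_pow_1[OF W] by auto
qed

lemma Q1_le_Qcap:
  assumes W: "valid W" shows "Q1 W \<le> Qcap W"
proof (rule Qcap_bounds(2)[OF W, where C = "log 2 (s_outB W)"])
  fix n :: nat
  have "s_outB W > 0" using W by (simp add: valid_def)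
  then show "Q1 (tensor_pow W n) \<le> log 2 (s_outB W) * n"
    using coh_info_le[OF valid_tensor_pow[OF W], of n]
    by (intro Q1_le valid_tensor_pow W) (simp add: s_outB_tensor_pow log_nat_power mult.commute)
qed

section \<open>Partial transpose bound on the coherent information\<close>

lemma sum_swap4:
  "(\<Sum>a\<in>A. \<Sum>b\<in>B. \<Sum>c\<in>C. \<Sum>d\<in>D. f a b c d) = (\<Sum>c\<in>C. \<Sum>d\<in>D. \<Sum>a\<in>A. \<Sum>b\<in>B. f a b c d)"
proof -
  have "(\<Sum>a\<in>A. \<Sum>b\<in>B. \<Sum>c\<in>C. \<Sum>d\<in>D. f a b c d) = (\<Sum>a\<in>A. \<Sum>c\<in>C. \<Sum>d\<in>D. \<Sum>b\<in>B. f a b c d)"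
    by (intro sum.cong refl sum_swap3)
  also have "\<dots> = (\<Sum>c\<in>C. \<Sum>d\<in>D. \<Sum>a\<in>A. \<Sum>b\<in>B. f a b c d)"
    by (rule sum_swap3)
  finally show ?thesis .
qed

text \<open>\<open>x\<close> and \<open>y\<close> decompose the partial transpose of the Choi matrix as \<open>\<Sum>s. |x_s><y_s|\<close>, in such a way that
  both \<open>\<Sum>s. Tr_B |x_s><x_s|\<close> and \<open>\<Sum>s. Tr_B |y_s><y_s|\<close> equal the diagonal matrix \<open>D\<close>.\<close>

definition pt_family :: "stinespring \<Rightarrow> nat \<Rightarrow> (nat \<Rightarrow> nat \<Rightarrow> nat \<Rightarrow> complex) \<Rightarrow>
    (nat \<Rightarrow> nat \<Rightarrow> nat \<Rightarrow> complex) \<Rightarrow> (nat \<Rightarrow> real) \<Rightarrow> bool" where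
  "pt_family W N x y D \<longleftrightarrow>
     (\<forall>a<s_in W. \<forall>a'<s_in W. \<forall>b<s_outB W. \<forall>b'<s_outB W.
        (\<Sum>e<s_outE W. iso_at W b' e a * cnj (iso_at W b e a')) = (\<Sum>s<N. x s a b * cnj (y s a' b'))) \<and>
     (\<forall>z\<in>{x, y}. \<forall>a<s_in W. \<forall>a'<s_in W.
        (\<Sum>s<N. \<Sum>b<s_outB W. z s a b * cnj (z s a' b)) = (if a = a' then of_real (D a) else 0))"

text \<open>Read as operators, the family writes the channel followed by transposition as
  \<open>\<Sum>s. X_s \<rho> Y_s^*\<close> with \<open>\<Sum>s. X_s^* X_s\<close> and
  \<open>\<Sum>s. Y_s^* Y_s\<close> at most \<open>c\<close>; hence \<open>c\<close> bounds the
  diamond norm of that map. As the marginals are diagonal, the operator bound is a bound on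
  numbers.\<close>

definition pt_bounded :: "stinespring \<Rightarrow> real \<Rightarrow> bool" where
  "pt_bounded W c \<longleftrightarrow> (\<exists>N x y D. pt_family W N x y D \<and> (\<forall>a<s_in W. 0 \<le> D a \<and> D a \<le> c))"

text \<open>On the left the output indices are crossed: \<open>x\<close> carries \<open>b\<close>
  while its partner carries \<open>b'\<close>. Regrouping moves the crossing to the reference
  indices \<open>r\<close> and \<open>r'\<close>, where it is harmless, because a Hilbert-Schmidt
  norm does not see a transposition.\<close>

lemma partial_transpose_swap:
  fixes x y :: "nat \<Rightarrow> nat \<Rightarrow> complex"
  shows "(\<Sum>b<B. \<Sum>b'<B. \<Sum>a<A. \<Sum>a'<A. (x a b * cnj (y a' b')) * ((\<Sum>r<R. G a r * U r b') * cnj (\<Sum>r<R. G a' r * U r b)))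
    = (\<Sum>r<R. \<Sum>r'<R. (\<Sum>b<B. (\<Sum>a<A. x a b * G a r) * cnj (U r' b)) * cnj (\<Sum>b<B. (\<Sum>a<A. y a b * G a r') * cnj (U r b)))"
proof -
  let ?M = "\<lambda>z r b. \<Sum>a<A. z a b * G a r"
  have MU: "(\<Sum>a<A. z a b * (\<Sum>r<R. G a r * U r b')) = (\<Sum>r<R. ?M z r b * U r b')" for z b b'
    unfolding sum_distrib_left sum_distrib_right by (subst sum.swap) (simp only: ac_simps)
  have "(\<Sum>b<B. \<Sum>b'<B. \<Sum>a<A. \<Sum>a'<A. (x a b * cnj (y a' b')) * ((\<Sum>r<R. G a r * U r b') * cnj (\<Sum>r<R. G a' r * U r b)))
    = (\<Sum>b<B. \<Sum>b'<B. (\<Sum>a<A. x a b * (\<Sum>r<R. G a r * U r b')) * cnj (\<Sum>a'<A. y a' b' * (\<Sum>r<R. G a' r * U r b)))"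
    unfolding cnj_sum[of _ "{..<A}"] sum_product[of _ "{..<A}"] by (simp add: ac_simps)
  also have "\<dots> = (\<Sum>b<B. \<Sum>b'<B. \<Sum>r<R. \<Sum>r'<R. (?M x r b * U r b') * cnj (?M y r' b' * U r' b))"
    unfolding MU unfolding cnj_sum[of _ "{..<R}"] sum_product[of _ "{..<R}"] ..
  also have "\<dots> = (\<Sum>r<R. \<Sum>r'<R. \<Sum>b<B. \<Sum>b'<B. (?M x r b * U r b') * cnj (?M y r' b' * U r' b))"
    by (rule sum_swap4)
  also have "\<dots> = (\<Sum>r<R. \<Sum>r'<R. \<Sum>b<B. \<Sum>b'<B. (?M x r b * cnj (U r' b)) * cnj (?M y r' b' * cnj (U r b')))"
    by (intro sum.cong refl) (simp only: ac_simps complex_cnj_mult complex_cnj_cnj)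
  also have "\<dots> = (\<Sum>r<R. \<Sum>r'<R. (\<Sum>b<B. ?M x r b * cnj (U r' b)) * cnj (\<Sum>b<B. ?M y r' b * cnj (U r b)))"
    unfolding cnj_sum[of _ "{..<B}"] sum_product[of _ "{..<B}"] ..
  finally show ?thesis .
qed

text \<open>\<open>U k\<close> are Kraus operators of a trace non-increasing map from the output to
  a copy of the reference. The left side is the overlap of the recovered state with the unnormalised
  maximally entangled vector; it is linear in the Choi matrix, so the factorisation can be
  inserted.\<close>

lemma recovery_le_pt_bounded:
  assumes cert: "pt_bounded W c"
    and G: "(\<Sum>a<s_in W. \<Sum>r<R. (cmod (G a r))\<^sup>2) = 1"
    and U: "\<And>\<eta>. (\<Sum>k<K. \<Sum>r<R. (cmod (\<Sum>b<s_outB W. \<eta> b * U k r b))\<^sup>2) \<le> (\<Sum>b<s_outB W. (cmod (\<eta> b))\<^sup>2)"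
  shows "(\<Sum>k<K. \<Sum>e<s_outE W. (cmod (\<Sum>b<s_outB W. \<Sum>r<R. outvec W G b e r * U k r b))\<^sup>2) \<le> c"
proof -
  let ?A = "{..<s_in W}" and ?B = "{..<s_outB W}" and ?E = "{..<s_outE W}" and ?R = "{..<R}" and ?K = "{..<K}"
  obtain N x y D where fam: "pt_family W N x y D" and D: "\<And>a. a \<in> ?A \<Longrightarrow> D a \<le> c"
    using cert unfolding pt_bounded_def by auto
  have PT: "(\<Sum>e\<in>?E. iso_at W b' e a * cnj (iso_at W b e a')) = (\<Sum>s<N. x s a b * cnj (y s a' b'))"
    if "a \<in> ?A" "a' \<in> ?A" "b \<in> ?B" "b' \<in> ?B" for a a' b b'
    using fam that unfolding pt_family_def by auto
  have xy: "(\<Sum>s<N. \<Sum>b\<in>?B. z s a b * cnj (z s a' b)) = (if a = a' then of_real (D a) else 0)"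
    if "z \<in> {x, y}" "a \<in> ?A" "a' \<in> ?A" for z a a'
    using fam that unfolding pt_family_def by blast
  \<comment> \<open>After the swap each member of the family is contracted with the state on its
    input side and with one recovery operator on its output side.\<close>
  define T where "T = (\<lambda>(z :: nat \<Rightarrow> nat \<Rightarrow> nat \<Rightarrow> complex) k s r r'. \<Sum>b\<in>?B. (\<Sum>a\<in>?A. z s a b * G a r) * cnj (U k r' b))"
  define Z where "Z = (\<lambda>k a b. \<Sum>r\<in>?R. G a r * U k r b)"
  define z where "z = (\<lambda>k e. \<Sum>b\<in>?B. \<Sum>r\<in>?R. outvec W G b e r * U k r b)"
  have zZ: "z k e = (\<Sum>b\<in>?B. \<Sum>a\<in>?A. iso_at W b e a * Z k a b)" for k e
    unfolding z_def Z_def outvec_def sum_distrib_left sum_distrib_right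
    by (rule sum.cong[OF refl], subst sum.swap) (simp only: ac_simps)
  have key: "(\<Sum>e\<in>?E. z k e * cnj (z k e)) = (\<Sum>s<N. \<Sum>r\<in>?R. \<Sum>r'\<in>?R. T x k s r r' * cnj (T y k s r' r))" for k
  proof -
    have "(\<Sum>e\<in>?E. z k e * cnj (z k e)) = (\<Sum>e\<in>?E. \<Sum>b'\<in>?B. \<Sum>b\<in>?B. \<Sum>a\<in>?A. \<Sum>a'\<in>?A.
        (iso_at W b' e a * Z k a b') * cnj (iso_at W b e a' * Z k a' b))"
      unfolding zZ cnj_sum sum_product ..
    also have "\<dots> = (\<Sum>e\<in>?E. \<Sum>b\<in>?B. \<Sum>b'\<in>?B. \<Sum>a\<in>?A. \<Sum>a'\<in>?A.
        (iso_at W b' e a * Z k a b') * cnj (iso_at W b e a' * Z k a' b))"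
      by (intro sum.cong[OF refl] sum.swap)
    also have "\<dots> = (\<Sum>b\<in>?B. \<Sum>b'\<in>?B. \<Sum>e\<in>?E. \<Sum>a\<in>?A. \<Sum>a'\<in>?A.
        (iso_at W b' e a * Z k a b') * cnj (iso_at W b e a' * Z k a' b))"
      by (rule sum_swap3)
    also have "\<dots> = (\<Sum>b\<in>?B. \<Sum>b'\<in>?B. \<Sum>a\<in>?A. \<Sum>a'\<in>?A. \<Sum>e\<in>?E.
        (iso_at W b' e a * Z k a b') * cnj (iso_at W b e a' * Z k a' b))"
      by (intro sum.cong[OF refl] sum_swap3)
    also have "\<dots> = (\<Sum>b\<in>?B. \<Sum>b'\<in>?B. \<Sum>a\<in>?A. \<Sum>a'\<in>?A.
        (\<Sum>e\<in>?E. iso_at W b' e a * cnj (iso_at W b e a')) * (Z k a b' * cnj (Z k a' b)))"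
      by (intro sum.cong[OF refl]) (simp only: sum_distrib_left sum_distrib_right complex_cnj_mult ac_simps)
    also have "\<dots> = (\<Sum>b\<in>?B. \<Sum>b'\<in>?B. \<Sum>a\<in>?A. \<Sum>a'\<in>?A. \<Sum>s<N.
        (x s a b * cnj (y s a' b')) * (Z k a b' * cnj (Z k a' b)))"
      using PT by (intro sum.cong[OF refl]) (simp only: sum_distrib_right)
    also have "\<dots> = (\<Sum>b\<in>?B. \<Sum>b'\<in>?B. \<Sum>s<N. \<Sum>a\<in>?A. \<Sum>a'\<in>?A.
        (x s a b * cnj (y s a' b')) * (Z k a b' * cnj (Z k a' b)))"
      by (intro sum.cong[OF refl] sum_swap3[symmetric])
    also have "\<dots> = (\<Sum>s<N. \<Sum>b\<in>?B. \<Sum>b'\<in>?B. \<Sum>a\<in>?A. \<Sum>a'\<in>?A.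
        (x s a b * cnj (y s a' b')) * (Z k a b' * cnj (Z k a' b)))"
      by (rule sum_swap3[symmetric])
    also have "\<dots> = (\<Sum>s<N. \<Sum>r\<in>?R. \<Sum>r'\<in>?R. T x k s r r' * cnj (T y k s r' r))"
      unfolding Z_def T_def partial_transpose_swap ..
    finally show ?thesis .
  qed
  \<comment> \<open>The contraction property removes \<open>U\<close>; what remains is the marginal
    of the family in the input state, a mean of the entries of \<open>D\<close>.\<close>
  have Tb: "(\<Sum>k\<in>?K. \<Sum>s<N. \<Sum>r\<in>?R. \<Sum>r'\<in>?R. (cmod (T w k s r r'))\<^sup>2) \<le> c" if w: "w \<in> {x, y}" for w
  proof -
    have cj: "cmod (T w k s r r') = cmod (\<Sum>b\<in>?B. cnj (\<Sum>a\<in>?A. w s a b * G a r) * U k r' b)" for k s r r'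
    proof -
      have "cnj (T w k s r r') = (\<Sum>b\<in>?B. cnj (\<Sum>a\<in>?A. w s a b * G a r) * U k r' b)"
        unfolding T_def by simp
      then show ?thesis by (metis complex_mod_cnj)
    qed
    have "(\<Sum>k\<in>?K. \<Sum>s<N. \<Sum>r\<in>?R. \<Sum>r'\<in>?R. (cmod (T w k s r r'))\<^sup>2)
      = (\<Sum>s<N. \<Sum>r\<in>?R. \<Sum>k\<in>?K. \<Sum>r'\<in>?R. (cmod (T w k s r r'))\<^sup>2)"
      by (rule sum_swap3)
    also have "\<dots> \<le> (\<Sum>s<N. \<Sum>r\<in>?R. \<Sum>b\<in>?B. (cmod (\<Sum>a\<in>?A. w s a b * G a r))\<^sup>2)"
    proof (intro sum_mono)
      fix s r
      show "(\<Sum>k\<in>?K. \<Sum>r'\<in>?R. (cmod (T w k s r r'))\<^sup>2) \<le> (\<Sum>b\<in>?B. (cmod (\<Sum>a\<in>?A. w s a b * G a r))\<^sup>2)"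
        unfolding cj using U[of "\<lambda>b. cnj (\<Sum>a\<in>?A. w s a b * G a r)"] by (simp only: complex_mod_cnj)
    qed
    also have "\<dots> \<le> c"
    proof -
      have "complex_of_real (\<Sum>s<N. \<Sum>r\<in>?R. \<Sum>b\<in>?B. (cmod (\<Sum>a\<in>?A. w s a b * G a r))\<^sup>2)
        = (\<Sum>s<N. \<Sum>r\<in>?R. \<Sum>b\<in>?B. \<Sum>a\<in>?A. \<Sum>a'\<in>?A. (w s a b * G a r) * cnj (w s a' b * G a' r))"
        unfolding of_real_sum complex_mult_cnj_cmod[symmetric] cnj_sum sum_product ..
      also have "\<dots> = (\<Sum>s<N. \<Sum>b\<in>?B. \<Sum>r\<in>?R. \<Sum>a\<in>?A. \<Sum>a'\<in>?A. (w s a b * cnj (w s a' b)) * (G a r * cnj (G a' r)))"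
        by (rule sum.cong[OF refl], subst sum.swap) (simp only: complex_cnj_mult ac_simps)
      also have "\<dots> = (\<Sum>s<N. \<Sum>b\<in>?B. \<Sum>a\<in>?A. \<Sum>a'\<in>?A. \<Sum>r\<in>?R. (w s a b * cnj (w s a' b)) * (G a r * cnj (G a' r)))"
        by (intro sum.cong[OF refl] sum_swap3)
      also have "\<dots> = (\<Sum>a\<in>?A. \<Sum>a'\<in>?A. \<Sum>s<N. \<Sum>b\<in>?B. \<Sum>r\<in>?R. (w s a b * cnj (w s a' b)) * (G a r * cnj (G a' r)))"
        by (rule sum_swap4)
      also have "\<dots> = (\<Sum>a\<in>?A. \<Sum>a'\<in>?A. (\<Sum>s<N. \<Sum>b\<in>?B. w s a b * cnj (w s a' b)) * (\<Sum>r\<in>?R. G a r * cnj (G a' r)))"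
        by (simp only: sum_distrib_right) (simp only: sum_distrib_left)
      also have "\<dots> = (\<Sum>a\<in>?A. \<Sum>a'\<in>?A. if a' = a then of_real (D a) * (\<Sum>r\<in>?R. G a r * cnj (G a' r)) else 0)"
        using xy[OF w] by (intro sum.cong[OF refl]) auto
      also have "\<dots> = (\<Sum>a\<in>?A. of_real (D a) * (\<Sum>r\<in>?R. G a r * cnj (G a r)))"
        by (simp add: sum.delta)
      also have "\<dots> = complex_of_real (\<Sum>a\<in>?A. D a * (\<Sum>r\<in>?R. (cmod (G a r))\<^sup>2))"
        by (simp only: complex_mult_cnj_cmod of_real_sum of_real_mult)
      finally have "(\<Sum>s<N. \<Sum>r\<in>?R. \<Sum>b\<in>?B. (cmod (\<Sum>a\<in>?A. w s a b * G a r))\<^sup>2)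
         = (\<Sum>a\<in>?A. D a * (\<Sum>r\<in>?R. (cmod (G a r))\<^sup>2))" using of_real_eq_iff by blast
      also have "\<dots> \<le> (\<Sum>a\<in>?A. c * (\<Sum>r\<in>?R. (cmod (G a r))\<^sup>2))"
        using D by (intro sum_mono mult_right_mono sum_nonneg) auto
      also have "\<dots> = c" using G by (simp add: sum_distrib_left[symmetric])
      finally show ?thesis .
    qed
    finally show ?thesis .
  qed
  have "complex_of_real (\<Sum>k\<in>?K. \<Sum>e\<in>?E. (cmod (z k e))\<^sup>2)
      = (\<Sum>k\<in>?K. \<Sum>s<N. \<Sum>r\<in>?R. \<Sum>r'\<in>?R. T x k s r r' * cnj (T y k s r' r))"
    unfolding of_real_sum complex_mult_cnj_cmod[symmetric] key ..
  from arg_cong[OF this, of Re] have "(\<Sum>k\<in>?K. \<Sum>e\<in>?E. (cmod (z k e))\<^sup>2)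
      = (\<Sum>k\<in>?K. \<Sum>s<N. \<Sum>r\<in>?R. \<Sum>r'\<in>?R. Re (T x k s r r' * cnj (T y k s r' r)))"
    by (simp only: Re_complex_of_real Re_sum)
  \<comment> \<open>The arithmetic-geometric mean replaces Cauchy-Schwarz without loss, since both
    factors obey the same bound \<open>c\<close>.\<close>
  also have "\<dots> \<le> (\<Sum>k\<in>?K. \<Sum>s<N. \<Sum>r\<in>?R. \<Sum>r'\<in>?R. ((cmod (T x k s r r'))\<^sup>2 + (cmod (T y k s r' r))\<^sup>2) / 2)"
  proof (intro sum_mono)
    fix k s r r'
    have "Re (T x k s r r' * cnj (T y k s r' r)) \<le> cmod (T x k s r r') * cmod (T y k s r' r)"
      using complex_Re_le_cmod[of "T x k s r r' * cnj (T y k s r' r)"] by (simp add: norm_mult)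
    also have "\<dots> \<le> ((cmod (T x k s r r'))\<^sup>2 + (cmod (T y k s r' r))\<^sup>2) / 2"
      using sum_squares_bound[of "cmod (T x k s r r')" "cmod (T y k s r' r)"] by simp
    finally show "Re (T x k s r r' * cnj (T y k s r' r)) \<le> ((cmod (T x k s r r'))\<^sup>2 + (cmod (T y k s r' r))\<^sup>2) / 2" .
  qed
  also have "\<dots> = ((\<Sum>k\<in>?K. \<Sum>s<N. \<Sum>r\<in>?R. \<Sum>r'\<in>?R. (cmod (T x k s r r'))\<^sup>2)
      + (\<Sum>k\<in>?K. \<Sum>s<N. \<Sum>r\<in>?R. \<Sum>r'\<in>?R. (cmod (T y k s r' r))\<^sup>2)) / 2"
    by (simp add: sum.distrib sum_divide_distrib[symmetric])
  \<comment> \<open>Here the crossing of \<open>r\<close> and \<open>r'\<close> disappears: all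
    entries are summed.\<close>
  also have "(\<Sum>k\<in>?K. \<Sum>s<N. \<Sum>r\<in>?R. \<Sum>r'\<in>?R. (cmod (T y k s r' r))\<^sup>2)
      = (\<Sum>k\<in>?K. \<Sum>s<N. \<Sum>r\<in>?R. \<Sum>r'\<in>?R. (cmod (T y k s r r'))\<^sup>2)"
    by (intro sum.cong[OF refl] sum.swap)
  finally have "(\<Sum>k\<in>?K. \<Sum>e\<in>?E. (cmod (z k e))\<^sup>2) \<le> c"
    using Tb[of x] Tb[of y] by simp
  then show ?thesis unfolding z_def .
qed

text \<open>The weights \<open>\<Sum>r. |p k j r|^2\<close> are the joint distribution of the
  environment outcome \<open>k\<close> and the output outcome \<open>j\<close>. Under it the entropy
  difference is at most the mean of the logarithm of \<open>\<epsilon> k * K / \<kappa> j\<close>,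
  where \<open>K = \<Sum>j. \<kappa> j\<close>, and the mean of that ratio is exactly
  \<open>K^2\<close>. The amplitudes \<open>p\<close> are handed on because the recovery operation
  is built from them.\<close>

lemma coh_info_le_kraus:
  assumes W: "valid W" and \<rho>: "density (s_in W) \<rho>"
    and G: "\<And>x y. x < s_in W \<Longrightarrow> y < s_in W \<Longrightarrow> \<rho> $$ (x, y) = (\<Sum>r<s_in W. G x r * cnj (G y r))"
  obtains f t :: "nat \<Rightarrow> nat \<Rightarrow> complex" and \<epsilon> \<kappa> J p where
    "orthonormal {..<s_outE W} {..<s_outE W} f"
    "\<And>k. k < s_outE W \<Longrightarrow> \<epsilon> k \<ge> 0" "(\<Sum>k<s_outE W. \<epsilon> k) = 1"
    "finite J" "J \<noteq> {}" "J \<subseteq> {..<s_outB W}" "orthonormal J {..<s_outB W} t" "\<And>j. j \<in> J \<Longrightarrow> \<kappa> j > 0"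
    "\<And>k j r. p k j r = ip {..<s_outB W} (t j) (\<lambda>b. ip {..<s_outE W} (f k) (\<lambda>e. outvec W G b e r))"
    "\<And>i j. i \<in> J \<Longrightarrow> j \<in> J \<Longrightarrow>
       (\<Sum>k<s_outE W. \<Sum>r<s_in W. of_real (\<epsilon> k) * (p k i r * cnj (p k j r))) = (if i = j then of_real ((\<kappa> j)\<^sup>2) else 0)"
    "coh_info W \<rho> \<le> log 2 ((\<Sum>j\<in>J. \<kappa> j)\<^sup>2)"
proof -
  let ?B = "{..<s_outB W}" and ?E = "{..<s_outE W}" and ?R = "{..<s_in W}"
  obtain f \<epsilon> where f: "spectral (s_outE W) (\<lambda>x y. chan_c W \<rho> $$ (x, y)) f \<epsilon>"
    and \<epsilon>0: "\<And>k. k < s_outE W \<Longrightarrow> \<epsilon> k \<ge> 0" and \<epsilon>1: "(\<Sum>k\<in>?E. \<epsilon> k) = 1"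
    using density_spectral[OF density_chan_c[OF W \<rho>]] by metis
  obtain u l where u: "spectral (s_outB W) (\<lambda>x y. chan W \<rho> $$ (x, y)) u l"
    and l: "\<And>k. k < s_outB W \<Longrightarrow> l k \<ge> 0" "(\<Sum>k\<in>?B. l k) = 1"
    using density_spectral[OF density_chan[OF W \<rho>]] by metis
  note fo = spectral_orthonormal[OF f]
  \<comment> \<open>The Kraus operator for the environment eigenvector \<open>f k\<close>, applied
    to the purification; its squared norm is \<open>\<epsilon> k\<close>.\<close>
  define \<psi> where "\<psi> = (\<lambda>k b r. ip ?E (f k) (\<lambda>e. outvec W G b e r))"
  have psi_norm: "(\<Sum>b\<in>?B. \<Sum>r\<in>?R. (cmod (\<psi> k b r))\<^sup>2) = \<epsilon> k" if k: "k < s_outE W" for k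
  proof -
    have "sesq_form (s_outE W) (\<lambda>x y. chan_c W \<rho> $$ (x, y)) (f k) (f k)
      = (\<Sum>i\<in>?B \<times> ?R. 1 * (ip ?E (f k) (\<lambda>e. outvec W G (fst i) e (snd i)) * ip ?E (\<lambda>e. outvec W G (fst i) e (snd i)) (f k)))"
    proof (rule sesq_form_gram)
      fix x y assume xy: "x < s_outE W" "y < s_outE W"
      have "chan_c W \<rho> $$ (x, y) = (\<Sum>(b,r)\<in>?B \<times> ?R. outvec W G b x r * cnj (outvec W G b y r))"
        by (rule chan_c_gram[OF W density_carrier[OF \<rho>] _ xy]) (rule G)
      then show "chan_c W \<rho> $$ (x, y) = (\<Sum>i\<in>?B \<times> ?R. 1 * (outvec W G (fst i) x (snd i) * cnj (outvec W G (fst i) y (snd i))))"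
        by (simp only: case_prod_unfold mult_1_left)
    qed
    also have "\<dots> = of_real (\<Sum>i\<in>?B \<times> ?R. (cmod (\<psi> k (fst i) (snd i)))\<^sup>2)"
      unfolding mult_1_left ip_mult_swap[of _ _ "f k"] \<psi>_def
      by (simp only: ip_mult_swap of_real_sum cmod_ip_sym[of ?E _ "f k"])
    also have "(\<Sum>i\<in>?B \<times> ?R. (cmod (\<psi> k (fst i) (snd i)))\<^sup>2) = (\<Sum>b\<in>?B. \<Sum>r\<in>?R. (cmod (\<psi> k b r))\<^sup>2)"
      by (simp add: sum.cartesian_product')
    finally show ?thesis using spectral_sesq_form_basis[OF f k k] of_real_eq_iff by metis
  qed
  have chan_psi: "chan W \<rho> $$ (b, b') = (\<Sum>i\<in>?E \<times> ?R. \<psi> (fst i) b (snd i) * cnj (\<psi> (fst i) b' (snd i)))"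
    if b: "b < s_outB W" "b' < s_outB W" for b b'
  proof -
    have "chan W \<rho> $$ (b, b') = (\<Sum>(e,r)\<in>?E \<times> ?R. outvec W G b e r * cnj (outvec W G b' e r))"
      by (rule chan_gram[OF W density_carrier[OF \<rho>] _ b]) (rule G)
    also have "\<dots> = (\<Sum>r\<in>?R. ip ?E (\<lambda>e. outvec W G b' e r) (\<lambda>e. outvec W G b e r))"
      unfolding ip_def by (simp only: sum.cartesian_product[symmetric]) (subst sum.swap, simp only: ac_simps)
    also have "\<dots> = (\<Sum>r\<in>?R. \<Sum>k\<in>?E. cnj (\<psi> k b' r) * \<psi> k b r)"
      unfolding ip_expand[OF fo, of "\<lambda>e. outvec W G b' e _"] \<psi>_def ..
    also have "\<dots> = (\<Sum>i\<in>?E \<times> ?R. \<psi> (fst i) b (snd i) * cnj (\<psi> (fst i) b' (snd i)))"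
      unfolding sum.cartesian_product' fst_conv snd_conv by (subst sum.swap) (simp only: ac_simps)
    finally show ?thesis .
  qed
  \<comment> \<open>The square of the operator \<open>K\<close> of the overview: each Kraus term of
    the output is weighted once more by its own probability.\<close>
  define L where "L = (\<lambda>b b'. \<Sum>i\<in>?E \<times> ?R. of_real (\<epsilon> (fst i)) * (\<psi> (fst i) b (snd i) * cnj (\<psi> (fst i) b' (snd i))))"
  have "cnj (L b b') = L b' b" for b b'
    unfolding L_def by (simp add: ac_simps)
  then obtain t ev where t: "spectral (s_outB W) L t ev"
    using spectral_exists[of "s_outB W" L] by blast
  note to = spectral_orthonormal[OF t]
  define p where "p = (\<lambda>k j r. ip ?B (t j) (\<lambda>b. \<psi> k b r))"
  have pp: "(\<Sum>k\<in>?E. \<Sum>r\<in>?R. of_real (\<epsilon> k) * (p k i r * cnj (p k j r))) = (if i = j then of_real (ev j) else 0)"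
    if ij: "i < s_outB W" "j < s_outB W" for i j
  proof -
    have "sesq_form (s_outB W) L (t i) (t j) = (\<Sum>i'\<in>?E \<times> ?R. of_real (\<epsilon> (fst i')) *
        (ip ?B (t i) (\<lambda>b. \<psi> (fst i') b (snd i')) * ip ?B (\<lambda>b. \<psi> (fst i') b (snd i')) (t j)))"
      by (rule sesq_form_gram) (simp add: L_def)
    also have "\<dots> = (\<Sum>k\<in>?E. \<Sum>r\<in>?R. of_real (\<epsilon> k) * (p k i r * cnj (p k j r)))"
      unfolding sum.cartesian_product' fst_conv snd_conv p_def cnj_ip ..
    finally show ?thesis using spectral_sesq_form_basis[OF t ij] by simp
  qed
  define P where "P = (\<lambda>k j. \<Sum>r\<in>?R. (cmod (p k j r))\<^sup>2)"
  have P0: "P k j \<ge> 0" for k j unfolding P_def by (intro sum_nonneg) auto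
  have ell: "ev j = (\<Sum>k\<in>?E. \<epsilon> k * P k j)" if j: "j < s_outB W" for j
  proof -
    have "complex_of_real (ev j) = of_real (\<Sum>k\<in>?E. \<Sum>r\<in>?R. \<epsilon> k * (cmod (p k j r))\<^sup>2)"
      using pp[OF j j] by (simp only: complex_mult_cnj_cmod of_real_sum of_real_mult if_True refl)
    then show ?thesis using of_real_eq_iff unfolding P_def sum_distrib_left by blast
  qed
  have Psum: "(\<Sum>j\<in>?B. P k j) = \<epsilon> k" if k: "k < s_outE W" for k
  proof -
    have "(\<Sum>j\<in>?B. P k j) = (\<Sum>r\<in>?R. \<Sum>j\<in>?B. (cmod (p k j r))\<^sup>2)" unfolding P_def by (rule sum.swap)
    also have "\<dots> = (\<Sum>r\<in>?R. \<Sum>b\<in>?B. (cmod (\<psi> k b r))\<^sup>2)" unfolding p_def parseval[OF to] ..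
    also have "\<dots> = \<epsilon> k" using psi_norm[OF k] by (subst sum.swap)
    finally show ?thesis .
  qed
  define q where "q = (\<lambda>j. \<Sum>k\<in>?E. P k j)"
  have q: "complex_of_real (q j) = sesq_form (s_outB W) (\<lambda>x y. chan W \<rho> $$ (x, y)) (t j) (t j)" for j
  proof -
    have "sesq_form (s_outB W) (\<lambda>x y. chan W \<rho> $$ (x, y)) (t j) (t j) = (\<Sum>i\<in>?E \<times> ?R. 1 *
        (ip ?B (t j) (\<lambda>b. \<psi> (fst i) b (snd i)) * ip ?B (\<lambda>b. \<psi> (fst i) b (snd i)) (t j)))"
      by (rule sesq_form_gram) (simp add: chan_psi)
    also have "\<dots> = (\<Sum>k\<in>?E. \<Sum>r\<in>?R. p k j r * cnj (p k j r))"
      unfolding sum.cartesian_product' fst_conv snd_conv p_def cnj_ip mult_1_left ..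
    finally show ?thesis unfolding q_def P_def by (simp only: complex_mult_cnj_cmod of_real_sum)
  qed
  \<comment> \<open>Restriction to the support, since \<open>\<kappa> j\<close> will be inverted.
    \<open>PJ\<close> shows that nothing is lost: outside \<open>J\<close> all amplitudes
    vanish.\<close>
  define J where "J = {j\<in>?B. ev j > 0}"
  have J: "finite J" "J \<subseteq> ?B" by (auto simp: J_def)
  have ell0: "ev j \<ge> 0" if "j < s_outB W" for j
    unfolding ell[OF that] using \<epsilon>0 P0 by (intro sum_nonneg mult_nonneg_nonneg) auto
  have PJ: "P k j = 0" if "k < s_outE W" "j \<in> ?B - J" for k j
  proof -
    have j: "j < s_outB W" "ev j = 0" using that ell0 by (auto simp: J_def order_le_less)
    have "\<epsilon> k * P k j = 0"
      using j(2) unfolding ell[OF j(1)]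
      by (subst (asm) sum_nonneg_eq_0_iff) (use \<epsilon>0 P0 that in auto)
    moreover have "P k j = 0" if "\<epsilon> k = 0"
      using Psum[OF \<open>k < s_outE W\<close>] unfolding \<open>\<epsilon> k = 0\<close>
      by (subst (asm) sum_nonneg_eq_0_iff) (use P0 j in auto)
    ultimately show ?thesis by auto
  qed
  have PsumJ: "(\<Sum>j\<in>J. P k j) = \<epsilon> k" if k: "k < s_outE W" for k
  proof -
    have "(\<Sum>j\<in>J. P k j) = (\<Sum>j\<in>?B. P k j)"
      using J(2) PJ[OF k] by (intro sum.mono_neutral_left) auto
    then show ?thesis using Psum[OF k] by simp
  qed
  have qsum: "(\<Sum>j\<in>J. q j) = 1"
    unfolding q_def by (subst sum.swap) (simp add: PsumJ \<epsilon>1)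
  then have Jne: "J \<noteq> {}" by auto
  define \<kappa> where "\<kappa> = (\<lambda>j. sqrt (ev j))"
  have \<kappa>0: "\<kappa> j > 0" if "j \<in> J" for j using that by (simp add: \<kappa>_def J_def)
  have \<kappa>2: "(\<kappa> j)\<^sup>2 = ev j" if "j \<in> J" for j using that by (simp add: \<kappa>_def J_def)
  define K where "K = (\<Sum>j\<in>J. \<kappa> j)"
  have K: "K > 0" unfolding K_def using J Jne \<kappa>0 by (intro sum_pos) auto
  have toJ: "orthonormal J ?B t" using to J(2) unfolding orthonormal_def by blast
  \<comment> \<open>The normalised eigenvalues of \<open>K\<close> serve as reference distribution
    for the measured output.\<close>
  have SB: "vN_entropy (chan W \<rho>) \<le> - (\<Sum>j\<in>J. q j * log 2 (\<kappa> j / K))"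
    unfolding vN_entropy_spectral[OF chan_carrier u]
  proof (rule entropy_le_cross[OF u l J(1) toJ q qsum])
    show "\<kappa> j / K > 0" if "j \<in> J" for j using \<kappa>0[OF that] K by simp
    show "(\<Sum>j\<in>J. \<kappa> j / K) \<le> 1" using K by (simp add: sum_divide_distrib[symmetric] K_def)
  qed
  have SE: "vN_entropy (chan_c W \<rho>) = - (\<Sum>k\<in>?E. \<Sum>j\<in>J. P k j * log 2 (\<epsilon> k))"
  proof -
    have "(\<Sum>k\<in>?E. eta (\<epsilon> k)) = (\<Sum>k\<in>?E. \<Sum>j\<in>J. P k j * log 2 (\<epsilon> k))"
      using \<epsilon>0 by (intro sum.cong refl) (auto simp: sum_distrib_right[symmetric] PsumJ eta_def order_le_less)
    then show ?thesis using vN_entropy_spectral[OF chan_c_carrier f] by simp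
  qed
  \<comment> \<open>The tangent of the logarithm is taken at \<open>K^2\<close>, the mean of the
    argument, so that the linear terms cancel in the sum (\<open>PK\<close> against
    \<open>P1\<close>).\<close>
  have term_le: "P k j * (log 2 (\<epsilon> k) - log 2 (\<kappa> j / K)) \<le>
      P k j * (log 2 (K\<^sup>2)) + (P k j * \<epsilon> k / (\<kappa> j * K) - P k j) / ln 2" if kj: "k < s_outE W" "j \<in> J" for k j
  proof (cases "P k j = 0")
    case False
    have "P k j \<le> (\<Sum>j\<in>J. P k j)" using kj P0 J by (intro member_le_sum) auto
    then have ek: "\<epsilon> k > 0" using False P0[of k j] PsumJ[OF kj(1)] by linarith
    note kj0 = \<kappa>0[OF kj(2)]
    have "log 2 (\<epsilon> k / (\<kappa> j / K)) - log 2 (K\<^sup>2) \<le> (\<epsilon> k / (\<kappa> j / K) / K\<^sup>2 - 1) / ln 2"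
      using ek kj0 K by (intro log_ratio_le) auto
    also have "\<epsilon> k / (\<kappa> j / K) / K\<^sup>2 = \<epsilon> k / (\<kappa> j * K)"
      using K kj0 by (simp add: field_simps power2_eq_square)
    also have "log 2 (\<epsilon> k / (\<kappa> j / K)) = log 2 (\<epsilon> k) - log 2 (\<kappa> j / K)"
      using ek kj0 K by (simp add: log_def ln_div ln_mult diff_divide_distrib add_divide_distrib)
    finally have "P k j * (log 2 (\<epsilon> k) - log 2 (\<kappa> j / K)) \<le> P k j * (log 2 (K\<^sup>2) + (\<epsilon> k / (\<kappa> j * K) - 1) / ln 2)"
      using P0 by (intro mult_left_mono) auto
    then show ?thesis by (simp add: distrib_left right_diff_distrib diff_divide_distrib)
  qed simp
  have PK: "(\<Sum>k\<in>?E. \<Sum>j\<in>J. P k j * \<epsilon> k / (\<kappa> j * K)) = 1"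
  proof -
    have "(\<Sum>k\<in>?E. \<Sum>j\<in>J. P k j * \<epsilon> k / (\<kappa> j * K)) = (\<Sum>j\<in>J. (\<Sum>k\<in>?E. \<epsilon> k * P k j) / (\<kappa> j * K))"
      by (subst sum.swap) (simp add: sum_divide_distrib mult.commute)
    also have "\<dots> = (\<Sum>j\<in>J. \<kappa> j / K)"
    proof (intro sum.cong refl)
      fix j assume j: "j \<in> J"
      then have "(\<Sum>k\<in>?E. \<epsilon> k * P k j) = \<kappa> j * \<kappa> j"
        using ell[of j] \<kappa>2[OF j] J(2) by (auto simp: power2_eq_square)
      then show "(\<Sum>k\<in>?E. \<epsilon> k * P k j) / (\<kappa> j * K) = \<kappa> j / K" using \<kappa>0[OF j] by simp
    qed
    also have "\<dots> = 1" using K by (simp add: sum_divide_distrib[symmetric] K_def)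
    finally show ?thesis .
  qed
  have P1: "(\<Sum>k\<in>?E. \<Sum>j\<in>J. P k j) = 1" using \<epsilon>1 PsumJ by simp
  have "coh_info W \<rho> \<le> (\<Sum>k\<in>?E. \<Sum>j\<in>J. P k j * (log 2 (\<epsilon> k) - log 2 (\<kappa> j / K)))"
  proof -
    have "(\<Sum>j\<in>J. q j * log 2 (\<kappa> j / K)) = (\<Sum>k\<in>?E. \<Sum>j\<in>J. P k j * log 2 (\<kappa> j / K))"
      unfolding q_def sum_distrib_right by (rule sum.swap)
    then show ?thesis using SB SE unfolding coh_info_def
      by (simp add: right_diff_distrib sum_subtractf)
  qed
  also have "\<dots> \<le> (\<Sum>k\<in>?E. \<Sum>j\<in>J. P k j * (log 2 (K\<^sup>2)) + (P k j * \<epsilon> k / (\<kappa> j * K) - P k j) / ln 2)"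
    using term_le by (intro sum_mono) auto
  also have "\<dots> = (\<Sum>k\<in>?E. \<Sum>j\<in>J. P k j) * log 2 (K\<^sup>2)
      + ((\<Sum>k\<in>?E. \<Sum>j\<in>J. P k j * \<epsilon> k / (\<kappa> j * K)) - (\<Sum>k\<in>?E. \<Sum>j\<in>J. P k j)) / ln 2"
    by (simp add: sum.distrib sum_subtractf sum_distrib_right sum_divide_distrib diff_divide_distrib)
  also have "\<dots> = log 2 (K\<^sup>2)" unfolding PK P1 by simp
  finally have coh: "coh_info W \<rho> \<le> log 2 (K\<^sup>2)" .
  show thesis
  proof (rule that[of f \<epsilon> J t \<kappa> p, OF fo \<epsilon>0 \<epsilon>1 J(1) Jne J(2) toJ \<kappa>0 _ _ coh[unfolded K_def]])
    show "p k j r = ip ?B (t j) (\<lambda>b. ip ?E (f k) (\<lambda>e. outvec W G b e r))" for k j r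
      by (simp add: p_def \<psi>_def)
    show "(\<Sum>k\<in>?E. \<Sum>r\<in>?R. of_real (\<epsilon> k) * (p k i r * cnj (p k j r))) = (if i = j then of_real ((\<kappa> j)\<^sup>2) else 0)"
      if ij: "i \<in> J" "j \<in> J" for i j
    proof -
      have "i < s_outB W" "j < s_outB W" using ij J(2) by auto
      from pp[OF this] show ?thesis using \<kappa>2[OF ij(2)] by simp
    qed
  qed auto
qed

text \<open>It remains to compare \<open>(\<Sum>j. \<kappa> j)^2\<close> with the overlap reached by
  the recovery operation. Of each vector \<open>z k\<close> only the component along
  \<open>f k\<close> is kept; these components recombine to the trace of \<open>K\<close>, and
  Cauchy-Schwarz concludes.\<close>

theorem coh_info_le_pt_bounded:
  assumes W: "valid W" and cert: "pt_bounded W c" and \<rho>: "density (s_in W) \<rho>"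
  shows "coh_info W \<rho> \<le> log 2 c"
proof -
  let ?B = "{..<s_outB W}" and ?E = "{..<s_outE W}" and ?R = "{..<s_in W}"
  obtain G where G: "\<And>x y. x < s_in W \<Longrightarrow> y < s_in W \<Longrightarrow> \<rho> $$ (x, y) = (\<Sum>r<s_in W. G x r * cnj (G y r))"
    using density_gram[OF \<rho>] by metis
  obtain f t :: "nat \<Rightarrow> nat \<Rightarrow> complex" and \<epsilon> \<kappa> J p where
    f: "orthonormal ?E ?E f" and \<epsilon>: "\<And>k. k < s_outE W \<Longrightarrow> \<epsilon> k \<ge> 0" "(\<Sum>k\<in>?E. \<epsilon> k) = 1"
    and J: "finite J" "J \<subseteq> ?B" and Jne: "J \<noteq> {}" and t: "orthonormal J ?B t" and \<kappa>: "\<And>j. j \<in> J \<Longrightarrow> \<kappa> j > 0"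
    and p: "\<And>k j r. p k j r = ip ?B (t j) (\<lambda>b. ip ?E (f k) (\<lambda>e. outvec W G b e r))"
    and pp: "\<And>i j. i \<in> J \<Longrightarrow> j \<in> J \<Longrightarrow>
       (\<Sum>k\<in>?E. \<Sum>r\<in>?R. of_real (\<epsilon> k) * (p k i r * cnj (p k j r))) = (if i = j then of_real ((\<kappa> j)\<^sup>2) else 0)"
    and coh: "coh_info W \<rho> \<le> log 2 ((\<Sum>j\<in>J. \<kappa> j)\<^sup>2)"
    by (rule coh_info_le_kraus[OF W \<rho>], rule G, assumption, assumption) (rule that)
  \<comment> \<open>\<open>h\<close> contains the factor \<open>K^(-1)\<close> as division by
    \<open>\<kappa> j\<close>; \<open>U k\<close> is the same operator in the standard basis of the
    output.\<close>
  define h where "h = (\<lambda>k j r. complex_of_real (sqrt (\<epsilon> k) / \<kappa> j) * cnj (p k j r))"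
  define U where "U = (\<lambda>k r b. \<Sum>j\<in>J. h k j r * cnj (t j b))"
  define z where "z = (\<lambda>k e. \<Sum>b\<in>?B. \<Sum>r\<in>?R. outvec W G b e r * U k r b)"
  \<comment> \<open>The overlap of \<open>z k\<close> with \<open>f k\<close>, which turns out to be
    real and nonnegative.\<close>
  define c' where "c' = (\<lambda>k. sqrt (\<epsilon> k) * (\<Sum>j\<in>J. (\<Sum>r\<in>?R. (cmod (p k j r))\<^sup>2) / \<kappa> j))"
  have contr: "(\<Sum>k\<in>?E. \<Sum>r\<in>?R. (cmod (\<Sum>b\<in>?B. \<eta> b * U k r b))\<^sup>2) \<le> (\<Sum>b\<in>?B. (cmod (\<eta> b))\<^sup>2)" for \<eta>
  proof -
    define g where "g = (\<lambda>j. ip ?B (t j) \<eta>)"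
    \<comment> \<open>\<open>K^(-1) K^2 K^(-1)\<close> is the identity on the support of
      \<open>K\<close>, so the recovery is isometric there; Bessel's inequality covers the
      complement.\<close>
    have hh: "(\<Sum>k\<in>?E. \<Sum>r\<in>?R. h k i r * cnj (h k j r)) = (if i = j then 1 else 0)" if ij: "i \<in> J" "j \<in> J" for i j
    proof -
      have "(\<Sum>k\<in>?E. \<Sum>r\<in>?R. h k i r * cnj (h k j r))
        = (\<Sum>k\<in>?E. \<Sum>r\<in>?R. of_real (1 / (\<kappa> i * \<kappa> j)) * (of_real (\<epsilon> k) * (p k j r * cnj (p k i r))))"
      proof (intro sum.cong refl)
        fix k r assume k: "k \<in> ?E"
        have "complex_of_real (sqrt (\<epsilon> k) / \<kappa> i) * of_real (sqrt (\<epsilon> k) / \<kappa> j) = of_real (1 / (\<kappa> i * \<kappa> j)) * of_real (\<epsilon> k)"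
          unfolding of_real_mult[symmetric] using \<epsilon>(1)[of k] k by simp
        then show "h k i r * cnj (h k j r) = of_real (1 / (\<kappa> i * \<kappa> j)) * (of_real (\<epsilon> k) * (p k j r * cnj (p k i r)))"
          unfolding h_def by (simp only: complex_cnj_mult complex_cnj_cnj complex_cnj_complex_of_real ac_simps)
      qed
      also have "\<dots> = of_real (1 / (\<kappa> i * \<kappa> j)) * (if j = i then of_real ((\<kappa> i)\<^sup>2) else 0)"
        unfolding pp[OF ij(2,1), symmetric] by (simp only: sum_distrib_left)
      also have "\<dots> = (if i = j then 1 else 0)"
        using \<kappa>[OF ij(1)] by (auto simp: power2_eq_square)
      finally show ?thesis .
    qed
    have etaU: "(\<Sum>b\<in>?B. \<eta> b * U k r b) = (\<Sum>j\<in>J. g j * h k j r)" for k r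
      unfolding U_def g_def ip_def sum_distrib_left sum_distrib_right
      by (subst sum.swap) (simp only: ac_simps)
    have "complex_of_real (\<Sum>k\<in>?E. \<Sum>r\<in>?R. (cmod (\<Sum>b\<in>?B. \<eta> b * U k r b))\<^sup>2)
      = (\<Sum>k\<in>?E. \<Sum>r\<in>?R. \<Sum>i\<in>J. \<Sum>j\<in>J. (g i * cnj (g j)) * (h k i r * cnj (h k j r)))"
      unfolding of_real_sum complex_mult_cnj_cmod[symmetric] etaU cnj_sum sum_product
      by (simp only: complex_cnj_mult ac_simps)
    also have "\<dots> = (\<Sum>i\<in>J. \<Sum>j\<in>J. (g i * cnj (g j)) * (\<Sum>k\<in>?E. \<Sum>r\<in>?R. h k i r * cnj (h k j r)))"
      unfolding sum_distrib_left by (rule sum_swap4)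
    also have "\<dots> = (\<Sum>i\<in>J. \<Sum>j\<in>J. if i = j then g i * cnj (g j) else 0)"
      using hh by (intro sum.cong refl) auto
    also have "\<dots> = of_real (\<Sum>j\<in>J. (cmod (g j))\<^sup>2)"
      using J(1) by (simp add: sum.delta' complex_mult_cnj_cmod del: of_real_power)
    finally have "(\<Sum>k\<in>?E. \<Sum>r\<in>?R. (cmod (\<Sum>b\<in>?B. \<eta> b * U k r b))\<^sup>2) = (\<Sum>j\<in>J. (cmod (g j))\<^sup>2)"
      using of_real_eq_iff by blast
    then show ?thesis using bessel[OF J(1) t, of \<eta>] by (simp add: g_def)
  qed
  have trG: "(\<Sum>a\<in>?R. \<Sum>r\<in>?R. (cmod (G a r))\<^sup>2) = 1"
  proof -
    have "complex_of_real (\<Sum>a\<in>?R. \<Sum>r\<in>?R. (cmod (G a r))\<^sup>2) = (\<Sum>a\<in>?R. \<rho> $$ (a, a))"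
      unfolding of_real_sum complex_mult_cnj_cmod[symmetric] using G by (intro sum.cong refl) simp
    also have "\<dots> = 1" by (rule density_trace[OF \<rho>])
    finally show ?thesis by (simp only: of_real_eq_1_iff)
  qed
  have zc: "(\<Sum>k\<in>?E. \<Sum>e\<in>?E. (cmod (z k e))\<^sup>2) \<le> c"
    unfolding z_def by (rule recovery_le_pt_bounded[OF cert trG contr])
  have c'z: "of_real (c' k) = ip ?E (f k) (z k)" if k: "k < s_outE W" for k
  proof -
    have "ip ?E (f k) (z k) = (\<Sum>b\<in>?B. \<Sum>r\<in>?R. U k r b * ip ?E (f k) (\<lambda>e. outvec W G b e r))"
      unfolding z_def ip_sum_right by (simp only: mult.commute[of "outvec _ _ _ _ _"] ip_scale_right)
    also have "\<dots> = (\<Sum>b\<in>?B. \<Sum>r\<in>?R. \<Sum>j\<in>J. h k j r * (cnj (t j b) * ip ?E (f k) (\<lambda>e. outvec W G b e r)))"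
      unfolding U_def by (simp only: sum_distrib_right mult.assoc)
    also have "\<dots> = (\<Sum>r\<in>?R. \<Sum>j\<in>J. \<Sum>b\<in>?B. h k j r * (cnj (t j b) * ip ?E (f k) (\<lambda>e. outvec W G b e r)))"
      by (rule sum_swap3)
    also have "\<dots> = (\<Sum>r\<in>?R. \<Sum>j\<in>J. h k j r * p k j r)"
      unfolding p ip_def[of ?B] sum_distrib_left ..
    also have "\<dots> = (\<Sum>r\<in>?R. \<Sum>j\<in>J. of_real (sqrt (\<epsilon> k) * ((cmod (p k j r))\<^sup>2 / \<kappa> j)))"
      unfolding h_def mult.assoc cnj_mult_cmod of_real_mult[symmetric] by (intro sum.cong refl) simp
    also have "\<dots> = of_real (\<Sum>j\<in>J. \<Sum>r\<in>?R. sqrt (\<epsilon> k) * ((cmod (p k j r))\<^sup>2 / \<kappa> j))"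
      by (subst sum.swap) (simp only: of_real_sum)
    also have "\<dots> = of_real (c' k)"
      unfolding c'_def by (simp only: sum_distrib_left sum_divide_distrib)
    finally show ?thesis by simp
  qed
  have c'2: "(\<Sum>k\<in>?E. (c' k)\<^sup>2) \<le> c"
  proof -
    have "(c' k)\<^sup>2 \<le> (\<Sum>e\<in>?E. (cmod (z k e))\<^sup>2)" if k: "k \<in> ?E" for k
    proof -
      have "(c' k)\<^sup>2 = (cmod (ip ?E (f k) (z k)))\<^sup>2" using c'z[of k] k by (simp flip: c'z)
      also have "\<dots> \<le> (\<Sum>k'\<in>?E. (cmod (ip ?E (f k') (z k)))\<^sup>2)"
        using k by (intro member_le_sum) auto
      also have "\<dots> = (\<Sum>e\<in>?E. (cmod (z k e))\<^sup>2)" by (rule parseval[OF f])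
      finally show ?thesis .
    qed
    then have "(\<Sum>k\<in>?E. (c' k)\<^sup>2) \<le> (\<Sum>k\<in>?E. \<Sum>e\<in>?E. (cmod (z k e))\<^sup>2)" by (intro sum_mono)
    then show ?thesis using zc by linarith
  qed
  have K: "(\<Sum>j\<in>J. \<kappa> j) = (\<Sum>k\<in>?E. sqrt (\<epsilon> k) * c' k)"
  proof -
    have "\<kappa> j = (\<Sum>k\<in>?E. \<epsilon> k * (\<Sum>r\<in>?R. (cmod (p k j r))\<^sup>2)) / \<kappa> j" if j: "j \<in> J" for j
    proof -
      have "complex_of_real (\<Sum>k\<in>?E. \<epsilon> k * (\<Sum>r\<in>?R. (cmod (p k j r))\<^sup>2))
        = (\<Sum>k\<in>?E. \<Sum>r\<in>?R. of_real (\<epsilon> k) * (p k j r * cnj (p k j r)))"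
        by (simp only: sum_distrib_left of_real_sum of_real_mult complex_mult_cnj_cmod)
      also have "\<dots> = of_real ((\<kappa> j)\<^sup>2)" using pp[OF j j] by simp
      finally have "(\<Sum>k\<in>?E. \<epsilon> k * (\<Sum>r\<in>?R. (cmod (p k j r))\<^sup>2)) = (\<kappa> j)\<^sup>2" using of_real_eq_iff by blast
      then show ?thesis using \<kappa>[OF j] by (simp add: power2_eq_square)
    qed
    then have "(\<Sum>j\<in>J. \<kappa> j) = (\<Sum>j\<in>J. \<Sum>k\<in>?E. \<epsilon> k * ((\<Sum>r\<in>?R. (cmod (p k j r))\<^sup>2) / \<kappa> j))"
      unfolding times_divide_eq_right sum_divide_distrib[where A = ?E, symmetric]
      by (rule sum.cong[OF refl])
    also have "\<dots> = (\<Sum>k\<in>?E. \<epsilon> k * (\<Sum>j\<in>J. (\<Sum>r\<in>?R. (cmod (p k j r))\<^sup>2) / \<kappa> j))"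
      unfolding sum_distrib_left by (rule sum.swap)
    also have "\<dots> = (\<Sum>k\<in>?E. sqrt (\<epsilon> k) * c' k)"
    proof (intro sum.cong refl)
      fix k assume "k \<in> ?E"
      then have sq: "sqrt (\<epsilon> k) * sqrt (\<epsilon> k) = \<epsilon> k" using \<epsilon>(1)[of k] by simp
      show "\<epsilon> k * (\<Sum>j\<in>J. (\<Sum>r\<in>?R. (cmod (p k j r))\<^sup>2) / \<kappa> j) = sqrt (\<epsilon> k) * c' k"
        unfolding c'_def by (simp only: mult.assoc[symmetric] sq)
    qed
    finally show ?thesis .
  qed
  define K where "K = (\<Sum>j\<in>J. \<kappa> j)"
  \<comment> \<open>Cauchy-Schwarz for the unit vector \<open>sqrt (\<epsilon> k)\<close> and
    \<open>c' k\<close>, written as a nonnegative sum of squares.\<close>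
  have "0 \<le> (\<Sum>k\<in>?E. (c' k - K * sqrt (\<epsilon> k))\<^sup>2)" by (intro sum_nonneg) auto
  also have "\<dots> = (\<Sum>k\<in>?E. (c' k)\<^sup>2 - 2 * K * (sqrt (\<epsilon> k) * c' k) + K\<^sup>2 * \<epsilon> k)"
    using \<epsilon>(1) by (intro sum.cong refl) (simp add: power2_diff power_mult_distrib)
  also have "\<dots> = (\<Sum>k\<in>?E. (c' k)\<^sup>2) - 2 * K * K + K\<^sup>2"
    unfolding sum.distrib sum_subtractf sum_distrib_left[symmetric] K[symmetric] \<epsilon>(2) K_def by simp
  finally have Kc: "(\<Sum>j\<in>J. \<kappa> j)\<^sup>2 \<le> c" using c'2 unfolding K_def by (simp add: power2_eq_square)
  have "(\<Sum>j\<in>J. \<kappa> j) > 0" using J(1) Jne \<kappa> by (intro sum_pos) auto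
  then have "(\<Sum>j\<in>J. \<kappa> j)\<^sup>2 > 0" by simp
  then have "log 2 ((\<Sum>j\<in>J. \<kappa> j)\<^sup>2) \<le> log 2 c" using Kc by (subst log_le_cancel_iff) linarith+
  with coh show ?thesis by linarith
qed

section \<open>Capacity bounds\<close>

lemma pt_family_tensor:
  assumes 1: "pt_family W1 N1 x1 y1 D1" and 2: "pt_family W2 N2 x2 y2 D2"
  shows "pt_family (tensor_iso W1 W2) (N1 * N2)
    (\<lambda>s a b. x1 (s div N2) (a div s_in W2) (b div s_outB W2) * x2 (s mod N2) (a mod s_in W2) (b mod s_outB W2))
    (\<lambda>s a b. y1 (s div N2) (a div s_in W2) (b div s_outB W2) * y2 (s mod N2) (a mod s_in W2) (b mod s_outB W2))
    (\<lambda>a. D1 (a div s_in W2) * D2 (a mod s_in W2))" (is "pt_family ?W _ ?x ?y ?D")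
  unfolding pt_family_def tensor_iso_simps
proof (intro conjI allI impI)
  fix a a' b b' assume *: "a < s_in W1 * s_in W2" "a' < s_in W1 * s_in W2"
    "b < s_outB W1 * s_outB W2" "b' < s_outB W1 * s_outB W2"
  let ?F = "\<lambda>W a a' b b' e. iso_at W b' e a * cnj (iso_at W b e a')"
  have "(\<Sum>e<s_outE W1 * s_outE W2. iso_at ?W b' e a * cnj (iso_at ?W b e a')) =
    (\<Sum>e<s_outE W1 * s_outE W2.
      ?F W1 (a div s_in W2) (a' div s_in W2) (b div s_outB W2) (b' div s_outB W2) (e div s_outE W2) *
      ?F W2 (a mod s_in W2) (a' mod s_in W2) (b mod s_outB W2) (b' mod s_outB W2) (e mod s_outE W2))"
    using * by (intro sum.cong refl) (simp add: iso_at_tensor)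
  also have "\<dots> = (\<Sum>e<s_outE W1. ?F W1 (a div s_in W2) (a' div s_in W2) (b div s_outB W2) (b' div s_outB W2) e) *
    (\<Sum>e<s_outE W2. ?F W2 (a mod s_in W2) (a' mod s_in W2) (b mod s_outB W2) (b' mod s_outB W2) e)"
    by (rule sum_divmod_prod)
  also have "\<dots> = (\<Sum>s<N1. x1 s (a div s_in W2) (b div s_outB W2) * cnj (y1 s (a' div s_in W2) (b' div s_outB W2))) *
    (\<Sum>s<N2. x2 s (a mod s_in W2) (b mod s_outB W2) * cnj (y2 s (a' mod s_in W2) (b' mod s_outB W2)))"
    using 1 2 * by (simp add: pt_family_def div_less_mult mod_less_mult)
  also have "\<dots> = (\<Sum>s<N1 * N2. ?x s a b * cnj (?y s a' b'))"
    by (subst sum_divmod_prod[symmetric]) (intro sum.cong refl, simp)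
  finally show "(\<Sum>e<s_outE W1 * s_outE W2. iso_at ?W b' e a * cnj (iso_at ?W b e a')) = (\<Sum>s<N1 * N2. ?x s a b * cnj (?y s a' b'))" .
next
  have *: "(\<Sum>s<N1 * N2. \<Sum>b<s_outB W1 * s_outB W2.
      (z1 (s div N2) (a div s_in W2) (b div s_outB W2) * z2 (s mod N2) (a mod s_in W2) (b mod s_outB W2)) *
      cnj (z1 (s div N2) (a' div s_in W2) (b div s_outB W2) * z2 (s mod N2) (a' mod s_in W2) (b mod s_outB W2)))
      = (if a = a' then complex_of_real (?D a) else 0)"
    if z: "z1 \<in> {x1, y1}" "z2 \<in> {x2, y2}" and a: "a < s_in W1 * s_in W2" "a' < s_in W1 * s_in W2" for z1 z2 a a'
  proof -
    let ?F = "\<lambda>z a a' s b. z s a b * cnj (z s a' b) :: complex"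
    have "(\<Sum>s<N1 * N2. \<Sum>b<s_outB W1 * s_outB W2.
      (z1 (s div N2) (a div s_in W2) (b div s_outB W2) * z2 (s mod N2) (a mod s_in W2) (b mod s_outB W2)) *
      cnj (z1 (s div N2) (a' div s_in W2) (b div s_outB W2) * z2 (s mod N2) (a' mod s_in W2) (b mod s_outB W2)))
      = (\<Sum>s<N1 * N2. \<Sum>b<s_outB W1 * s_outB W2.
       ?F z1 (a div s_in W2) (a' div s_in W2) (s div N2) (b div s_outB W2) * ?F z2 (a mod s_in W2) (a' mod s_in W2) (s mod N2) (b mod s_outB W2))"
      by (intro sum.cong refl) simp
    also have "\<dots> = (\<Sum>s<N1. \<Sum>b<s_outB W1. ?F z1 (a div s_in W2) (a' div s_in W2) s b) *
      (\<Sum>s<N2. \<Sum>b<s_outB W2. ?F z2 (a mod s_in W2) (a' mod s_in W2) s b)"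
      by (rule sum2_divmod_prod)
    also have "(\<Sum>s<N1. \<Sum>b<s_outB W1. ?F z1 (a div s_in W2) (a' div s_in W2) s b) =
        (if a div s_in W2 = a' div s_in W2 then of_real (D1 (a div s_in W2)) else 0)"
      using 1 z(1) div_less_mult[OF a(1)] div_less_mult[OF a(2)] unfolding pt_family_def by blast
    also have "(\<Sum>s<N2. \<Sum>b<s_outB W2. ?F z2 (a mod s_in W2) (a' mod s_in W2) s b) =
        (if a mod s_in W2 = a' mod s_in W2 then of_real (D2 (a mod s_in W2)) else 0)"
      using 2 z(2) mod_less_mult[OF a(1)] mod_less_mult[OF a(2)] unfolding pt_family_def by blast
    finally show ?thesis using divmod_eq_iff[of a "s_in W2" a'] by auto
  qed
  show "\<forall>z\<in>{?x, ?y}. \<forall>a<s_in W1 * s_in W2. \<forall>a'<s_in W1 * s_in W2.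
    (\<Sum>s<N1 * N2. \<Sum>b<s_outB W1 * s_outB W2. z s a b * cnj (z s a' b)) = (if a = a' then of_real (?D a) else 0)"
    using *[of x1 x2] *[of y1 y2] by blast
qed

text \<open>The nonnegativity of the entries of \<open>D\<close> allows the two upper bounds to be
  multiplied.\<close>

lemma pt_bounded_tensor:
  assumes "pt_bounded W1 c1" "pt_bounded W2 c2"
  shows "pt_bounded (tensor_iso W1 W2) (c1 * c2)"
proof -
  obtain N1 x1 y1 D1 where 1: "pt_family W1 N1 x1 y1 D1" "\<forall>a<s_in W1. 0 \<le> D1 a \<and> D1 a \<le> c1"
    using assms(1) unfolding pt_bounded_def by blast
  obtain N2 x2 y2 D2 where 2: "pt_family W2 N2 x2 y2 D2" "\<forall>a<s_in W2. 0 \<le> D2 a \<and> D2 a \<le> c2"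
    using assms(2) unfolding pt_bounded_def by blast
  have "0 \<le> D1 (a div s_in W2) * D2 (a mod s_in W2) \<and> D1 (a div s_in W2) * D2 (a mod s_in W2) \<le> c1 * c2"
    if "a < s_in W1 * s_in W2" for a
    using 1(2) 2(2) div_less_mult[OF that] mod_less_mult[OF that]
    by (meson mult_mono mult_nonneg_nonneg order_trans)
  then show ?thesis unfolding pt_bounded_def tensor_iso_simps using pt_family_tensor[OF 1(1) 2(1)] by blast
qed

lemma pt_bounded_unit: "pt_bounded unit_iso 1"
  unfolding pt_bounded_def
proof (intro exI conjI)
  show "pt_family unit_iso 1 (\<lambda>_ _ _. 1) (\<lambda>_ _ _. 1) (\<lambda>_. 1)"
    by (simp add: pt_family_def)
qed auto

lemma pt_bounded_tensor_pow: "pt_bounded W c \<Longrightarrow> pt_bounded (tensor_pow W n) (c ^ n)"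
proof (induction n)
  case 0
  then show ?case using pt_bounded_unit by simp
next
  case (Suc n)
  then show ?case using pt_bounded_tensor[of "tensor_pow W n" "c ^ n" W c] by (simp add: mult.commute)
qed

lemma Qcap_le_pt_bounded:
  assumes W: "valid W" and c: "pt_bounded W c" "c > 0"
  shows "Qcap W \<le> log 2 c"
proof (rule Qcap_bounds(1)[OF W])
  fix n :: nat
  have "log 2 (c ^ n) = log 2 c * n" using c(2) by (simp add: log_nat_power)
  then show "Q1 (tensor_pow W n) \<le> log 2 c * n"
    using coh_info_le_pt_bounded[OF valid_tensor_pow[OF W] pt_bounded_tensor_pow[OF c(1)], of n]
    by (intro Q1_le valid_tensor_pow W) simp
qed

section \<open>Channels symmetric in output and environment\<close>

definition balanced :: "stinespring \<Rightarrow> bool" where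
  "balanced W \<longleftrightarrow> s_outB W = s_outE W \<and>
     (\<forall>b<s_outB W. \<forall>e<s_outB W. \<forall>a<s_in W. iso_at W b e a = iso_at W e b a)"

lemma balanced_tensor: "balanced W1 \<Longrightarrow> balanced W2 \<Longrightarrow> balanced (tensor_iso W1 W2)"
  by (auto simp: balanced_def iso_at_tensor div_less_mult mod_less_mult)

lemma balanced_tensor_pow: "balanced W \<Longrightarrow> balanced (tensor_pow W n)"
proof (induction n)
  case 0
  then show ?case by (simp add: balanced_def)
next
  case (Suc n)
  then show ?case by (simp add: balanced_tensor)
qed

lemma coh_info_balanced:
  assumes W: "valid W" and b: "balanced W" and \<rho>: "density (s_in W) \<rho>"
  shows "coh_info W \<rho> = 0"
proof -
  have "chan W \<rho> = chan_c W \<rho>"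
  proof (rule eq_matI)
    fix i j assume "i < dim_row (chan_c W \<rho>)" "j < dim_col (chan_c W \<rho>)"
    then have ij: "i < s_outE W" "j < s_outE W" by (auto simp: chan_c_def ptrace_B_def)
    have "chan W \<rho> $$ (i, j) = (\<Sum>e<s_outE W. kernel W \<rho> i e j e)"
      using ij b by (subst chan_index[OF W density_carrier[OF \<rho>]]) (auto simp: balanced_def)
    also have "\<dots> = (\<Sum>e<s_outE W. kernel W \<rho> e i e j)"
      unfolding kernel_def using ij b by (intro sum.cong refl) (auto simp: balanced_def)
    also have "\<dots> = chan_c W \<rho> $$ (i, j)"
      using ij b by (subst chan_c_index[OF W density_carrier[OF \<rho>]]) (auto simp: balanced_def)
    finally show "chan W \<rho> $$ (i, j) = chan_c W \<rho> $$ (i, j)" .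
  qed (use b in \<open>auto simp: balanced_def chan_def chan_c_def ptrace_E_def ptrace_B_def\<close>)
  then show ?thesis by (simp add: coh_info_def)
qed

lemma Qcap_balanced:
  assumes W: "valid W" and b: "balanced W"
  shows "Qcap W \<le> 0"
proof (rule Qcap_bounds(1)[OF W])
  fix n :: nat
  show "Q1 (tensor_pow W n) \<le> (0::real) * real n"
    using coh_info_balanced[OF valid_tensor_pow[OF W] balanced_tensor_pow[OF b], of n]
    by (intro Q1_le valid_tensor_pow W) simp
qed

section \<open>The platypus and erasure isometries\<close>

lemma erasure_simps [simp]:
  "s_in (erasure d l) = d" "s_outB (erasure d l) = Suc d" "s_outE (erasure d l) = Suc d"
  by (auto simp: erasure_def)

lemma divmod_small:
  fixes b e n :: nat
  assumes "e < n"
  shows "(b * n + e) div n = b" "(b * n + e) mod n = e"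
  using assms by auto

lemma iso_at_erasure:
  assumes "b < Suc d" "e < Suc d" "a < d"
  shows "iso_at (erasure d l) b e a =
    (if b = a \<and> e = d then complex_of_real (sqrt (1 - l)) else 0) +
    (if b = d \<and> e = a then complex_of_real (sqrt l) else 0)"
proof -
  have e: "e < Suc d" using assms by simp
  have r: "b * Suc d + e < Suc d * Suc d" using assms by (intro pair_less) auto
  show ?thesis
    using r e assms(3) by (simp add: iso_at_def erasure_def Let_def divmod_small[OF e] del: mult_Suc mult_Suc_right)
qed

lemma platypus_simps [simp]:
  "s_in (platypus d \<mu>) = Suc d" "s_outB (platypus d \<mu>) = Suc d" "s_outE (platypus d \<mu>) = d"
  by (auto simp: platypus_def)

lemma iso_at_platypus:
  assumes "b < Suc d" "e < d" "a < Suc d"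
  shows "iso_at (platypus d \<mu>) b e a =
    (if a = 0 then (if b = e then complex_of_real (sqrt (\<mu> e)) else 0)
     else (if b = d \<and> e = a - 1 then 1 else 0))"
  using assms pair_less[OF assms(1,2)]
  by (auto simp: iso_at_def platypus_def Let_def divmod_small[OF assms(2)])

lemma sum_lessThan_add: "(\<Sum>i<m + n. f i) = (\<Sum>i<m. f i) + (\<Sum>i<n. f (m + i :: nat))"
  by (induction n) (simp_all add: ac_simps)

lemma valid_platypus:
  assumes d: "d \<ge> 1" and mu: "\<forall>i<d. \<mu> i \<ge> 0" "(\<Sum>i<d. \<mu> i) = 1"
  shows "valid (platypus d \<mu>)"
  unfolding valid_def platypus_simps
proof (intro conjI allI impI)
  show "s_iso (platypus d \<mu>) \<in> carrier_mat ((Suc d) * d) (Suc d)"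
    by (simp add: platypus_def)
  fix a a' assume a: "a < Suc d" "a' < Suc d"
  \<comment> \<open>For given \<open>a\<close> and \<open>e\<close> at most one output contributes:
    \<open>b = e\<close> if \<open>a = 0\<close>, and \<open>b = d\<close> otherwise. As
    \<open>e < d\<close>, the two cases never meet.\<close>
  have "(\<Sum>b<Suc d. \<Sum>e<d. cnj (iso_at (platypus d \<mu>) b e a) * iso_at (platypus d \<mu>) b e a')
    = (\<Sum>e<d. \<Sum>b<Suc d. if b = (if a = 0 then e else d) then
        (if a = 0 \<and> a' = 0 then of_real (\<mu> e) else if a \<noteq> 0 \<and> a = a' \<and> e = a - 1 then 1 else 0) else 0)"
    (is "_ = (\<Sum>e<d. \<Sum>b<Suc d. ?f e b)")
  proof (subst sum.swap, intro sum.cong refl)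
    fix e b assume eb: "e \<in> {..<d}" "b \<in> {..<Suc d}"
    have "complex_of_real (sqrt (\<mu> e)) * of_real (sqrt (\<mu> e)) = of_real (\<mu> e)"
      using mu(1) eb by (simp flip: of_real_mult)
    then show "cnj (iso_at (platypus d \<mu>) b e a) * iso_at (platypus d \<mu>) b e a' = ?f e b"
      using a eb by (auto simp: iso_at_platypus)
  qed
  also have "\<dots> = (\<Sum>e<d. if a = 0 \<and> a' = 0 then of_real (\<mu> e) else if a \<noteq> 0 \<and> a = a' \<and> e = a - 1 then 1 else 0)"
    by (intro sum.cong refl) (simp add: sum.delta)
  also have "\<dots> = (if a = a' then 1 else 0)"
  proof (cases "a = 0 \<and> a' = 0")
    case True
    then show ?thesis using mu(2) by (simp flip: of_real_sum)
  next
    case False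
    then have "(\<Sum>e<d. if a = 0 \<and> a' = 0 then of_real (\<mu> e) else if a \<noteq> 0 \<and> a = a' \<and> e = a - 1 then 1 else 0)
      = (\<Sum>e<d. if e = a - 1 then (if a = a' then 1 else 0) else (0::complex))"
      by (intro sum.cong refl) auto
    then show ?thesis using False a by (auto simp: sum.delta)
  qed
  finally show "(\<Sum>b<Suc d. \<Sum>e<d. cnj (iso_at (platypus d \<mu>) b e a) * iso_at (platypus d \<mu>) b e a') = (if a = a' then 1 else 0)" .
qed (use d in auto)

lemma valid_erasure:
  assumes "d \<ge> 1" "0 \<le> l" "l \<le> 1"
  shows "valid (erasure d l)"
  unfolding valid_def erasure_simps
proof (intro conjI allI impI)
  show "s_iso (erasure d l) \<in> carrier_mat ((Suc d) * (Suc d)) d"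
    by (simp add: erasure_def)
  fix a a' assume a: "a < d" "a' < d"
  have s: "complex_of_real (sqrt (1 - l)) * of_real (sqrt (1 - l)) = of_real (1 - l)"
     "complex_of_real (sqrt l) * of_real (sqrt l) = of_real l"
    using assms unfolding of_real_mult[symmetric] by simp_all
  \<comment> \<open>The cross terms vanish, because the two branches have \<open>e = d\<close> and
    \<open>e < d\<close> respectively.\<close>
  have "(\<Sum>b<Suc d. \<Sum>e<Suc d. cnj (iso_at (erasure d l) b e a) * iso_at (erasure d l) b e a')
    = (\<Sum>b<Suc d. \<Sum>e<Suc d. (if e = d then (if b = a then (if a = a' then of_real (1 - l) else 0) else 0) else 0) +
       (if e = a then (if b = d then (if a = a' then of_real l else 0) else 0) else 0))"
    using a by (intro sum.cong refl) (auto simp: iso_at_erasure s)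
  also have "\<dots> = (if a = a' then of_real (1 - l) else 0) + (if a = a' then of_real l else 0)"
    unfolding sum.distrib using a by (simp only: sum.delta finite_lessThan lessThan_iff) auto
  finally show "(\<Sum>b<Suc d. \<Sum>e<Suc d. cnj (iso_at (erasure d l) b e a) * iso_at (erasure d l) b e a') = (if a = a' then 1 else 0)"
    by simp
qed (use assms in auto)

lemma balanced_erasure: "balanced (erasure d (1 / 2))"
  by (auto simp: balanced_def iso_at_erasure)

text \<open>The partial transpose couples \<open>|0>|d>\<close> to \<open>\<Sum>b. sqrt \<mu>_b |b+1>|b>\<close>; the weight \<open>m\<close> balances the two
  vectors \<open>\<alpha>\<close> and \<open>\<chi>\<close> so that the entries of \<open>D\<close> are at most \<open>1 + m\<close>.\<close>

lemma pt_bounded_platypus: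
  assumes mu: "\<forall>i<d. \<mu> i \<ge> 0" "(\<Sum>i<d. \<mu> i) = 1" and m: "m > 0" "\<forall>i<d. \<mu> i \<le> m\<^sup>2"
  shows "pt_bounded (platypus d \<mu>) (1 + m)"
proof -
  define \<alpha> where "\<alpha> = (\<lambda>(a::nat) (b::nat). if a = 0 \<and> b = d then complex_of_real (sqrt m) else 0)"
  define \<chi> where "\<chi> = (\<lambda>a b. if b < d \<and> a = b + 1 then complex_of_real (sqrt (\<mu> b) / sqrt m) else 0)"
  define \<beta> where "\<beta> = (\<lambda>s a (b::nat). if s < d then (if a = 0 \<and> b = s then complex_of_real (sqrt (\<mu> s)) else 0)
    else (if a = Suc (s - d) \<and> b = d then 1 else 0))"
  \<comment> \<open>On \<beta> the partial transpose is already diagonal, so both sides agree there.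
    The last two positions exchange \<alpha> and \<chi>, which produces
    \<open>|\<alpha>><\<chi>| + |\<chi>><\<alpha>|\<close>; because of the exchange \<open>x\<close>
    and \<open>y\<close> have the same marginal.\<close>
  define x where "x = (\<lambda>s. if s < d + d then \<beta> s else if s = d + d then \<alpha> else \<chi>)"
  define y where "y = (\<lambda>s. if s < d + d then \<beta> s else if s = d + d then \<chi> else \<alpha>)"
  \<comment> \<open>The summand 1 comes from \<beta>; \<alpha> adds \<open>m\<close> at
    \<open>a = 0\<close>, and \<chi> adds \<open>\<mu> (a - 1) / m \<le> m\<close> elsewhere. The
    choice \<open>m = sqrt \<mu>_max\<close> makes the two maxima meet.\<close>
  define D where "D = (\<lambda>a. if a = 0 then 1 + m else 1 + \<mu> (a - 1) / m)"
  have split: "(\<Sum>s<d + d + 2. f s) = (\<Sum>s<d. f s) + (\<Sum>s<d. f (d + s)) + f (d + d) + f (Suc (d + d))"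
    for f :: "nat \<Rightarrow> complex"
    using sum_lessThan_add[of f d d] by (simp add: numeral_2_eq_2 ac_simps)
  have sq: "complex_of_real (sqrt (\<mu> b)) * of_real (sqrt (\<mu> b)) = of_real (\<mu> b)" if "b < d" for b
    using mu(1) that unfolding of_real_mult[symmetric] by simp
  have sm: "complex_of_real (sqrt m) * of_real (sqrt m) = of_real m" "complex_of_real (sqrt m) \<noteq> 0"
    using m unfolding of_real_mult[symmetric] by simp_all
  have \<beta>1: "(\<Sum>s<d. \<beta> s a b * cnj (\<beta> s a' b')) = (if a = 0 \<and> a' = 0 \<and> b = b' \<and> b < d then of_real (\<mu> b) else 0)" for a a' b b'
  proof -
    have "(\<Sum>s<d. \<beta> s a b * cnj (\<beta> s a' b')) = (\<Sum>s<d. if s = b then (if a = 0 \<and> a' = 0 \<and> b = b' then of_real (\<mu> b) else 0) else 0)"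
      by (intro sum.cong refl) (auto simp: \<beta>_def sq)
    then show ?thesis by (auto simp: sum.delta)
  qed
  have \<beta>2: "(\<Sum>s<d. \<beta> (d + s) a b * cnj (\<beta> (d + s) a' b')) = (if a = a' \<and> a \<noteq> 0 \<and> b = d \<and> b' = d then 1 else 0)"
    if "a < Suc d" for a a' b b'
  proof -
    have "(\<Sum>s<d. \<beta> (d + s) a b * cnj (\<beta> (d + s) a' b')) = (\<Sum>s<d. if s = a - 1 then (if a = a' \<and> a \<noteq> 0 \<and> b = d \<and> b' = d then 1 else 0) else 0)"
      by (intro sum.cong refl) (auto simp: \<beta>_def)
    then show ?thesis using that by (auto simp: sum.delta)
  qed
  have fam: "pt_family (platypus d \<mu>) (d + d + 2) x y D"
    unfolding pt_family_def platypus_simps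
  proof (intro conjI allI impI ballI)
    fix a a' b b' assume *: "a < Suc d" "a' < Suc d" "b < Suc d" "b' < Suc d"
    have L: "(\<Sum>e<d. iso_at (platypus d \<mu>) b' e a * cnj (iso_at (platypus d \<mu>) b e a')) =
      (if a = 0 then (if a' = 0 then (if b = b' \<and> b < d then of_real (\<mu> b) else 0)
          else (if b = d \<and> b' = a' - 1 then of_real (sqrt (\<mu> b')) else 0))
       else (if a' = 0 then (if b' = d \<and> b = a - 1 then of_real (sqrt (\<mu> b)) else 0)
          else (if a = a' \<and> b = d \<and> b' = d then 1 else 0)))" (is "_ = ?r")
    proof -
      have "(\<Sum>e<d. iso_at (platypus d \<mu>) b' e a * cnj (iso_at (platypus d \<mu>) b e a')) =
        (\<Sum>e<d. if e = (if a = 0 then b' else a - 1) then ?r else 0)"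
      proof (intro sum.cong refl)
        fix e assume "e \<in> {..<d}"
        then show "iso_at (platypus d \<mu>) b' e a * cnj (iso_at (platypus d \<mu>) b e a') = (if e = (if a = 0 then b' else a - 1) then ?r else 0)"
          using * by (cases "a = 0"; cases "a' = 0") (auto simp: iso_at_platypus sq)
      qed
      also have "\<dots> = ?r" using * by (auto simp: sum.delta)
      finally show ?thesis .
    qed
    show "(\<Sum>e<d. iso_at (platypus d \<mu>) b' e a * cnj (iso_at (platypus d \<mu>) b e a')) = (\<Sum>s<d + d + 2. x s a b * cnj (y s a' b'))"
      unfolding L split x_def y_def using * \<beta>1[of a b a' b'] \<beta>2[OF *(1), of b a' b'] sm
      by (cases "a = 0"; cases "a' = 0") (auto simp: \<alpha>_def \<chi>_def)
  next
    fix z a a' assume z: "z \<in> {x, y}" and a: "a < Suc d" "a' < Suc d"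
    have A: "(\<Sum>b<Suc d. \<alpha> a b * cnj (\<alpha> a' b)) = (if a = 0 \<and> a' = 0 then of_real m else 0)"
    proof -
      have "(\<Sum>b<Suc d. \<alpha> a b * cnj (\<alpha> a' b)) = (\<Sum>b<Suc d. if b = d then (if a = 0 \<and> a' = 0 then of_real m else 0) else 0)"
        by (intro sum.cong refl) (auto simp: \<alpha>_def sm)
      then show ?thesis by (simp add: sum.delta)
    qed
    have X: "(\<Sum>b<Suc d. \<chi> a b * cnj (\<chi> a' b)) = (if a = a' \<and> a \<noteq> 0 then of_real (\<mu> (a - 1) / m) else 0)"
    proof -
      have "(\<Sum>b<Suc d. \<chi> a b * cnj (\<chi> a' b)) = (\<Sum>b<Suc d. if b = a - 1 then (if a = a' \<and> a \<noteq> 0 then of_real (\<mu> b / m) else 0) else 0)"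
      proof (intro sum.cong refl)
        fix b
        have "complex_of_real (sqrt (\<mu> b) / sqrt m) * of_real (sqrt (\<mu> b) / sqrt m) = of_real (\<mu> b / m)" if "b < d"
          using mu(1) m that unfolding of_real_mult[symmetric] by simp
        then show "\<chi> a b * cnj (\<chi> a' b) = (if b = a - 1 then (if a = a' \<and> a \<noteq> 0 then of_real (\<mu> b / m) else 0) else 0)"
          using a by (auto simp: \<chi>_def)
      qed
      then show ?thesis using a by (auto simp: sum.delta)
    qed
    have B1: "(\<Sum>s<d. \<Sum>b<Suc d. \<beta> s a b * cnj (\<beta> s a' b)) = (if a = 0 \<and> a' = 0 then 1 else 0)"
    proof -
      have "(\<Sum>s<d. \<Sum>b<Suc d. \<beta> s a b * cnj (\<beta> s a' b)) = (\<Sum>b<Suc d. if a = 0 \<and> a' = 0 \<and> b < d then of_real (\<mu> b) else 0)"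
        by (subst sum.swap) (simp only: \<beta>1 simp_thms)
      also have "\<dots> = (if a = 0 \<and> a' = 0 then of_real (\<Sum>b<d. \<mu> b) else 0)" by (auto intro!: sum.cong)
      finally show ?thesis using mu(2) by simp
    qed
    have B2: "(\<Sum>s<d. \<Sum>b<Suc d. \<beta> (d + s) a b * cnj (\<beta> (d + s) a' b)) = (if a = a' \<and> a \<noteq> 0 then 1 else 0)"
    proof -
      have "(\<Sum>s<d. \<Sum>b<Suc d. \<beta> (d + s) a b * cnj (\<beta> (d + s) a' b)) = (\<Sum>b<Suc d. if b = d then (if a = a' \<and> a \<noteq> 0 then 1 else 0) else 0)"
        by (subst sum.swap) (simp only: \<beta>2[OF a(1)], intro sum.cong refl, simp)
      then show ?thesis by (simp add: sum.delta)
    qed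
    have "(\<Sum>s<d + d + 2. \<Sum>b<Suc d. z s a b * cnj (z s a' b)) =
      (\<Sum>s<d. \<Sum>b<Suc d. \<beta> s a b * cnj (\<beta> s a' b)) + (\<Sum>s<d. \<Sum>b<Suc d. \<beta> (d + s) a b * cnj (\<beta> (d + s) a' b))
      + (\<Sum>b<Suc d. \<alpha> a b * cnj (\<alpha> a' b)) + (\<Sum>b<Suc d. \<chi> a b * cnj (\<chi> a' b))"
      using z unfolding split by (auto simp: x_def y_def simp del: sum.lessThan_Suc)
    also have "\<dots> = (if a = a' then of_real (D a) else 0)"
      unfolding A X B1 B2 by (auto simp: D_def)
    finally show "(\<Sum>s<d + d + 2. \<Sum>b<Suc d. z s a b * cnj (z s a' b)) = (if a = a' then of_real (D a) else 0)" .
  qed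
  have "0 \<le> D a \<and> D a \<le> 1 + m" if "a < Suc d" for a
  proof (cases "a = 0")
    case False
    then have "\<mu> (a - 1) \<ge> 0" "\<mu> (a - 1) \<le> m * m" using mu(1) m(2) that by (auto simp: power2_eq_square)
    then show ?thesis using False m(1) by (simp add: D_def divide_le_eq)
  qed (use m in \<open>simp add: D_def\<close>)
  then show ?thesis unfolding pt_bounded_def platypus_simps using fam by blast
qed

lemma Qcap_platypus_le:
  assumes d: "d \<ge> 1" and mu: "\<forall>i<d. \<mu> i \<ge> 0" "(\<Sum>i<d. \<mu> i) = 1"
    and M: "Max (\<mu> ` {..<d}) \<in> {1 / real d .. 3 - 2 * sqrt 2}"
  shows "Qcap (platypus d \<mu>) \<le> 1 / 2"
proof -
  define M where "M = Max (\<mu> ` {..<d})"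
  define m where "m = sqrt M"
  have M0: "M > 0"
  proof -
    have "0 < 1 / real d" using d by simp
    also have "\<dots> \<le> M" using M by (simp add: M_def)
    finally show ?thesis .
  qed
  have m: "m > 0" "m\<^sup>2 = M" using M0 by (auto simp: m_def)
  have "\<mu> i \<le> m\<^sup>2" if "i < d" for i unfolding m M_def using that by (intro Max_ge) auto
  then have c: "pt_bounded (platypus d \<mu>) (1 + m)" using mu m by (intro pt_bounded_platypus) auto
  have "M \<le> 3 - 2 * sqrt 2" using M by (simp add: M_def)
  \<comment> \<open>The origin of the threshold: it is the square of \<open>sqrt 2 - 1\<close>, so
    \<open>1 + m \<le> sqrt 2\<close> and the logarithm is at most \<open>1/2\<close>.\<close>
  also have "\<dots> = (sqrt 2 - 1)\<^sup>2" by (simp add: power2_diff)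
  finally have "m\<^sup>2 \<le> (sqrt 2 - 1)\<^sup>2" using m by simp
  then have "m \<le> sqrt 2 - 1" by (rule power2_le_imp_le) simp
  then have "log 2 (1 + m) \<le> log 2 (sqrt 2)" using m by (subst log_le_cancel_iff) auto
  also have "log 2 (sqrt 2) = 1 / 2" by (simp add: log_def ln_sqrt)
  finally show ?thesis
    using Qcap_le_pt_bounded[OF valid_platypus[OF d mu] c] m by simp
qed

section \<open>The joint channel\<close>

lemma spectral_diag:
  assumes "\<And>x y. x < n \<Longrightarrow> y < n \<Longrightarrow> M x y = (if x = y then complex_of_real (l x) else 0)"
  shows "spectral n M (\<lambda>k x. if k = x then 1 else 0) l"
proof -
  have *: "(\<Sum>k<n. (if k = x then c else 0) * (if k = y then 1 else 0)) = (if x = y \<and> x < n then c else (0::complex))" for x y c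
  proof -
    have "(\<Sum>k<n. (if k = x then c else 0) * (if k = y then 1 else 0)) = (\<Sum>k<n. if k = x then (if x = y then c else 0) else 0)"
      by (intro sum.cong refl) auto
    then show ?thesis by (auto simp: sum.delta)
  qed
  have **: "(\<Sum>k<n. complex_of_real (l k) * ((if k = x then 1 else 0) * cnj (if k = y then 1 else 0))) = (if x = y then of_real (l x) else 0)"
    if "x < n" for x y
  proof -
    have "(\<Sum>k<n. complex_of_real (l k) * ((if k = x then 1 else 0) * cnj (if k = y then 1 else 0)))
      = (\<Sum>k<n. (if k = x then of_real (l x) else 0) * (if k = y then 1 else 0))"
      by (intro sum.cong refl) auto
    then show ?thesis using * that by simp
  qed
  have o: "(\<Sum>x<n. cnj (if i = x then 1 else 0) * (if j = x then 1 else 0)) = (if i = j then 1 else (0::complex))" if "i < n" for i j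
  proof -
    have "(\<Sum>x<n. cnj (if i = x then 1 else 0) * (if j = x then 1 else 0)) = (\<Sum>k<n. (if k = i then 1 else 0) * (if k = j then 1 else (0::complex)))"
      by (intro sum.cong refl) auto
    then show ?thesis using *[of i 1 j] that by simp
  qed
  have c: "(\<Sum>k<n. (if k = x then 1 else 0) * cnj (if k = y then 1 else 0)) = (if x = y then 1 else (0::complex))" if "x < n" for x y
    using *[of x 1 y] that by (simp add: if_distrib[of cnj] cong: if_cong)
  show ?thesis unfolding spectral_def orthonormal_def using assms ** o c by auto
qed

lemma eta_scale: "x \<ge> 0 \<Longrightarrow> c > 0 \<Longrightarrow> eta (x * c) = x * (c * log 2 c) + eta x * c"
  using eta_mult[of x c] by (simp add: eta_def)

lemma log2_quarter: "log 2 (1 / 4) = - 2"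
  using log_nat_power[of 2 2 2] by (simp add: log_divide)

lemma eta_quarter: "x \<ge> 0 \<Longrightarrow> eta (x * (1 / 4)) = x * (- 1 / 2) + eta x / 4"
  using eta_scale[of x "1 / 4"] unfolding log2_quarter by simp

lemma eta_half: "x \<ge> 0 \<Longrightarrow> eta (x * (1 / 2)) = x * (- 1 / 2) + eta x / 2"
  using eta_scale[of x "1 / 2"] by (simp add: log_divide)

section \<open>The input state of the joint channel\<close>

context
  fixes d j0 :: nat and \<mu> :: "nat \<Rightarrow> real"
  assumes mu: "\<forall>i<d. \<mu> i \<ge> 0" "(\<Sum>i<d. \<mu> i) = 1" and j0: "j0 < d" "\<mu> j0 > 0"
begin

declare mult_Suc [simp del] mult_Suc_right [simp del]

text \<open>\<open>r\<close> labels the two terms of the mixture. The input index is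
  \<open>a1 * d + a2\<close>, so \<open>a = j0\<close> stands for \<open>|0>|j0>\<close>, and
  \<open>a div d = Suc (a mod d)\<close> selects the vectors \<open>|j+1>|j>\<close>.\<close>

definition "input_amp r a = complex_of_real (if r = (0::nat) then (if a = j0 then sqrt (1 / 2) else 0)
  else (if a div d = Suc (a mod d) then sqrt (1 / 2) * sqrt (\<mu> (a mod d)) else 0))"

definition "input_state = mat ((Suc d) * d) ((Suc d) * d) (\<lambda>(x, y). \<Sum>r<2. input_amp r x * cnj (input_amp r y))"

text \<open>The image of \<open>|j>\<close> under the erasure isometry at \<open>1/2\<close>,
  without its factor \<open>sqrt (1/2)\<close>: either the output or the environment receives
  \<open>|j>\<close>, and the other the erasure symbol \<open>|d>\<close>.\<close>

definition "flag j b e = (if (b = j \<and> e = d) \<or> (b = d \<and> e = j) then 1 else (0::complex))"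

abbreviation "joint \<equiv> tensor_iso (platypus d \<mu>) (erasure d (1 / 2))"

lemma d0: "d \<ge> 1" using j0 by simp

lemma sum_eta_quarter: "(\<Sum>i<d. eta (\<mu> i * (1 / 4))) = - 1 / 2 + (\<Sum>i<d. eta (\<mu> i)) / 4"
proof -
  have "(\<Sum>i<d. eta (\<mu> i * (1 / 4))) = (\<Sum>i<d. \<mu> i * (- 1 / 2) + eta (\<mu> i) / 4)"
    using mu(1) by (intro sum.cong refl eta_quarter) auto
  also have "\<dots> = (\<Sum>i<d. \<mu> i) * (- 1 / 2) + (\<Sum>i<d. eta (\<mu> i)) / 4"
    by (simp only: sum.distrib sum_distrib_right sum_divide_distrib)
  finally show ?thesis using mu(2) by simp
qed

lemma sum_eta_half: "(\<Sum>i<d. eta (\<mu> i * (1 / 2))) = - 1 / 2 + (\<Sum>i<d. eta (\<mu> i)) / 2"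
proof -
  have "(\<Sum>i<d. eta (\<mu> i * (1 / 2))) = (\<Sum>i<d. \<mu> i * (- 1 / 2) + eta (\<mu> i) / 2)"
    using mu(1) by (intro sum.cong refl eta_half) auto
  also have "\<dots> = (\<Sum>i<d. \<mu> i) * (- 1 / 2) + (\<Sum>i<d. eta (\<mu> i)) / 2"
    by (simp only: sum.distrib sum_distrib_right sum_divide_distrib)
  finally show ?thesis using mu(2) by simp
qed

lemma j0_less: "j0 < Suc d * d"
  using pair_less[of 0 "Suc d" j0 d] j0 by simp

lemma sq_mu: "i < d \<Longrightarrow> complex_of_real (sqrt (\<mu> i)) * of_real (sqrt (\<mu> i)) = of_real (\<mu> i)"
  using mu(1) unfolding of_real_mult[symmetric] by simp

lemma density_input_state: "density ((Suc d) * d) input_state"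
proof (rule densityI_gram[where I = "{..<2}" and g = input_amp])
  have "(\<Sum>x<(Suc d) * d. (cmod (input_amp 0 x))\<^sup>2) = (\<Sum>x<(Suc d) * d. if x = j0 then 1 / 2 else 0)"
    by (intro sum.cong refl) (auto simp: input_amp_def)
  also have "\<dots> = 1 / 2" using j0_less by (simp add: sum.delta)
  finally have 0: "(\<Sum>x<(Suc d) * d. (cmod (input_amp 0 x))\<^sup>2) = 1 / 2" .
  have "(\<Sum>x<(Suc d) * d. (cmod (input_amp 1 x))\<^sup>2) = (\<Sum>a<Suc d. \<Sum>j<d. if a = j + 1 then \<mu> j / 2 else 0)"
    unfolding sum_divmod using mu(1)
    by (intro sum.cong refl) (auto simp: input_amp_def norm_mult power_mult_distrib simp del: mult_Suc_right)
  also have "\<dots> = (\<Sum>j<d. \<Sum>a<Suc d. if a = j + 1 then \<mu> j / 2 else 0)" by (rule sum.swap)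
  also have "\<dots> = (\<Sum>j<d. \<mu> j / 2)" by (intro sum.cong refl) (simp add: sum.delta)
  also have "\<dots> = 1 / 2" using mu(2) by (simp add: sum_divide_distrib[symmetric])
  finally have 1: "(\<Sum>x<(Suc d) * d. (cmod (input_amp 1 x))\<^sup>2) = 1 / 2" .
  show "(\<Sum>r<2. \<Sum>x<(Suc d) * d. (cmod (input_amp r x))\<^sup>2) = 1"
    using 0 1 by (simp add: numeral_2_eq_2)
qed (auto simp: input_state_def)

lemma valid_joint: "valid joint"
  using valid_tensor[OF valid_platypus[OF d0 mu] valid_erasure[of d "1 / 2"]] d0 by simp

lemma iso_at_joint:
  assumes "b1 < Suc d" "b2 < Suc d" "e1 < d" "e2 < Suc d" "a1 < Suc d" "a2 < d"
  shows "iso_at joint (b1 * (Suc d) + b2) (e1 * (Suc d) + e2) (a1 * d + a2) =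
    (if a1 = 0 then (if b1 = e1 then of_real (sqrt (\<mu> e1)) else 0)
     else (if b1 = d \<and> e1 = a1 - 1 then 1 else 0)) * (of_real (sqrt (1 / 2)) * flag a2 b2 e2)"
proof -
  have *: "b1 * (Suc d) + b2 < (Suc d) * (Suc d)" "e1 * (Suc d) + e2 < d * (Suc d)" "a1 * d + a2 < (Suc d) * d"
    using assms by (intro pair_less; simp)+
  show ?thesis
    using iso_at_tensor[of "b1 * (Suc d) + b2" "platypus d \<mu>" "erasure d (1 / 2)" "e1 * (Suc d) + e2" "a1 * d + a2"] *
    unfolding platypus_simps erasure_simps divmod_small[OF assms(2)] divmod_small[OF assms(4)] divmod_small[OF assms(6)]
    using assms by (simp add: iso_at_platypus iso_at_erasure flag_def del: mult_Suc mult_Suc_right)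
qed

text \<open>In branch 0 the platypus input \<open>|0>\<close> gives equal labels
  \<open>b1 = e1\<close>, and the erasure channel carries \<open>j0\<close>. In branch 1 the output
  is \<open>|d>\<close>, and the environment label \<open>e1\<close> equals the index sent through
  the erasure channel. The factor \<open>1/2\<close> combines the mixture amplitude with the erasure
  amplitude, each \<open>sqrt (1/2)\<close>.\<close>

lemma outvec_joint:
  assumes "b1 < Suc d" "b2 < Suc d" "e1 < d" "e2 < Suc d"
  shows "outvec joint (\<lambda>a r. input_amp r a) (b1 * (Suc d) + b2) (e1 * (Suc d) + e2) 0 =
      (if b1 = e1 then of_real (sqrt (\<mu> e1) / 2) * flag j0 b2 e2 else 0)"
    and "outvec joint (\<lambda>a r. input_amp r a) (b1 * (Suc d) + b2) (e1 * (Suc d) + e2) (Suc 0) =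
      (if b1 = d then of_real (sqrt (\<mu> e1) / 2) * flag e1 b2 e2 else 0)"
proof -
  have h: "complex_of_real (sqrt (1 / 2)) * of_real (sqrt (1 / 2)) = 1 / 2"
    unfolding of_real_mult[symmetric] by simp
  let ?v = "iso_at joint (b1 * (Suc d) + b2) (e1 * (Suc d) + e2)"
  have "outvec joint (\<lambda>a r. input_amp r a) (b1 * (Suc d) + b2) (e1 * (Suc d) + e2) 0
    = (\<Sum>a<(Suc d) * d. if a = j0 then ?v (0 * d + j0) * of_real (sqrt (1 / 2)) else 0)"
    unfolding outvec_def tensor_iso_simps platypus_simps erasure_simps
    by (intro sum.cong refl) (auto simp: input_amp_def)
  also have "\<dots> = ?v (0 * d + j0) * of_real (sqrt (1 / 2))"
    using j0_less by (simp add: sum.delta)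
  also have "\<dots> = (if b1 = e1 then of_real (sqrt (\<mu> e1) / 2) * flag j0 b2 e2 else 0)"
    using iso_at_joint[OF assms, of 0 j0] j0 h by (simp add: ac_simps)
  finally show "outvec joint (\<lambda>a r. input_amp r a) (b1 * (Suc d) + b2) (e1 * (Suc d) + e2) 0 =
      (if b1 = e1 then of_real (sqrt (\<mu> e1) / 2) * flag j0 b2 e2 else 0)" .
  have "outvec joint (\<lambda>a r. input_amp r a) (b1 * (Suc d) + b2) (e1 * (Suc d) + e2) (Suc 0)
    = (\<Sum>a1<Suc d. \<Sum>a2<d. if a1 = a2 + 1 then ?v ((a2 + 1) * d + a2) * of_real (sqrt (1 / 2) * sqrt (\<mu> a2)) else 0)"
    unfolding outvec_def tensor_iso_simps platypus_simps erasure_simps sum_divmod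
    by (intro sum.cong refl) (auto simp: input_amp_def divmod_small simp del: mult_Suc mult_Suc_right)
  also have "\<dots> = (\<Sum>a2<d. \<Sum>a1<Suc d. if a1 = a2 + 1 then ?v ((a2 + 1) * d + a2) * of_real (sqrt (1 / 2) * sqrt (\<mu> a2)) else 0)"
    by (rule sum.swap)
  also have "\<dots> = (\<Sum>a2<d. ?v ((a2 + 1) * d + a2) * of_real (sqrt (1 / 2) * sqrt (\<mu> a2)))"
    by (intro sum.cong refl) (simp add: sum.delta)
  also have "\<dots> = (\<Sum>a2<d. if a2 = e1 then (if b1 = d then of_real (sqrt (\<mu> e1) / 2) * flag e1 b2 e2 else 0) else 0)"
  proof (intro sum.cong refl)
    fix a2 assume "a2 \<in> {..<d}"
    then have "?v ((a2 + 1) * d + a2) = (if b1 = d \<and> e1 = a2 then 1 else 0) * (of_real (sqrt (1 / 2)) * flag a2 b2 e2)"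
      using iso_at_joint[OF assms, of "a2 + 1" a2] by simp
    then show "?v ((a2 + 1) * d + a2) * of_real (sqrt (1 / 2) * sqrt (\<mu> a2))
      = (if a2 = e1 then (if b1 = d then of_real (sqrt (\<mu> e1) / 2) * flag e1 b2 e2 else 0) else 0)"
      using h by (auto simp: ac_simps)
  qed
  also have "\<dots> = (if b1 = d then of_real (sqrt (\<mu> e1) / 2) * flag e1 b2 e2 else 0)"
    using assms by (simp add: sum.delta)
  finally show "outvec joint (\<lambda>a r. input_amp r a) (b1 * (Suc d) + b2) (e1 * (Suc d) + e2) (Suc 0) =
      (if b1 = d then of_real (sqrt (\<mu> e1) / 2) * flag e1 b2 e2 else 0)" .
qed

lemma cnj_flag [simp]: "cnj (flag j b e) = flag j b e"
  by (simp add: flag_def)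

lemma sum_flag_E:
  assumes "j < d" "b < Suc d" "b' < Suc d"
  shows "(\<Sum>e<Suc d. flag j b e * flag j b' e) = (if b = b' \<and> (b = j \<or> b = d) then 1 else 0)"
proof -
  have "(\<Sum>e<Suc d. flag j b e * flag j b' e) =
    (\<Sum>e<Suc d. (if e = d then (if b = j \<and> b' = j then 1 else 0) else 0) + (if e = j then (if b = d \<and> b' = d then 1 else 0) else 0))"
    using assms by (intro sum.cong refl) (auto simp: flag_def)
  also have "\<dots> = (if b = b' \<and> (b = j \<or> b = d) then 1 else 0)"
    unfolding sum.distrib using assms by (simp only: sum.delta finite_lessThan lessThan_iff) auto
  finally show ?thesis .
qed

lemma sum_flag_B:
  assumes "j < d" "j' < d" "e < Suc d" "e' < Suc d"
  shows "(\<Sum>b<Suc d. flag j b e * flag j' b e') =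
    (if j = j' \<and> e = d \<and> e' = d then 1 else 0) + (if e = j \<and> e' = j' then 1 else 0)"
proof -
  have "(\<Sum>b<Suc d. flag j b e * flag j' b e') =
    (\<Sum>b<Suc d. (if b = j then (if j = j' \<and> e = d \<and> e' = d then 1 else 0) else 0) + (if b = d then (if e = j \<and> e' = j' then 1 else 0) else 0))"
    using assms by (intro sum.cong refl) (auto simp: flag_def)
  also have "\<dots> = (if j = j' \<and> e = d \<and> e' = d then 1 else 0) + (if e = j \<and> e' = j' then 1 else 0)"
    unfolding sum.distrib using assms by (simp only: sum.delta finite_lessThan lessThan_iff) auto
  finally show ?thesis .
qed

lemma sum_2: "(\<Sum>r<2. f r) = f 0 + f (Suc 0)"
  for f :: "nat \<Rightarrow> complex"
  by (simp add: numeral_2_eq_2)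

lemma input_state_gram: "x < s_in joint \<Longrightarrow> y < s_in joint \<Longrightarrow>
    input_state $$ (x, y) = (\<Sum>r<2. (\<lambda>a r. input_amp r a) x r * cnj ((\<lambda>a r. input_amp r a) y r))"
  by (simp add: input_state_def)

section \<open>Output and environment states of the joint channel\<close>

definition "out_eigenvalue b1 b2 = (if b1 < d then (if b2 = j0 \<or> b2 = d then \<mu> b1 * (1 / 4) else 0)
   else (if b2 < d then \<mu> b2 * (1 / 4) else 1 / 4))"

text \<open>The environment label \<open>e1\<close> copies \<open>b1\<close> in branch 0 and the
  transmitted index in branch 1, so tracing it out removes all coherence; the branches are separated
  by \<open>b1 < d\<close> and \<open>b1 = d\<close>.\<close>

lemma chan_joint:
  assumes "b1 < Suc d" "b2 < Suc d" "b1' < Suc d" "b2' < Suc d"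
  shows "chan joint input_state $$ (b1 * (Suc d) + b2, b1' * (Suc d) + b2') =
    (if b1 = b1' \<and> b2 = b2' then of_real (out_eigenvalue b1 b2) else 0)"
proof -
  have *: "b1 * (Suc d) + b2 < s_outB joint" "b1' * (Suc d) + b2' < s_outB joint"
    unfolding tensor_iso_simps platypus_simps erasure_simps using assms by (intro pair_less; simp)+
  have ca: "input_state \<in> carrier_mat (s_in joint) (s_in joint)" by (simp add: input_state_def)
  have q: "complex_of_real (sqrt (\<mu> e) / 2) * of_real (sqrt (\<mu> e) / 2) = of_real (\<mu> e * (1 / 4))" if "e < d" for e
    using sq_mu[OF that] by simp
  have "chan joint input_state $$ (b1 * (Suc d) + b2, b1' * (Suc d) + b2') =
    (\<Sum>(e,r)\<in>{..<s_outE joint} \<times> {..<2}. outvec joint (\<lambda>a r. input_amp r a) (b1 * (Suc d) + b2) e r * cnj (outvec joint (\<lambda>a r. input_amp r a) (b1' * (Suc d) + b2') e r))"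
    by (rule chan_gram[OF valid_joint ca _ *]) (rule input_state_gram)
  also have "\<dots> = (\<Sum>e1<d. \<Sum>e2<Suc d. \<Sum>r<2. outvec joint (\<lambda>a r. input_amp r a) (b1 * (Suc d) + b2) (e1 * (Suc d) + e2) r *
      cnj (outvec joint (\<lambda>a r. input_amp r a) (b1' * (Suc d) + b2') (e1 * (Suc d) + e2) r))"
    unfolding tensor_iso_simps platypus_simps erasure_simps sum.cartesian_product' prod.case sum_divmod ..
  also have "\<dots> = (\<Sum>e1<d. \<Sum>e2<Suc d.
      (if b1 = e1 \<and> b1' = e1 then of_real (\<mu> e1 * (1 / 4)) else 0) * (flag j0 b2 e2 * flag j0 b2' e2) +
      (if b1 = d \<and> b1' = d then of_real (\<mu> e1 * (1 / 4)) else 0) * (flag e1 b2 e2 * flag e1 b2' e2))"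
  proof (intro sum.cong refl)
    fix e1 e2 assume e: "e1 \<in> {..<d}" "e2 \<in> {..<Suc d}"
    show "(\<Sum>r<2. outvec joint (\<lambda>a r. input_amp r a) (b1 * (Suc d) + b2) (e1 * (Suc d) + e2) r *
      cnj (outvec joint (\<lambda>a r. input_amp r a) (b1' * (Suc d) + b2') (e1 * (Suc d) + e2) r)) =
      (if b1 = e1 \<and> b1' = e1 then of_real (\<mu> e1 * (1 / 4)) else 0) * (flag j0 b2 e2 * flag j0 b2' e2) +
      (if b1 = d \<and> b1' = d then of_real (\<mu> e1 * (1 / 4)) else 0) * (flag e1 b2 e2 * flag e1 b2' e2)"
      unfolding sum_2 using e assms q[of e1, symmetric] by (simp add: outvec_joint del: mult_Suc_right mult_Suc of_real_divide)
  qed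
  also have "\<dots> = (\<Sum>e1<d.
      (if b1 = e1 \<and> b1' = e1 then of_real (\<mu> e1 * (1 / 4)) else 0) * (if b2 = b2' \<and> (b2 = j0 \<or> b2 = d) then 1 else 0) +
      (if b1 = d \<and> b1' = d then of_real (\<mu> e1 * (1 / 4)) else 0) * (if b2 = b2' \<and> (b2 = e1 \<or> b2 = d) then 1 else 0))"
    unfolding sum.distrib sum_distrib_left[symmetric]
    using assms j0 by (intro arg_cong2[where f = "(+)"] sum.cong refl) (auto simp: sum_flag_E simp del: sum.lessThan_Suc)
  also have "\<dots> = (\<Sum>e1<d. (if e1 = b1 then (if b1 = b1' \<and> b2 = b2' \<and> (b2 = j0 \<or> b2 = d) then of_real (\<mu> b1 * (1 / 4)) else 0) else 0)) +
      (if b1 = d \<and> b1' = d \<and> b2 = b2' then (\<Sum>e1<d. if b2 = e1 \<or> b2 = d then of_real (\<mu> e1 * (1 / 4)) else 0) else 0)"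
    unfolding sum.distrib
    by (rule arg_cong2[where f = "(+)"], rule sum.cong[OF refl], (auto)[1], auto intro!: sum.cong sum.neutral)
  also have "(\<Sum>e1<d. if b2 = e1 \<or> b2 = d then complex_of_real (\<mu> e1 * (1 / 4)) else 0) = of_real (if b2 < d then \<mu> b2 * (1 / 4) else 1 / 4)"
  proof (cases "b2 = d")
    case True
    then have "(\<Sum>e1<d. if b2 = e1 \<or> b2 = d then complex_of_real (\<mu> e1 * (1 / 4)) else 0) = of_real ((\<Sum>e1<d. \<mu> e1) * (1 / 4))"
      unfolding sum_distrib_right of_real_sum by (intro sum.cong refl) simp
    then show ?thesis using True mu(2) by simp
  next
    case False
    then have "(\<Sum>e1<d. if b2 = e1 \<or> b2 = d then complex_of_real (\<mu> e1 * (1 / 4)) else 0) = (\<Sum>e1<d. if e1 = b2 then of_real (\<mu> e1 * (1 / 4)) else 0)"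
      by (intro sum.cong refl) auto
    then show ?thesis using False assms by (simp add: sum.delta)
  qed
  finally show ?thesis using assms by (auto simp: sum.delta out_eigenvalue_def)
qed

text \<open>The spectrum consists of three copies of the weights \<open>\<mu> i / 4\<close> and one
  weight \<open>1/4\<close>. With \<open>H\<close> the Shannon entropy of \<mu> this gives
  \<open>2 + 3/4 H\<close>.\<close>

lemma entropy_chan_joint:
  "vN_entropy (chan joint input_state) = 2 - 3 / 4 * (\<Sum>i<d. eta (\<mu> i))"
proof -
  define l where "l = (\<lambda>b. out_eigenvalue (b div (Suc d)) (b mod (Suc d)))"
  have "spectral ((Suc d) * (Suc d)) (\<lambda>x y. chan joint input_state $$ (x, y)) (\<lambda>k x. if k = x then 1 else 0) l"
  proof (rule spectral_diag)
    fix x y assume xy: "x < (Suc d) * (Suc d)" "y < (Suc d) * (Suc d)"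
    have "chan joint input_state $$ (x div (Suc d) * (Suc d) + x mod (Suc d), y div (Suc d) * (Suc d) + y mod (Suc d)) =
      (if x div (Suc d) = y div (Suc d) \<and> x mod (Suc d) = y mod (Suc d) then of_real (out_eigenvalue (x div (Suc d)) (x mod (Suc d))) else 0)"
      by (rule chan_joint) (use xy in \<open>auto intro: div_less_mult mod_less_mult\<close>)
    then show "chan joint input_state $$ (x, y) = (if x = y then of_real (l x) else 0)"
      unfolding div_mult_mod_eq divmod_eq_iff l_def .
  qed
  then have "vN_entropy (chan joint input_state) = - (\<Sum>b<(Suc d) * (Suc d). eta (l b))"
    by (intro vN_entropy_spectral) (use chan_carrier[of joint input_state] in auto)
  also have "(\<Sum>b<(Suc d) * (Suc d). eta (l b)) = (\<Sum>b1<Suc d. \<Sum>b2<Suc d. eta (out_eigenvalue b1 b2))"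
    unfolding sum_divmod l_def by (intro sum.cong refl) (simp add: divmod_small del: mult_Suc mult_Suc_right)
  also have "\<dots> = (\<Sum>b1<d. 2 * eta (\<mu> b1 * (1 / 4))) + ((\<Sum>b2<d. eta (\<mu> b2 * (1 / 4))) + eta (1 / 4))"
  proof -
    have "(\<Sum>b2<Suc d. eta (out_eigenvalue b1 b2)) = 2 * eta (\<mu> b1 * (1 / 4))" if "b1 < d" for b1
    proof -
      have "(\<Sum>b2<Suc d. eta (out_eigenvalue b1 b2)) = (\<Sum>b2<Suc d. (if b2 = j0 then eta (\<mu> b1 * (1 / 4)) else 0) + (if b2 = d then eta (\<mu> b1 * (1 / 4)) else 0))"
        using that j0 by (intro sum.cong refl) (auto simp: out_eigenvalue_def eta_def)
      then show ?thesis unfolding sum.distrib using j0 by (simp only: sum.delta finite_lessThan lessThan_iff) simp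
    qed
    moreover have "(\<Sum>b2<Suc d. eta (out_eigenvalue d b2)) = (\<Sum>b2<d. eta (\<mu> b2 * (1 / 4))) + eta (1 / 4)"
      by (simp add: out_eigenvalue_def)
    ultimately show ?thesis by (simp del: sum.lessThan_Suc add: sum.lessThan_Suc[of _ d])
  qed
  also have "\<dots> = 3 * (\<Sum>i<d. eta (\<mu> i * (1 / 4))) + eta (1 / 4)"
    by (simp add: sum_distrib_left[symmetric])
  also have "(\<Sum>i<d. eta (\<mu> i * (1 / 4))) = - 1 / 2 + (\<Sum>i<d. eta (\<mu> i)) / 4"
    by (rule sum_eta_quarter)
  also have "eta (1 / 4) = - 1 / 2"
    using log2_quarter by (simp add: eta_def)
  finally show ?thesis by simp
qed

text \<open>\<open>env_vec (d + j0)\<close> and \<open>env_vec (d + d)\<close> are the two non-orthogonal terms of the environment state.\<close>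

definition "env_vec i = (\<lambda>e.
   if i < d then (if e = i * (Suc d) + d then complex_of_real (sqrt (\<mu> i / 2)) else 0)
   else if i < d + d then (if e = (i - d) * (Suc d) + j0 then of_real (sqrt (\<mu> (i - d)) / 2) else 0)
   else (if e div (Suc d) = e mod (Suc d) then of_real (sqrt (\<mu> (e div (Suc d))) / 2) else 0))"

definition "env_weight i = (if i < d then \<mu> i * (1 / 2) else if i < d + d then \<mu> (i - d) * (1 / 4) else 1 / 4)"

text \<open>The terms, in order: the erasure symbol in the environment, to which both branches
  contribute \<open>\<mu> / 4\<close>; branch 0 with \<open>j0\<close> lost to the environment;
  branch 1 with its index lost. In the last case the output is \<open>|d>|d>\<close> whatever the
  index was, so the coherence of the entangled vector survives in the environment.\<close>

lemma chan_c_joint: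
  assumes "e1 < d" "e2 < Suc d" "e1' < d" "e2' < Suc d"
  shows "chan_c joint input_state $$ (e1 * (Suc d) + e2, e1' * (Suc d) + e2') =
    (if e1 = e1' \<and> e2 = d \<and> e2' = d then of_real (\<mu> e1 * (1 / 2)) else 0) +
    (if e1 = e1' \<and> e2 = j0 \<and> e2' = j0 then of_real (\<mu> e1 * (1 / 4)) else 0) +
    (if e2 = e1 \<and> e2' = e1' then of_real (sqrt (\<mu> e1) / 2) * of_real (sqrt (\<mu> e1') / 2) else 0)"
proof -
  have *: "e1 * (Suc d) + e2 < s_outE joint" "e1' * (Suc d) + e2' < s_outE joint"
    unfolding tensor_iso_simps platypus_simps erasure_simps using assms by (intro pair_less; simp)+
  have ca: "input_state \<in> carrier_mat (s_in joint) (s_in joint)" by (simp add: input_state_def)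
  let ?s = "complex_of_real (sqrt (\<mu> e1) / 2) * of_real (sqrt (\<mu> e1') / 2)"
  have q: "?s = of_real (\<mu> e1 * (1 / 4))" if "e1 = e1'"
    using sq_mu[OF assms(1)] that by simp
  have "chan_c joint input_state $$ (e1 * (Suc d) + e2, e1' * (Suc d) + e2') =
    (\<Sum>(b,r)\<in>{..<s_outB joint} \<times> {..<2}. outvec joint (\<lambda>a r. input_amp r a) b (e1 * (Suc d) + e2) r * cnj (outvec joint (\<lambda>a r. input_amp r a) b (e1' * (Suc d) + e2') r))"
    by (rule chan_c_gram[OF valid_joint ca _ *]) (rule input_state_gram)
  also have "\<dots> = (\<Sum>b1<Suc d. \<Sum>b2<Suc d. \<Sum>r<2. outvec joint (\<lambda>a r. input_amp r a) (b1 * (Suc d) + b2) (e1 * (Suc d) + e2) r *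
      cnj (outvec joint (\<lambda>a r. input_amp r a) (b1 * (Suc d) + b2) (e1' * (Suc d) + e2') r))"
    unfolding tensor_iso_simps platypus_simps erasure_simps sum.cartesian_product' prod.case sum_divmod ..
  also have "\<dots> = (\<Sum>b1<Suc d. \<Sum>b2<Suc d.
      (if b1 = e1 then (if e1 = e1' then ?s else 0) else 0) * (flag j0 b2 e2 * flag j0 b2 e2') +
      (if b1 = d then ?s else 0) * (flag e1 b2 e2 * flag e1' b2 e2'))"
  proof (intro sum.cong refl)
    fix b1 b2 assume b: "b1 \<in> {..<Suc d}" "b2 \<in> {..<Suc d}"
    show "(\<Sum>r<2. outvec joint (\<lambda>a r. input_amp r a) (b1 * (Suc d) + b2) (e1 * (Suc d) + e2) r *
      cnj (outvec joint (\<lambda>a r. input_amp r a) (b1 * (Suc d) + b2) (e1' * (Suc d) + e2') r)) =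
      (if b1 = e1 then (if e1 = e1' then ?s else 0) else 0) * (flag j0 b2 e2 * flag j0 b2 e2') +
      (if b1 = d then ?s else 0) * (flag e1 b2 e2 * flag e1' b2 e2')"
      unfolding sum_2 using b assms by (simp add: outvec_joint del: mult_Suc_right mult_Suc of_real_divide)
  qed
  also have "\<dots> = (\<Sum>b1<Suc d.
      (if b1 = e1 then (if e1 = e1' then ?s else 0) else 0) * ((if e2 = d \<and> e2' = d then 1 else 0) + (if e2 = j0 \<and> e2' = j0 then 1 else 0)) +
      (if b1 = d then ?s else 0) * ((if e1 = e1' \<and> e2 = d \<and> e2' = d then 1 else 0) + (if e2 = e1 \<and> e2' = e1' then 1 else 0)))"
    unfolding sum.distrib[of _ _ "{..<Suc d}"] sum_distrib_left[symmetric]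
      sum_flag_B[OF j0(1) j0(1) assms(2,4)] sum_flag_B[OF assms(1,3,2,4)] by simp
  also have "\<dots> = (if e1 = e1' then ?s else 0) * ((if e2 = d \<and> e2' = d then 1 else 0) + (if e2 = j0 \<and> e2' = j0 then 1 else 0)) +
      ?s * ((if e1 = e1' \<and> e2 = d \<and> e2' = d then 1 else 0) + (if e2 = e1 \<and> e2' = e1' then 1 else 0))"
    unfolding sum.distrib[of _ _ "{..<Suc d}"] sum_distrib_right[symmetric] using assms
    by (simp only: sum.delta finite_lessThan lessThan_iff) simp
  finally have e: "chan_c joint input_state $$ (e1 * Suc d + e2, e1' * Suc d + e2') =
      (if e1 = e1' then ?s else 0) * ((if e2 = d \<and> e2' = d then 1 else 0) + (if e2 = j0 \<and> e2' = j0 then 1 else 0)) +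
      ?s * ((if e1 = e1' \<and> e2 = d \<and> e2' = d then 1 else 0) + (if e2 = e1 \<and> e2' = e1' then 1 else 0))" .
  \<comment> \<open>The equal contributions of the two branches at \<open>e2 = d\<close> are
    merged.\<close>
  have dbl: "2 * complex_of_real (x / 4) = of_real (x / 2)" for x by simp
  show ?thesis unfolding e using q assms j0 by (auto simp: dbl simp del: of_real_divide)
qed

lemma env_vec_apply:
  assumes "e1 < d" "e2 < Suc d"
  shows "i < d \<Longrightarrow> env_vec i (e1 * (Suc d) + e2) = (if e1 = i \<and> e2 = d then of_real (sqrt (\<mu> i / 2)) else 0)"
    and "i < d \<Longrightarrow> env_vec (d + i) (e1 * (Suc d) + e2) = (if e1 = i \<and> e2 = j0 then of_real (sqrt (\<mu> i) / 2) else 0)"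
    and "env_vec (d + d) (e1 * (Suc d) + e2) = (if e1 = e2 then of_real (sqrt (\<mu> e1) / 2) else 0)"
proof -
  have *: "e1 * (Suc d) + e2 = i * (Suc d) + k \<longleftrightarrow> e1 = i \<and> e2 = k" if "k < Suc d" for i k
    using divmod_small[OF assms(2), of e1] divmod_small[OF that, of i] by metis
  show "i < d \<Longrightarrow> env_vec i (e1 * (Suc d) + e2) = (if e1 = i \<and> e2 = d then of_real (sqrt (\<mu> i / 2)) else 0)"
    unfolding env_vec_def using *[of d i] by simp
  show "i < d \<Longrightarrow> env_vec (d + i) (e1 * (Suc d) + e2) = (if e1 = i \<and> e2 = j0 then of_real (sqrt (\<mu> i) / 2) else 0)"
    unfolding env_vec_def using *[of j0 i] j0 by simp
  show "env_vec (d + d) (e1 * (Suc d) + e2) = (if e1 = e2 then of_real (sqrt (\<mu> e1) / 2) else 0)"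
    unfolding env_vec_def divmod_small[OF assms(2)] by simp
qed

lemma sum_env_split:
  fixes f :: "nat \<Rightarrow> 'a :: comm_monoid_add"
  shows "(\<Sum>i<d + d + 1. f i) = (\<Sum>i<d. f i) + (\<Sum>i<d. f (d + i)) + f (d + d)"
  using sum_lessThan_add[of f d d] by simp

text \<open>The weights \<open>\<mu> i / 2\<close>, \<open>\<mu> i / 4\<close> and
  \<open>1/4\<close> have Shannon entropy \<open>3/2 + 3/4 H\<close>, with \<open>H\<close> the
  Shannon entropy of \<mu>. That bound is strict because of one overlapping pair.\<close>

lemma entropy_chan_c_joint:
  "vN_entropy (chan_c joint input_state) < 3 / 2 - 3 / 4 * (\<Sum>i<d. eta (\<mu> i))"
proof -
  let ?n = "d * (Suc d)"
  have dens: "density ?n (chan_c joint input_state)"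
    using density_chan_c[OF valid_joint, of input_state] density_input_state by simp
  obtain u l where s: "spectral ?n (\<lambda>x y. chan_c joint input_state $$ (x, y)) u l"
    using density_spectral[OF dens] by metis
  have S: "vN_entropy (chan_c joint input_state) = - (\<Sum>k<?n. eta (l k))"
    by (rule vN_entropy_spectral[OF density_carrier[OF dens] s])
  have gram: "chan_c joint input_state $$ (x, y) = (\<Sum>i<d + d + 1. env_vec i x * cnj (env_vec i y))" if xy: "x < ?n" "y < ?n" for x y
  proof -
    define e1 e2 e1' e2' where "e1 = x div (Suc d)" and "e2 = x mod (Suc d)" and "e1' = y div (Suc d)" and "e2' = y mod (Suc d)"
    have x: "x = e1 * (Suc d) + e2" and y: "y = e1' * (Suc d) + e2'"
      unfolding e1_def e2_def e1'_def e2'_def by (simp_all only: div_mult_mod_eq)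
    have e: "e1 < d" "e2 < Suc d" "e1' < d" "e2' < Suc d"
      using xy unfolding e1_def e2_def e1'_def e2'_def by (auto intro: div_less_mult)
    have f1: "(\<Sum>i<d. env_vec i x * cnj (env_vec i y)) = (if e1 = e1' \<and> e2 = d \<and> e2' = d then of_real (\<mu> e1 * (1 / 2)) else 0)"
    proof -
      have "complex_of_real (sqrt (\<mu> e1 / 2)) * of_real (sqrt (\<mu> e1 / 2)) = of_real (\<mu> e1 * (1 / 2))"
        unfolding of_real_mult[symmetric] using mu(1) e by simp
      then have "(\<Sum>i<d. env_vec i x * cnj (env_vec i y)) = (\<Sum>i<d. if i = e1 then (if e1 = e1' \<and> e2 = d \<and> e2' = d then of_real (\<mu> e1 * (1 / 2)) else 0) else 0)"
        unfolding x y using e by (intro sum.cong refl) (auto simp: env_vec_apply simp del: mult_Suc_right)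
      then show ?thesis using e by (simp add: sum.delta)
    qed
    have f2: "(\<Sum>i<d. env_vec (d + i) x * cnj (env_vec (d + i) y)) = (if e1 = e1' \<and> e2 = j0 \<and> e2' = j0 then of_real (\<mu> e1 * (1 / 4)) else 0)"
    proof -
      have "complex_of_real (sqrt (\<mu> e1) / 2) * of_real (sqrt (\<mu> e1) / 2) = of_real (\<mu> e1 * (1 / 4))"
        using sq_mu[OF e(1)] by simp
      then have "(\<Sum>i<d. env_vec (d + i) x * cnj (env_vec (d + i) y)) = (\<Sum>i<d. if i = e1 then (if e1 = e1' \<and> e2 = j0 \<and> e2' = j0 then of_real (\<mu> e1 * (1 / 4)) else 0) else 0)"
        unfolding x y using e by (intro sum.cong refl) (auto simp: env_vec_apply simp del: mult_Suc_right of_real_divide)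
      then show ?thesis using e by (simp add: sum.delta)
    qed
    have f3: "env_vec (d + d) x * cnj (env_vec (d + d) y) = (if e2 = e1 \<and> e2' = e1' then of_real (sqrt (\<mu> e1) / 2) * of_real (sqrt (\<mu> e1') / 2) else 0)"
      unfolding x y env_vec_apply(3)[OF e(1,2)] env_vec_apply(3)[OF e(3,4)] by auto
    show ?thesis unfolding sum_env_split f1 f2 f3 unfolding x y by (rule chan_c_joint[OF e])
  qed
  have norm: "env_weight i = (\<Sum>x<?n. (cmod (env_vec i x))\<^sup>2)" if i: "i \<in> {..<d + d + 1}" for i
  proof -
    have "i < d \<or> (\<exists>k<d. i = d + k) \<or> i = d + d"
      using i by (cases "i < d"; cases "i < d + d") (auto intro!: exI[of _ "i - d"])
    then consider "i < d" | k where "k < d" "i = d + k" | "i = d + d" by blast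
    then show ?thesis
    proof cases
      case 1
      have "(\<Sum>x<?n. (cmod (env_vec i x))\<^sup>2) = (\<Sum>e1<d. \<Sum>e2<Suc d. if e2 = d then (if e1 = i then \<mu> i * (1 / 2) else 0) else 0)"
        unfolding sum_divmod using 1 mu(1) by (intro sum.cong refl) (auto simp: env_vec_apply simp del: mult_Suc_right)
      then show ?thesis using 1 by (simp add: sum.delta env_weight_def)
    next
      case 2
      have "(\<Sum>x<?n. (cmod (env_vec i x))\<^sup>2) = (\<Sum>e1<d. \<Sum>e2<Suc d. if e2 = j0 then (if e1 = k then \<mu> k * (1 / 4) else 0) else 0)"
        unfolding sum_divmod using 2 mu(1) by (intro sum.cong refl) (auto simp: env_vec_apply norm_divide power_divide simp del: mult_Suc_right)
      then show ?thesis using 2 j0 by (simp add: sum.delta env_weight_def)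
    next
      case 3
      have "(\<Sum>x<?n. (cmod (env_vec i x))\<^sup>2) = (\<Sum>e1<d. \<Sum>e2<Suc d. if e2 = e1 then \<mu> e1 * (1 / 4) else 0)"
        unfolding sum_divmod using 3 mu(1) by (intro sum.cong refl) (auto simp: env_vec_apply norm_divide power_divide simp del: mult_Suc_right)
      also have "\<dots> = (\<Sum>e1<d. \<mu> e1 * (1 / 4))" by (intro sum.cong refl) (simp add: sum.delta)
      also have "\<dots> = 1 / 4" using mu(2) by (simp only: sum_distrib_right[symmetric] mult_1_left)
      finally show ?thesis using 3 by (simp add: env_weight_def)
    qed
  qed
  have sum1: "(\<Sum>i<d + d + 1. env_weight i) = 1"
    unfolding sum_env_split by (simp add: env_weight_def sum_divide_distrib[symmetric] mu(2))
  \<comment> \<open>The two vectors share the basis vector \<open>|j0>|j0>\<close>, each with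
    amplitude \<open>sqrt (\<mu> j0) / 2\<close>; the positivity of \<open>\<mu> j0\<close> enters
    here.\<close>
  have nonorth: "ip {..<?n} (env_vec (d + j0)) (env_vec (d + d)) \<noteq> 0"
  proof -
    have "ip {..<?n} (env_vec (d + j0)) (env_vec (d + d)) = (\<Sum>e1<d. \<Sum>e2<Suc d. if e2 = j0 then (if e1 = j0 then of_real (\<mu> j0 * (1 / 4)) else 0) else 0)"
      unfolding ip_def sum_divmod using j0 sq_mu[OF j0(1)]
      by (intro sum.cong refl) (auto simp: env_vec_apply simp del: mult_Suc_right)
    also have "\<dots> = of_real (\<mu> j0 * (1 / 4))" using j0 by (simp add: sum.delta)
    finally have e: "ip {..<?n} (env_vec (d + j0)) (env_vec (d + d)) = of_real (\<mu> j0 * (1 / 4))" .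
    show ?thesis unfolding e using j0(2) by simp
  qed
  have "- (\<Sum>k<?n. eta (l k)) < - (\<Sum>i<d + d + 1. eta (env_weight i))"
    by (rule entropy_decomp(2)[OF s finite_lessThan gram norm sum1 _ _ _ nonorth]) (use j0 in auto)
  also have "(\<Sum>i<d + d + 1. eta (env_weight i)) = (\<Sum>i<d. eta (\<mu> i * (1 / 2))) + (\<Sum>i<d. eta (\<mu> i * (1 / 4))) + eta (1 / 4)"
    unfolding sum_env_split by (simp add: env_weight_def)
  also have "(\<Sum>i<d. eta (\<mu> i * (1 / 4))) = - 1 / 2 + (\<Sum>i<d. eta (\<mu> i)) / 4"
    by (rule sum_eta_quarter)
  also have "(\<Sum>i<d. eta (\<mu> i * (1 / 2))) = - 1 / 2 + (\<Sum>i<d. eta (\<mu> i)) / 2"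
    by (rule sum_eta_half)
  also have "eta (1 / 4) = - 1 / 2"
    using log2_quarter by (simp add: eta_def)
  finally show ?thesis using S by simp
qed

lemma Qcap_joint: "Qcap joint > 1 / 2"
proof -
  \<comment> \<open>The entropy of \<mu> has the coefficient \<open>3/4\<close> on both sides and
    cancels, leaving \<open>2 - 3/2\<close>.\<close>
  have "coh_info joint input_state > 1 / 2"
    unfolding coh_info_def using entropy_chan_joint entropy_chan_c_joint by simp
  also have "coh_info joint input_state \<le> Q1 joint"
    using density_input_state by (intro coh_info_le_Q1[OF valid_joint]) simp
  also have "\<dots> \<le> Qcap joint" by (rule Q1_le_Qcap[OF valid_joint])
  finally show ?thesis .
qed

end

theorem theorem3:
  fixes d :: nat and \<mu> :: "nat \<Rightarrow> real"
  assumes "d \<ge> 1"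
    and "\<forall>i<d. \<mu> i \<ge> 0"
    and "(\<Sum>i<d. \<mu> i) = 1"
    and "Max (\<mu> ` {..<d}) \<in> {1 / real d .. 3 - 2 * sqrt 2}"
  shows "\<exists>lam::real. 0 \<le> lam \<and> lam \<le> 1 \<and>
           Qcap (tensor_iso (platypus d \<mu>) (erasure d lam))
             > Qcap (platypus d \<mu>) + Qcap (erasure d lam)"
proof (intro exI conjI)
  \<comment> \<open>Weights that sum to 1 cannot all be nonpositive; any index of positive weight
    will do.\<close>
  obtain j0 where j0: "j0 < d" "\<mu> j0 > 0"
  proof (rule ccontr)
    assume "\<not> thesis"
    then have "\<mu> i \<le> 0" if "i < d" for i using that \<open>\<And>j0. \<lbrakk>j0 < d; 0 < \<mu> j0\<rbrakk> \<Longrightarrow> thesis\<close> by force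
    then have "(\<Sum>i<d. \<mu> i) \<le> 0" by (intro sum_nonpos) auto
    then show False using assms(3) by simp
  qed
  have "Qcap (platypus d \<mu>) \<le> 1 / 2" by (rule Qcap_platypus_le[OF assms])
  moreover have "Qcap (erasure d (1 / 2)) \<le> 0"
    using assms(1) by (intro Qcap_balanced valid_erasure balanced_erasure) auto
  moreover have "Qcap (tensor_iso (platypus d \<mu>) (erasure d (1 / 2))) > 1 / 2"
    by (rule Qcap_joint[OF assms(2,3) j0])
  ultimately show "Qcap (tensor_iso (platypus d \<mu>) (erasure d (1 / 2))) > Qcap (platypus d \<mu>) + Qcap (erasure d (1 / 2))"
    by linarith
qed auto

end
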